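(* For every $\alpha\in[0,1)$ there exists a constant $C(\alpha)$ such that $$q_L(\alpha,d,d)\lesssim C(\alpha)\,d^{-\frac1{1-\alpha}}\qquad\text{as }d\to\infty .$$ More precisely, this holds with $C(0)=1$ and, for $\alpha\in(0,1)$, with $$C(\alpha)=\frac{\theta^{\frac{1}{1-\alpha}}}{e^{\theta}-1},$$ where $\theta$ is the unique (real, nonzero) solution of $\dfrac{\theta e^{\theta}}{e^{\theta}-1}=\dfrac{1}{1-\alpha}$.
   Context: Setting: site percolation on $\mathbb Z^{d+1}$. $\Omega=\{0,1\}^{\mathbb Z^{d+1}}$, and for $p\in[0,1]$, $\mathbb P_p$ is the product measure on $\Omega$ of Bernoulli distributions with parameter $p$. A site $x$ is open if $\omega(x)=1$ and closed if $\omega(x)=0$. A function $F:\mathbb Z^d\to\mathbb Z$ is Lipschitz if $|F(\bar x)-F(\bar y)|\le 1$ whenever $\Vert\bar x-\bar y\Vert_1=1$. For $\alpha\in[0,1)$ and $\eta\in\{-1,0,+1\}^d$, $\mathsf{LIP}^{\alpha,d}_\eta$ is the event of all $\omega\in\Omega$ for which there is a Lipschitz function $F$ such that for all $\bar x\in\mathbb Z^d$: $\omega((\bar x,F(\bar x)))=1$ and $F(\bar x)>\lfloor\alpha\sum_{i=1}^d\eta_i\bar x_i\rfloor$. Critical probability: there is a number $p_L(\alpha,d,\eta)\in(0,1)$ such that $\mathbb P_p(\mathsf{LIP}^{\alpha,d}_\eta)=0$ for $p<p_L(\alpha,d,\eta)$ and $=1$ for $p>p_L(\alpha,d,\eta)$;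 it depends on $\eta$ only through $k=\Vert\eta\Vert_1\in\{0,\dots,d\}$ and is written $p_L(\alpha,d,k)$. Put $q_L(\alpha,d,k):=1-p_L(\alpha,d,k)$. Notation: $f(s)\lesssim g(s)$ as $s\to\bar s$ means $\limsup_{s\to\bar s}f(s)/g(s)\le1$. *)

theory Defs
  imports "HOL-Probability.Probability"
begin

text \<open>Since the dimension \<open>d\<close> tends to infinity in the theorem, \<open>\<int>\<^sup>d\<close> is an explicit carrier
  (extensional functions with coordinates \<open>i < d\<close>) and \<open>\<int>\<^sup>d\<^sup>+\<^sup>1\<close> is \<open>\<int>\<^sup>d \<times> \<int>\<close>, whose elements are the
  pairs \<open>(x, h)\<close> of a base point and a height.\<close>

definition Zd :: "nat \<Rightarrow> (nat \<Rightarrow> int) set" where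
  "Zd d = {..<d} \<rightarrow>\<^sub>E UNIV"

definition sites :: "nat \<Rightarrow> ((nat \<Rightarrow> int) \<times> int) set" where
  "sites d = Zd d \<times> UNIV"

definition norm1 :: "nat \<Rightarrow> (nat \<Rightarrow> int) \<Rightarrow> int" where
  "norm1 d x = (\<Sum>i<d. \<bar>x i\<bar>)"

text \<open>Configurations are extensional functions from \<^term>\<open>sites d\<close> to \<^typ>\<open>bool\<close>; \<^term>\<open>True\<close> means open.\<close>

definition configs :: "nat \<Rightarrow> ((nat \<Rightarrow> int) \<times> int \<Rightarrow> bool) set" where
  "configs d = sites d \<rightarrow>\<^sub>E UNIV"

definition perc :: "nat \<Rightarrow> real \<Rightarrow> ((nat \<Rightarrow> int) \<times> int \<Rightarrow> bool) measure" where
  "perc d p = (\<Pi>\<^sub>M s\<in>sites d. measure_pmf (bernoulli_pmf p))"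

definition lipschitz_fun :: "nat \<Rightarrow> ((nat \<Rightarrow> int) \<Rightarrow> int) \<Rightarrow> bool" where
  "lipschitz_fun d F \<longleftrightarrow>
     (\<forall>x\<in>Zd d. \<forall>y\<in>Zd d. norm1 d (\<lambda>i. x i - y i) = 1 \<longrightarrow> \<bar>F x - F y\<bar> \<le> 1)"

definition directions :: "nat \<Rightarrow> (nat \<Rightarrow> int) set" where
  "directions d = {..<d} \<rightarrow>\<^sub>E {-1, 0, 1}"

definition LIP :: "real \<Rightarrow> nat \<Rightarrow> (nat \<Rightarrow> int) \<Rightarrow> ((nat \<Rightarrow> int) \<times> int \<Rightarrow> bool) set" where
  "LIP \<alpha> d \<eta> = {\<omega> \<in> configs d. \<exists>F. lipschitz_fun d F \<and>
     (\<forall>x\<in>Zd d. \<omega> (x, F x) \<and> F x > \<lfloor>\<alpha> * real_of_int (\<Sum>i<d. \<eta> i * x i)\<rfloor>)}"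

text \<open>At most one number can satisfy the two conditions below. For \<open>d \<ge> 1\<close> it lies in the open
  interval \<open>(0, 1)\<close>; the closed interval also covers \<open>d = 0\<close>, where the threshold is 0.\<close>

definition p_L_dir :: "real \<Rightarrow> nat \<Rightarrow> (nat \<Rightarrow> int) \<Rightarrow> real" where
  "p_L_dir \<alpha> d \<eta> = (THE c. 0 \<le> c \<and> c \<le> 1 \<and>
     (\<forall>p. 0 \<le> p \<and> p < c \<longrightarrow> measure (perc d p) (LIP \<alpha> d \<eta>) = 0) \<and>
     (\<forall>p. c < p \<and> p \<le> 1 \<longrightarrow> measure (perc d p) (LIP \<alpha> d \<eta>) = 1))"

text \<open>The common value of \<^term>\<open>p_L_dir \<alpha> d \<eta>\<close> over all \<^term>\<open>\<eta>\<close> with 1-norm \<open>k\<close> (meaningful for \<open>k \<le> d\<close>).\<close>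

definition p_L :: "real \<Rightarrow> nat \<Rightarrow> nat \<Rightarrow> real" where
  "p_L \<alpha> d k = (THE c. \<forall>\<eta>\<in>directions d. norm1 d \<eta> = int k \<longrightarrow> p_L_dir \<alpha> d \<eta> = c)"

definition q_L :: "real \<Rightarrow> nat \<Rightarrow> nat \<Rightarrow> real" where
  "q_L \<alpha> d k = 1 - p_L \<alpha> d k"

definition asymp_le :: "'a filter \<Rightarrow> ('a \<Rightarrow> real) \<Rightarrow> ('a \<Rightarrow> real) \<Rightarrow> bool" where
  "asymp_le A f g \<longleftrightarrow> Limsup A (\<lambda>s. ereal (f s / g s)) \<le> 1"

end

theory Submission
  imports Defs "HOL-Library.Function_Algebras" "HOL-Real_Asymp.Real_Asymp"
begin

text \<open>Let \<open>q = 1 - p\<close> be the density of closed sites and \<open>\<beta> = 1 / (1 - \<alpha>)\<close>. All coordinates of the direction may be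
taken to be \<open>1\<close>, because reflections preserve the percolation measure. A Lipschitz surface of open sites
above the plane is obstructed by descending paths: from \<open>(x, h)\<close> a path may step for free to
\<open>(x + e\<^sub>i, h + 1)\<close>, and from a closed site \<open>(x, h)\<close> it may drop to \<open>(x, h - 1)\<close>. If such a path leads from
\<open>(0, H)\<close> to a point on or below the plane, then every such surface \<open>F\<close> satisfies \<open>F 0 > H\<close>
(\<open>closed_path_lifts\<close>). If paths of this kind exist with probability at least \<open>1 / 2\<close> for every \<open>H\<close>, then surfaces
exist with probability less than \<open>1\<close>, hence with probability \<open>0\<close> by a zero-one law, and \<open>q_L \<le> q\<close> follows.

A free step gains \<open>1 - \<alpha>\<close> of height relative to the plane and a drop loses \<open>1\<close>, so a useful path has about
\<open>\<beta>\<close> free steps per drop. Consider paths that make \<open>k \<ge> 1\<close> free steps in distinct directions before every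
drop. There are about \<open>d\<^sup>k / k!\<close> choices for these steps, so the number of such paths with \<open>b\<close> drops and
\<open>\<beta> b\<close> free steps is \<open>d\<close> to the power \<open>\<beta> b\<close> times the coefficient of order \<open>\<beta> b\<close> of the function
\<open>(exp t - 1)\<close> to the power \<open>b\<close>. The latter grows like the \<open>b\<close>-th power of the minimum of
\<open>(exp t - 1) t powr - \<beta>\<close> over \<open>t > 0\<close>. The minimum is attained at the solution \<open>\<theta>\<close> of
\<open>\<theta> exp \<theta> / (exp \<theta> - 1) = \<beta>\<close> and equals \<open>1 / C\<close>. Therefore the expected number of paths all of whose
drops start at closed sites grows exponentially as soon as \<open>q\<close> exceeds \<open>C d powr - \<beta>\<close> by a constant factor.
For \<open>\<alpha> = 0\<close> only \<open>k = 1\<close> is left, and \<open>C = 1\<close>.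

To pass from expectations to probabilities, the second moment method needs a bound, for a fixed target
path, on the average of \<open>(1 / q)\<close> to the power of the number of shared drop sites (\<open>LIP_not_almost_sure\<close>).
Three devices give a bound that is uniform in the length of the paths.

\<^item> Blocks of \<open>b\<close> drops have a prescribed number of free steps, chosen among two values around \<open>\<beta> b\<close>, so that
  a path follows the plane up to a bounded error. Then initial segments that agree with the target cost
  only a power of \<open>d\<close> (\<open>card_stretch_ge\<close>), and a path that leaves the target and comes back to it has few choices
  on the way (\<open>pinned_overlap_sum\<close>).
\<^item> Of order \<open>log d\<close> blocks form a superblock. The exponential surplus of paths over its length exceeds any
  given power of \<open>d\<close>, which pays for \<open>z\<close> additional drops at the end of the superblock; these are what makes
  the path gain on the plane (\<open>superblock_overlap_sum\<close>).
\<^item> A few coordinates are reserved, about \<open>d powr (1 / 3)\<close> in number up to a constant factor. At the start of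
  each superblock the path makes one random step in each of finitely many groups of reserved coordinates.
  A superblock contributes overlaps only if the reserved coordinates agree with those of the target. These
  perform a transient random walk relative to the target, and its returns are so rare that this outweighs the
  power of \<open>d\<close> lost per superblock (\<open>hit_reserved_sum_le\<close>, \<open>long_path_overlap_sum\<close>).\<close>

section \<open>The critical value\<close>

text \<open>Resetting the first \<open>n\<close> coordinates to a reference point does not affect the event, so it is measurable with
respect to the remaining coordinates for every \<open>n\<close>, and Kolmogorov's law applies.\<close>

lemma finite_change_invariant_0_1:
  fixes M :: "'i \<Rightarrow> 'a measure"
  assumes M: "\<And>i. prob_space (M i)"
    and I: "countable I" "infinite I"
    and T: "T \<in> sets (PiM I M)"
    and inv: "\<And>x y. x \<in> space (PiM I M) \<Longrightarrow> y \<in> space (PiM I M) \<Longrightarrow>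
                finite {i \<in> I. x i \<noteq> y i} \<Longrightarrow> x \<in> T \<Longrightarrow> y \<in> T"
  shows "measure (PiM I M) T = 0 \<or> measure (PiM I M) T = 1"
proof -
  interpret product_prob_space M I
    using M by (simp add: product_prob_space_def product_prob_space_axioms_def product_sigma_finite_def prob_space_imp_sigma_finite)
  let ?P = "PiM I M"
  define e where "e = from_nat_into I"
  have e: "bij_betw e UNIV I"
    unfolding e_def using bij_betw_from_nat_into[OF I] .
  have eI: "e k \<in> I" for k using e by (auto simp: bij_betw_def)
  have einj: "inj e" using e by (auto simp: bij_betw_def)
  define pre where "pre k = {(\<lambda>w. w (e k)) -` X \<inter> space ?P | X. X \<in> sets (M (e k))}" for k
  define A where "A k = sigma_sets (space ?P) (pre k)" for k
  have pre_sub: "pre k \<subseteq> Pow (space ?P)" for k by (auto simp: pre_def)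
  have sa: "sigma_algebra (space ?P) (A k)" for k
    unfolding A_def by (rule sigma_algebra_sigma_sets[OF pre_sub])
  have pre_ev: "pre k \<subseteq> sets ?P" for k
    unfolding pre_def using measurable_sets[OF measurable_component_singleton[OF eI[of k]]] by auto
  have "P.indep_sets pre UNIV"
  proof (rule P.indep_setsI)
    show "pre i \<subseteq> P.events" for i by (rule pre_ev)
  next
    fix S :: "nat \<Rightarrow> ('i \<Rightarrow> 'a) set" and J :: "nat set"
    assume J: "J \<noteq> {}" "finite J" and S: "\<forall>j\<in>J. S j \<in> pre j"
    from S have "\<forall>j\<in>J. \<exists>X. X \<in> sets (M (e j)) \<and> S j = (\<lambda>w. w (e j)) -` X \<inter> space ?P"
      by (auto simp: pre_def)
    then obtain X where X: "\<And>j. j \<in> J \<Longrightarrow> X j \<in> sets (M (e j))"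
      and SX: "\<And>j. j \<in> J \<Longrightarrow> S j = (\<lambda>w. w (e j)) -` X j \<inter> space ?P"
      by metis
    have ie: "inv e (e j) = j" for j using einj by simp
    have "(\<Inter>j\<in>J. S j) = prod_emb I M (e ` J) (\<Pi>\<^sub>E i\<in>e ` J. X (inv e i))"
      using J(1) by (auto simp: SX prod_emb_def space_PiM ie PiE_iff)
    then have "P.prob (\<Inter>j\<in>J. S j) = (\<Prod>i\<in>e ` J. measure (M i) (X (inv e i)))"
      using J X eI by (subst measure_PiM_emb[symmetric]) (auto simp: ie)
    also have "\<dots> = (\<Prod>j\<in>J. measure (M (e j)) (X j))"
      by (subst prod.reindex) (auto intro: inj_on_subset[OF einj] simp: ie)
    also have "\<dots> = (\<Prod>j\<in>J. P.prob (S j))"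
    proof (rule prod.cong[OF refl])
      fix j assume j: "j \<in> J"
      have "S j = prod_emb I M {e j} (\<Pi>\<^sub>E i\<in>{e j}. X j)"
        by (auto simp: SX[OF j] prod_emb_def space_PiM PiE_iff)
      then show "measure (M (e j)) (X j) = P.prob (S j)"
        using X[OF j] eI measure_PiM_emb[of "{e j}" "\<lambda>_. X j"] by simp
    qed
    finally show "P.prob (\<Inter>j\<in>J. S j) = (\<Prod>j\<in>J. P.prob (S j))" .
  qed
  then have ind: "P.indep_sets A UNIV"
    unfolding A_def
  proof (rule P.indep_sets_sigma)
    fix k
    show "Int_stable (pre k)"
    proof (rule Int_stableI)
      fix a b assume "a \<in> pre k" "b \<in> pre k"
      then obtain X Y where "X \<in> sets (M (e k))" "Y \<in> sets (M (e k))"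
        "a = (\<lambda>w. w (e k)) -` X \<inter> space ?P" "b = (\<lambda>w. w (e k)) -` Y \<inter> space ?P"
        by (auto simp: pre_def)
      then have "a \<inter> b = (\<lambda>w. w (e k)) -` (X \<inter> Y) \<inter> space ?P" "X \<inter> Y \<in> sets (M (e k))" by auto
      then show "a \<inter> b \<in> pre k" unfolding pre_def by blast
    qed
  qed
  obtain w0 where w0: "w0 \<in> space ?P" using P.not_empty by blast
  have "T \<in> P.tail_events A"
    unfolding P.tail_events_def
  proof
    fix n
    let ?G = "\<Union> (A ` {n..})"
    have Gsub: "?G \<subseteq> Pow (space ?P)"
      unfolding A_def using sigma_sets_into_sp[OF pre_sub] by blast
    let ?N = "sigma (space ?P) ?G"
    define r where "r w i = (if i \<in> e ` {..<n} then w0 i else w i)" for w :: "'i \<Rightarrow> 'a" and i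
    have rm: "r \<in> measurable ?N ?P"
      unfolding r_def
    proof (rule measurable_PiM_single')
      fix i assume i: "i \<in> I"
      then obtain k where k: "i = e k" using e by (auto simp: bij_betw_def)
      show "(\<lambda>w. if i \<in> e ` {..<n} then w0 i else w i) \<in> measurable ?N (M i)"
      proof (cases "i \<in> e ` {..<n}")
        case True
        then show ?thesis using w0 i by (simp add: space_PiM PiE_iff)
      next
        case False
        then have kn: "k \<ge> n" using k by (meson image_eqI lessThan_iff not_le)
        have "(\<lambda>w. w i) \<in> measurable ?N (M i)"
        proof (rule measurableI)
          show "w \<in> space ?N \<Longrightarrow> w i \<in> space (M i)" for w
            using i unfolding space_measure_of[OF Gsub] by (simp add: space_PiM PiE_iff)
        next
          fix X assume X: "X \<in> sets (M i)"
          have "(\<lambda>w. w i) -` X \<inter> space ?P \<in> A k"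
            unfolding A_def by (rule sigma_sets.Basic) (use X k in \<open>auto simp: pre_def\<close>)
          then have "(\<lambda>w. w i) -` X \<inter> space ?P \<in> ?G" using kn by auto
          then show "(\<lambda>w. w i) -` X \<inter> space ?N \<in> sets ?N"
            using Gsub by (simp add: space_measure_of sets_measure_of)
        qed
        then show ?thesis using False by simp
      qed
    next
      show "(\<lambda>w i. if i \<in> e ` {..<n} then w0 i else w i) \<in> space ?N \<rightarrow> (\<Pi>\<^sub>E i\<in>I. space (M i))"
        using w0 eI unfolding space_measure_of[OF Gsub] by (auto simp: space_PiM PiE_iff extensional_def)
    qed
    have rin: "r w \<in> space ?P" if "w \<in> space ?P" for w
      using rm that Gsub by (auto simp: measurable_def space_measure_of)
    have fin: "finite {i \<in> I. r w i \<noteq> w i}" "finite {i \<in> I. w i \<noteq> r w i}" for w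
      by (rule finite_subset[of _ "e ` {..<n}"]; auto simp: r_def)+
    have "r -` T \<inter> space ?P = T"
    proof
      show "r -` T \<inter> space ?P \<subseteq> T"
        using inv[OF rin _ fin(1)] by auto
      show "T \<subseteq> r -` T \<inter> space ?P"
        using inv[OF _ rin fin(2)] sets.sets_into_space[OF T] by blast
    qed
    moreover have "r -` T \<inter> space ?N \<in> sets ?N"
      by (rule measurable_sets[OF rm T])
    ultimately show "T \<in> sigma_sets (space ?P) ?G"
      using Gsub by (simp add: space_measure_of sets_measure_of)
  qed
  from P.kolmogorov_0_1_law[OF sa ind this] show ?thesis .
qed

interpretation perc: product_prob_space "\<lambda>s. measure_pmf (bernoulli_pmf p)" "sites d" for p d
  by unfold_locales

lemma prob_space_perc: "prob_space (perc d p)"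
  unfolding perc_def by (rule perc.prob_space_axioms)

lemma space_perc: "space (perc d p) = configs d"
  by (simp add: perc_def space_PiM configs_def)

lemma sets_perc: "sets (perc d p) = sets (perc d p')"
  unfolding perc_def by (intro sets_PiM_cong) auto

lemma countable_sites: "countable (sites d)"
  unfolding sites_def Zd_def by (intro countable_SIGMA countable_PiE) auto

lemma Zd_nonempty: "(\<lambda>i\<in>{..<d}. 0) \<in> Zd d"
  by (auto simp: Zd_def)

lemma infinite_sites: "infinite (sites d)"
  unfolding sites_def using Zd_nonempty[of d]
  by (auto simp: finite_cartesian_product_iff infinite_UNIV_int)

lemma all_closed_event:
  assumes "finite J" "J \<subseteq> sites d" "0 \<le> p" "p \<le> 1"
  shows "{w \<in> configs d. \<forall>s\<in>J. \<not> w s} \<in> sets (perc d p)"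
    and "measure (perc d p) {w \<in> configs d. \<forall>s\<in>J. \<not> w s} = (1 - p) ^ card J"
proof -
  interpret P: prob_space "perc d p" by (rule prob_space_perc)
  have eq: "{w \<in> configs d. \<forall>s\<in>J. \<not> w s} = {w \<in> space (perc d p). \<forall>s\<in>J. w s \<in> {False}}"
    by (auto simp: space_perc)
  show "{w \<in> configs d. \<forall>s\<in>J. \<not> w s} \<in> sets (perc d p)"
    unfolding eq perc_def
  proof (rule sets.sets_Collect_finite_All)
    fix s assume "s \<in> J"
    then have "s \<in> sites d" using assms(2) by auto
    then show "{w \<in> space (\<Pi>\<^sub>M s\<in>sites d. measure_pmf (bernoulli_pmf p)). w s \<in> {False}}
        \<in> sets (\<Pi>\<^sub>M s\<in>sites d. measure_pmf (bernoulli_pmf p))"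
      by (intro sets_Collect_single') auto
  qed (fact assms(1))
  have "measure (measure_pmf (bernoulli_pmf p)) {False} = 1 - p"
    using assms by (simp add: measure_pmf_single)
  then have "emeasure (measure_pmf (bernoulli_pmf p)) {False} = ennreal (1 - p)"
    by (simp add: measure_pmf.emeasure_eq_measure)
  then have "emeasure (perc d p) {w \<in> configs d. \<forall>s\<in>J. \<not> w s} = ennreal ((1 - p) ^ card J)"
    unfolding eq perc_def using assms by (subst perc.emeasure_PiM_Collect) (auto simp: ennreal_power)
  then show "measure (perc d p) {w \<in> configs d. \<forall>s\<in>J. \<not> w s} = (1 - p) ^ card J"
    using assms by (simp add: measure_def)
qed

text \<open>General obstacles \<open>\<phi>\<close> are needed because the zero-one law compares a plane with its vertical translates.\<close>

definition lip_above :: "nat \<Rightarrow> ((nat \<Rightarrow> int) \<Rightarrow> int) \<Rightarrow> ((nat \<Rightarrow> int) \<times> int \<Rightarrow> bool) set" where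
  "lip_above d \<phi> = {\<omega> \<in> configs d. \<exists>F. lipschitz_fun d F \<and> (\<forall>x\<in>Zd d. \<omega> (x, F x) \<and> F x > \<phi> x)}"

lemma LIP_eq_lip_above: "LIP \<alpha> d \<eta> = lip_above d (\<lambda>x. \<lfloor>\<alpha> * real_of_int (\<Sum>i<d. \<eta> i * x i)\<rfloor>)"
  by (simp add: LIP_def lip_above_def)

lemma measure_perc_reindex:
  assumes f: "inj_on f (sites d)" "f \<in> sites d \<rightarrow> sites d" and T: "T \<in> sets (perc d p)"
  shows "measure (perc d p) {w \<in> configs d. (\<lambda>s\<in>sites d. w (f s)) \<in> T} = measure (perc d p) T"
    and "{w \<in> configs d. (\<lambda>s\<in>sites d. w (f s)) \<in> T} \<in> sets (perc d p)"
proof -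
  let ?t = "\<lambda>w. \<lambda>s\<in>sites d. w (f s)"
  have m: "?t \<in> measurable (perc d p) (perc d p)"
    unfolding perc_def using f by (intro measurable_restrict measurable_component_singleton) auto
  have eq: "{w \<in> configs d. ?t w \<in> T} = ?t -` T \<inter> space (perc d p)"
    by (auto simp: space_perc)
  show "{w \<in> configs d. ?t w \<in> T} \<in> sets (perc d p)"
    unfolding eq by (rule measurable_sets[OF m T])
  have "measure (perc d p) T = measure (distr (perc d p) (perc d p) ?t) T"
    unfolding perc_def by (subst distr_PiM_reindex) (use f in \<open>auto simp: measure_pmf.prob_space_axioms\<close>)
  also have "\<dots> = measure (perc d p) (?t -` T \<inter> space (perc d p))"
    by (rule measure_distr[OF m T])
  finally show "measure (perc d p) {w \<in> configs d. ?t w \<in> T} = measure (perc d p) T"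
    unfolding eq by simp
qed

definition lift_site :: "int \<Rightarrow> (nat \<Rightarrow> int) \<times> int \<Rightarrow> (nat \<Rightarrow> int) \<times> int" where
  "lift_site m s = (fst s, snd s + m)"

lemma lift_site_sites:
  "inj_on (lift_site m) (sites d)" "lift_site m \<in> sites d \<rightarrow> sites d"
  by (auto simp: lift_site_def inj_on_def sites_def)

lemma lip_above_lift:
  "{w \<in> configs d. (\<lambda>s\<in>sites d. w (lift_site m s)) \<in> lip_above d \<phi>} = lip_above d (\<lambda>x. \<phi> x + m)"
proof -
  have 1: "(\<exists>F. lipschitz_fun d F \<and> (\<forall>x\<in>Zd d. (\<lambda>s\<in>sites d. w (lift_site m s)) (x, F x) \<and> F x > \<phi> x)) \<longleftrightarrow>
        (\<exists>F. lipschitz_fun d F \<and> (\<forall>x\<in>Zd d. w (x, F x) \<and> F x > \<phi> x + m))" (is "?L \<longleftrightarrow> ?R") for w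
  proof
    assume ?L
    then obtain F where "lipschitz_fun d F" "\<forall>x\<in>Zd d. (\<lambda>s\<in>sites d. w (lift_site m s)) (x, F x) \<and> F x > \<phi> x" by auto
    then show ?R
      by (intro exI[of _ "\<lambda>x. F x + m"]) (auto simp: lipschitz_fun_def lift_site_def sites_def)
  next
    assume ?R
    then obtain F where "lipschitz_fun d F" "\<forall>x\<in>Zd d. w (x, F x) \<and> F x > \<phi> x + m" by auto
    then show ?L
      by (intro exI[of _ "\<lambda>x. F x - m"]) (fastforce simp: lipschitz_fun_def lift_site_def sites_def)
  qed
  have 2: "(\<lambda>s\<in>sites d. w (lift_site m s)) \<in> configs d" for w
    by (auto simp: configs_def)
  show ?thesis unfolding lip_above_def using 1 2 by simp
qed

lemma lip_above_antimono:
  assumes "\<And>x. x \<in> Zd d \<Longrightarrow> \<phi> x \<le> \<psi> x" shows "lip_above d \<psi> \<subseteq> lip_above d \<phi>"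
  using assms unfolding lip_above_def by fastforce

text \<open>The event itself may change when finitely many sites are changed. The event that there is a surface above
every vertical translate of the obstacle does not: a surface above a sufficiently high translate avoids
the changed sites. It has the same probability, since it is a decreasing limit of translates of the original
event. An event that is not measurable has \<open>measure\<close> zero.\<close>

lemma lip_above_0_1:
  "measure (perc d p) (lip_above d \<phi>) = 0 \<or> measure (perc d p) (lip_above d \<phi>) = 1"
proof (cases "lip_above d \<phi> \<in> sets (perc d p)")
  case False
  then show ?thesis by (simp add: measure_notin_sets)
next
  case True
  interpret P: prob_space "perc d p" by (rule prob_space_perc)
  define E where "E m = lip_above d (\<lambda>x. \<phi> x + int m)" for m
  have E: "E m \<in> P.events" "P.prob (E m) = P.prob (lip_above d \<phi>)" for m
    using measure_perc_reindex[OF lift_site_sites True, of "int m"]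
    by (simp_all add: lip_above_lift E_def)
  have dec: "decseq E"
    unfolding decseq_def E_def by (intro allI impI lip_above_antimono) auto
  let ?T = "\<Inter>m. E m"
  have T: "?T \<in> P.events" using E(1) by auto
  have "(\<lambda>m. P.prob (E m)) \<longlonglongrightarrow> P.prob ?T"
    using E(1) dec by (intro P.finite_Lim_measure_decseq) auto
  then have PT: "P.prob ?T = P.prob (lip_above d \<phi>)"
    unfolding E(2) by (simp add: LIMSEQ_const_iff)
  have "measure (\<Pi>\<^sub>M s\<in>sites d. measure_pmf (bernoulli_pmf p)) ?T = 0 \<or>
        measure (\<Pi>\<^sub>M s\<in>sites d. measure_pmf (bernoulli_pmf p)) ?T = 1"
  proof (rule finite_change_invariant_0_1[OF measure_pmf.prob_space_axioms countable_sites infinite_sites])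
    show "?T \<in> sets (\<Pi>\<^sub>M s\<in>sites d. measure_pmf (bernoulli_pmf p))"
      using T by (simp add: perc_def)
  next
    fix w w' assume w: "w \<in> space (\<Pi>\<^sub>M s\<in>sites d. measure_pmf (bernoulli_pmf p))"
      "w' \<in> space (\<Pi>\<^sub>M s\<in>sites d. measure_pmf (bernoulli_pmf p))"
      and fin: "finite {s \<in> sites d. w s \<noteq> w' s}" and wT: "w \<in> ?T"
    from w have wc: "w' \<in> configs d" by (simp_all add: space_perc[unfolded perc_def])
    let ?D = "{s \<in> sites d. w s \<noteq> w' s}"
    \<comment> \<open>Above this level the changed sites lie below the obstacle, so they are never used.\<close>
    define m0 where "m0 = nat (Max (insert 0 ((\<lambda>s. snd s - \<phi> (fst s)) ` ?D)))"
    have m0: "snd s \<le> \<phi> (fst s) + int m0" if "s \<in> ?D" for s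
    proof -
      have "snd s - \<phi> (fst s) \<le> Max (insert 0 ((\<lambda>s. snd s - \<phi> (fst s)) ` ?D))"
        using fin that by (intro Max_ge) auto
      then show ?thesis unfolding m0_def by linarith
    qed
    show "w' \<in> ?T"
    proof
      fix m
      have "w \<in> E (m + m0)" using wT by auto
      then obtain F where F: "lipschitz_fun d F"
        "\<And>x. x \<in> Zd d \<Longrightarrow> w (x, F x) \<and> F x > \<phi> x + int (m + m0)"
        by (auto simp: E_def lip_above_def)
      have "w' (x, F x) \<and> F x > \<phi> x + int m" if x: "x \<in> Zd d" for x
      proof -
        have "(x, F x) \<notin> ?D" using m0[of "(x, F x)"] F(2)[OF x] by fastforce
        then have "w' (x, F x) = w (x, F x)" using x by (auto simp: sites_def)
        then show ?thesis using F(2)[OF x] by auto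
      qed
      then show "w' \<in> E m" using F(1) wc by (auto simp: E_def lip_above_def)
    qed
  qed
  then show ?thesis unfolding PT[symmetric] by (simp add: perc_def)
qed


text \<open>One product of uniform laws realises all percolation measures at the same time.\<close>

lemma perc_uniform_coupling:
  fixes p :: real
  assumes "0 \<le> p" "p \<le> 1"
  defines "U \<equiv> uniform_measure lborel {0..1::real}"
  shows "distr (\<Pi>\<^sub>M s\<in>sites d. U) (perc d p) (\<lambda>u. \<lambda>s\<in>sites d. u s \<le> p) = perc d p"
    and "(\<lambda>u. \<lambda>s\<in>sites d. u s \<le> p) \<in> measurable (\<Pi>\<^sub>M s\<in>sites d. U) (perc d p)"
    and "prob_space U"
proof -
  show U: "prob_space U" unfolding U_def by (rule prob_space_uniform_measure) auto
  interpret U: product_prob_space "\<lambda>s. U" "sites d"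
    using U by (simp add: product_prob_space_def product_prob_space_axioms_def product_sigma_finite_def prob_space_imp_sigma_finite)
  have sU: "sets U = sets borel" "space U = UNIV" by (simp_all add: U_def)
  have m1: "(\<lambda>x. x \<le> p) \<in> measurable U (measure_pmf (bernoulli_pmf p))"
  proof -
    have "(\<lambda>x. x \<le> p) \<in> measurable borel (count_space UNIV)" by measurable
    then show ?thesis by (simp cong: measurable_cong_sets add: measurable_cong_sets[OF sU(1) refl])
  qed
  show m: "(\<lambda>u. \<lambda>s\<in>sites d. u s \<le> p) \<in> measurable (\<Pi>\<^sub>M s\<in>sites d. U) (perc d p)"
    unfolding perc_def
  proof (intro measurable_restrict)
    fix s assume "s \<in> sites d"
    then show "(\<lambda>u. u s \<le> p) \<in> measurable (\<Pi>\<^sub>M s\<in>sites d. U) (measure_pmf (bernoulli_pmf p))"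
      by (rule measurable_compose[OF measurable_component_singleton[of s "sites d" "\<lambda>_. U"] m1])
  qed
  have law: "emeasure U {x. (x \<le> p) \<in> B} = emeasure (measure_pmf (bernoulli_pmf p)) B" for B
  proof -
    have 1: "emeasure U {x. x \<le> p} = ennreal p"
    proof -
      have "emeasure U {x. x \<le> p} = emeasure lborel ({0..1} \<inter> {x. x \<le> p})"
        unfolding U_def by (subst emeasure_uniform_measure) (auto simp: divide_ennreal_def)
      also have "{0..1} \<inter> {x. x \<le> p} = {0..p}" using assms by auto
      finally show ?thesis using assms by simp
    qed
    then have T: "measure U {x. x \<le> p} = p" using assms by (simp add: measure_def)
    have "measure U (space U - {x. x \<le> p}) = 1 - p"
      using prob_space.prob_compl[OF U, of "{x. x \<le> p}"] T by (simp add: sU)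
    then have F: "measure U {x. \<not> x \<le> p} = 1 - p" by (simp add: sU Compl_eq_Diff_UNIV[symmetric] Collect_neg_eq)
    have B: "B = {} \<or> B = {True} \<or> B = {False} \<or> B = UNIV"
    proof -
      have "B \<in> Pow {False, True}" using UNIV_bool by auto
      then show ?thesis unfolding Pow_insert Pow_empty UNIV_bool by auto
    qed
    have "measure U {x. (x \<le> p) \<in> B} = measure (measure_pmf (bernoulli_pmf p)) B"
      using B T F assms prob_space.prob_space[OF U] by (auto simp: measure_pmf_single sU)
    then show ?thesis by (simp add: finite_measure.emeasure_eq_measure[OF prob_space.finite_measure[OF U]] measure_pmf.emeasure_eq_measure)
  qed
  show "distr (\<Pi>\<^sub>M s\<in>sites d. U) (perc d p) (\<lambda>u. \<lambda>s\<in>sites d. u s \<le> p) = perc d p"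
    unfolding perc_def
  proof (rule perc.PiM_eq)
    fix J and F :: "_ \<Rightarrow> bool set"
    assume J: "finite J" "J \<subseteq> sites d"
    have "(\<lambda>u. \<lambda>s\<in>sites d. u s \<le> p) -` prod_emb (sites d) (\<lambda>s. measure_pmf (bernoulli_pmf p)) J (Pi\<^sub>E J F) \<inter> space (\<Pi>\<^sub>M s\<in>sites d. U)
        = {u \<in> space (\<Pi>\<^sub>M s\<in>sites d. U). \<forall>s\<in>J. u s \<in> {x. (x \<le> p) \<in> F s}}"
    proof -
      have JI: "s \<in> sites d" if "s \<in> J" for s using that J by auto
      show ?thesis
        by (auto simp: prod_emb_def PiE_iff JI simp del: split_paired_All)
    qed
    moreover have "emeasure (\<Pi>\<^sub>M s\<in>sites d. U) {u \<in> space (\<Pi>\<^sub>M s\<in>sites d. U). \<forall>s\<in>J. u s \<in> {x. (x \<le> p) \<in> F s}}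
        = (\<Prod>s\<in>J. emeasure U {x. (x \<le> p) \<in> F s})"
      using J measurable_sets[OF m1] by (intro U.emeasure_PiM_Collect) (auto simp: vimage_def sU)
    ultimately show "emeasure (distr (\<Pi>\<^sub>M s\<in>sites d. U) (Pi\<^sub>M (sites d) (\<lambda>s. measure_pmf (bernoulli_pmf p))) (\<lambda>u. \<lambda>s\<in>sites d. u s \<le> p))
        (prod_emb (sites d) (\<lambda>s. measure_pmf (bernoulli_pmf p)) J (Pi\<^sub>E J F)) = (\<Prod>j\<in>J. emeasure (measure_pmf (bernoulli_pmf p)) (F j))"
      using J m by (subst emeasure_distr) (auto simp: perc_def law)
  qed simp
qed

text \<open>Open sites of the coupled configurations are monotone in \<open>p\<close>, and so is the event.\<close>

lemma measure_lip_above_mono: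
  assumes "0 \<le> p" "p \<le> p'" "p' \<le> 1"
  shows "measure (perc d p) (lip_above d \<phi>) \<le> measure (perc d p') (lip_above d \<phi>)"
proof (cases "lip_above d \<phi> \<in> sets (perc d p)")
  case False
  then show ?thesis by (simp add: measure_notin_sets)
next
  case True
  define U where "U = uniform_measure lborel {0..1::real}"
  let ?N = "\<Pi>\<^sub>M s\<in>sites d. U"
  let ?t = "\<lambda>p u. \<lambda>s\<in>sites d. u s \<le> p"
  have True': "lip_above d \<phi> \<in> sets (perc d p')" using True sets_perc by blast
  have p: "0 \<le> p" "p \<le> 1" "0 \<le> p'" "p' \<le> 1" using assms by auto
  interpret N: prob_space ?N
    unfolding U_def using perc_uniform_coupling(3)[OF p(1,2)] by (intro prob_space_PiM)
  note c = perc_uniform_coupling(1,2)[OF p(1,2), where d = d, folded U_def]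
  note c' = perc_uniform_coupling(1,2)[OF p(3,4), where d = d, folded U_def]
  have "measure (perc d p) (lip_above d \<phi>) = measure (distr ?N (perc d p) (?t p)) (lip_above d \<phi>)"
    by (simp add: c)
  also have "\<dots> = N.prob (?t p -` lip_above d \<phi> \<inter> space ?N)"
    by (rule measure_distr[OF c(2) True])
  also have "\<dots> \<le> N.prob (?t p' -` lip_above d \<phi> \<inter> space ?N)"
  proof (rule N.finite_measure_mono)
    show "?t p' -` lip_above d \<phi> \<inter> space ?N \<in> N.events" by (rule measurable_sets[OF c'(2) True'])
    show "?t p -` lip_above d \<phi> \<inter> space ?N \<subseteq> ?t p' -` lip_above d \<phi> \<inter> space ?N"
    proof
      fix u assume u: "u \<in> ?t p -` lip_above d \<phi> \<inter> space ?N"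
      then obtain F where F: "lipschitz_fun d F" "\<And>x. x \<in> Zd d \<Longrightarrow> ?t p u (x, F x) \<and> F x > \<phi> x"
        by (auto simp: lip_above_def)
      have "?t p' u (x, F x) \<and> F x > \<phi> x" if x: "x \<in> Zd d" for x
        using F(2)[OF x] x assms(2) by (auto simp: sites_def)
      moreover have "?t p' u \<in> configs d" by (auto simp: configs_def)
      ultimately show "u \<in> ?t p' -` lip_above d \<phi> \<inter> space ?N"
        using u F(1) unfolding lip_above_def by blast
    qed
  qed
  also have "\<dots> = measure (distr ?N (perc d p') (?t p')) (lip_above d \<phi>)"
    by (rule measure_distr[OF c'(2) True', symmetric])
  also have "\<dots> = measure (perc d p') (lip_above d \<phi>)" by (simp add: c')
  finally show ?thesis .
qed

definition reflect_base :: "nat \<Rightarrow> (nat \<Rightarrow> int) \<Rightarrow> (nat \<Rightarrow> int) \<Rightarrow> (nat \<Rightarrow> int)" where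
  "reflect_base d \<eta> x = (\<lambda>i\<in>{..<d}. \<eta> i * x i)"

lemma reflect_base_invol:
  assumes "\<And>i. i < d \<Longrightarrow> \<bar>\<eta> i\<bar> = 1" "x \<in> Zd d"
  shows "reflect_base d \<eta> (reflect_base d \<eta> x) = x"
proof -
  have "\<eta> i * (\<eta> i * x i) = x i" if "i < d" for i
  proof -
    have "\<eta> i = 1 \<or> \<eta> i = - 1" using assms(1)[OF that] by linarith
    then show ?thesis by (elim disjE) simp_all
  qed
  then show ?thesis using assms(2) by (auto simp: reflect_base_def Zd_def fun_eq_iff extensional_def PiE_iff)
qed

text \<open>Multiplying the base coordinates by the signs \<open>\<eta> i\<close> is an involution that preserves the percolation measure
and the Lipschitz property, and it carries the plane for \<open>\<eta>\<close> to the plane for \<open>(1, \<dots>, 1)\<close>.\<close>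

lemma measure_LIP_reflect:
  assumes \<eta>: "\<And>i. i < d \<Longrightarrow> \<bar>\<eta> i\<bar> = 1"
  shows "measure (perc d p) (LIP \<alpha> d \<eta>) = measure (perc d p) (LIP \<alpha> d (\<lambda>i\<in>{..<d}. 1))"
proof -
  let ?r = "reflect_base d \<eta>"
  define f where "f s = (?r (fst s), snd s)" for s :: "(nat \<Rightarrow> int) \<times> int"
  have rZ: "?r x \<in> Zd d" for x by (auto simp: reflect_base_def Zd_def)
  have rr: "?r (?r x) = x" if "x \<in> Zd d" for x using reflect_base_invol[OF \<eta> that] .
  have f: "inj_on f (sites d)" "f \<in> sites d \<rightarrow> sites d"
    using rZ by (auto simp: f_def inj_on_def sites_def) (metis rr)+
  have sum1: "(\<Sum>i<d. (\<lambda>i\<in>{..<d}. 1) i * ?r x i) = (\<Sum>i<d. \<eta> i * x i)" for x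
    by (rule sum.cong) (auto simp: reflect_base_def)
  have lip: "lipschitz_fun d (\<lambda>x. F (?r x))" if "lipschitz_fun d F" for F
    unfolding lipschitz_fun_def
  proof (intro ballI impI)
    fix x y assume xy: "x \<in> Zd d" "y \<in> Zd d" "norm1 d (\<lambda>i. x i - y i) = 1"
    have "\<bar>?r x i - ?r y i\<bar> = \<bar>x i - y i\<bar>" if "i < d" for i
      using \<eta>[OF that] that by (simp add: reflect_base_def abs_mult flip: right_diff_distrib)
    then have "norm1 d (\<lambda>i. ?r x i - ?r y i) = 1"
      using xy(3) by (simp add: norm1_def)
    then show "\<bar>F (?r x) - F (?r y)\<bar> \<le> 1"
      using that rZ unfolding lipschitz_fun_def by blast
  qed
  have cfg: "(\<lambda>s\<in>sites d. w (f s)) \<in> configs d" for w by (auto simp: configs_def)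
  have key: "(\<lambda>s\<in>sites d. w (f s)) \<in> LIP \<alpha> d (\<lambda>i\<in>{..<d}. 1) \<longleftrightarrow> w \<in> LIP \<alpha> d \<eta>" if w: "w \<in> configs d" for w
  proof
    assume "(\<lambda>s\<in>sites d. w (f s)) \<in> LIP \<alpha> d (\<lambda>i\<in>{..<d}. 1)"
    then obtain F where F: "lipschitz_fun d F" "\<And>x. x \<in> Zd d \<Longrightarrow> (\<lambda>s\<in>sites d. w (f s)) (x, F x) \<and>
       F x > \<lfloor>\<alpha> * real_of_int (\<Sum>i<d. (\<lambda>i\<in>{..<d}. 1) i * x i)\<rfloor>"
      unfolding LIP_def by blast
    have "w (x, F (?r x)) \<and> F (?r x) > \<lfloor>\<alpha> * real_of_int (\<Sum>i<d. \<eta> i * x i)\<rfloor>" if x: "x \<in> Zd d" for x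
      using F(2)[OF rZ[of x]] rr[OF x] rZ[of x] unfolding sum1 by (simp add: sites_def f_def)
    then show "w \<in> LIP \<alpha> d \<eta>" using lip[OF F(1)] w unfolding LIP_def by blast
  next
    assume "w \<in> LIP \<alpha> d \<eta>"
    then obtain F where F: "lipschitz_fun d F" "\<And>x. x \<in> Zd d \<Longrightarrow> w (x, F x) \<and>
       F x > \<lfloor>\<alpha> * real_of_int (\<Sum>i<d. \<eta> i * x i)\<rfloor>"
      unfolding LIP_def by blast
    have "(\<lambda>s\<in>sites d. w (f s)) (x, F (?r x)) \<and> F (?r x) > \<lfloor>\<alpha> * real_of_int (\<Sum>i<d. (\<lambda>i\<in>{..<d}. 1) i * x i)\<rfloor>" if x: "x \<in> Zd d" for x
      using F(2)[OF rZ[of x]] x unfolding sum1[of "?r x", symmetric] rr[OF x] by (simp add: sites_def f_def)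
    then show "(\<lambda>s\<in>sites d. w (f s)) \<in> LIP \<alpha> d (\<lambda>i\<in>{..<d}. 1)"
      using lip[OF F(1)] cfg unfolding LIP_def by blast
  qed
  have LIP_sub: "LIP \<alpha> d \<zeta> \<subseteq> configs d" for \<zeta> by (auto simp: LIP_def)
  have rev: "{w \<in> configs d. (\<lambda>s\<in>sites d. w (f s)) \<in> LIP \<alpha> d (\<lambda>i\<in>{..<d}. 1)} = LIP \<alpha> d \<eta>"
    using key LIP_sub by blast
  have ff: "(\<lambda>s\<in>sites d. (\<lambda>s\<in>sites d. w (f s)) (f s)) = w" if "w \<in> configs d" for w
  proof
    fix s :: "(nat \<Rightarrow> int) \<times> int"
    obtain x h where s: "s = (x, h)" by (cases s)
    show "(\<lambda>s\<in>sites d. (\<lambda>s\<in>sites d. w (f s)) (f s)) s = w s"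
    proof (cases "s \<in> sites d")
      case True
      then have "f (f s) = s" "f s \<in> sites d" using rr rZ by (auto simp: s f_def sites_def)
      then show ?thesis using True by simp
    next
      case False
      moreover have "w s = undefined" using that False unfolding configs_def by (rule PiE_arb)
      ultimately show ?thesis by simp
    qed
  qed
  have rev': "{w \<in> configs d. (\<lambda>s\<in>sites d. w (f s)) \<in> LIP \<alpha> d \<eta>} = LIP \<alpha> d (\<lambda>i\<in>{..<d}. 1)"
  proof (intro equalityI subsetI)
    fix w assume "w \<in> {w \<in> configs d. (\<lambda>s\<in>sites d. w (f s)) \<in> LIP \<alpha> d \<eta>}"
    then show "w \<in> LIP \<alpha> d (\<lambda>i\<in>{..<d}. 1)" using key[OF cfg, of w] ff[of w] by simp
  next
    fix w assume w: "w \<in> LIP \<alpha> d (\<lambda>i\<in>{..<d}. 1)"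
    then have "w \<in> configs d" using LIP_sub by blast
    then show "w \<in> {w \<in> configs d. (\<lambda>s\<in>sites d. w (f s)) \<in> LIP \<alpha> d \<eta>}"
      using key[OF cfg, of w] ff[of w] w by simp
  qed
  show ?thesis
  proof (cases "LIP \<alpha> d \<eta> \<in> sets (perc d p)")
    case True
    then show ?thesis using measure_perc_reindex(1)[OF f True] unfolding rev' by simp
  next
    case False
    then have "LIP \<alpha> d (\<lambda>i\<in>{..<d}. 1) \<notin> sets (perc d p)"
      using measure_perc_reindex(2)[OF f, of "LIP \<alpha> d (\<lambda>i\<in>{..<d}. 1)" p] unfolding rev by blast
    then show ?thesis using False by (simp add: measure_notin_sets)
  qed
qed

definition threshold :: "(real \<Rightarrow> real) \<Rightarrow> real \<Rightarrow> bool" where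
  "threshold f c \<longleftrightarrow> 0 \<le> c \<and> c \<le> 1 \<and> (\<forall>p. 0 \<le> p \<and> p < c \<longrightarrow> f p = 0) \<and> (\<forall>p. c < p \<and> p \<le> 1 \<longrightarrow> f p = 1)"

lemma p_L_dir_threshold: "p_L_dir \<alpha> d \<eta> = (THE c. threshold (\<lambda>p. measure (perc d p) (LIP \<alpha> d \<eta>)) c)"
  by (simp add: p_L_dir_def threshold_def)

lemma threshold_ex1:
  fixes f :: "real \<Rightarrow> real"
  assumes zo: "\<And>p. f p = 0 \<or> f p = 1"
    and mono: "\<And>p p'. 0 \<le> p \<Longrightarrow> p \<le> p' \<Longrightarrow> p' \<le> 1 \<Longrightarrow> f p \<le> f p'"
  shows "\<exists>!c. threshold f c"
proof (rule ex_ex1I)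
  define Z where "Z = insert 0 {p. 0 \<le> p \<and> p \<le> 1 \<and> f p = 0}"
  have bdd: "bdd_above Z" "Z \<noteq> {}" by (auto simp: Z_def intro!: bdd_aboveI[of _ 1])
  have "0 \<le> Sup Z" using bdd by (intro cSup_upper) (auto simp: Z_def)
  moreover have "Sup Z \<le> 1" by (rule cSup_least) (auto simp: Z_def)
  moreover have "f p = 0" if p: "0 \<le> p" "p < Sup Z" for p
  proof -
    obtain z where z: "z \<in> Z" "p < z" using less_cSup_iff[OF bdd(2,1)] p(2) by blast
    then have "f p \<le> f z" using p by (intro mono) (auto simp: Z_def)
    moreover have "f z = 0" using z p by (auto simp: Z_def)
    ultimately show ?thesis using zo[of p] by auto
  qed
  moreover have "f p = 1" if p: "Sup Z < p" "p \<le> 1" for p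
    using cSup_upper[OF _ bdd(1), of p] zo[of p] p \<open>0 \<le> Sup Z\<close> by (fastforce simp: Z_def)
  ultimately show "\<exists>c. threshold f c"
    unfolding threshold_def by blast
next
  fix c c'
  assume c: "threshold f c" and c': "threshold f c'"
  have False if ab: "threshold f a" "threshold f b" "a < b" for a b
  proof -
    obtain m where m: "a < m" "m < b" using dense[OF ab(3)] by blast
    have "m \<le> 1" "0 \<le> m" using ab m unfolding threshold_def by linarith+
    then have "f m = 1" "f m = 0" using ab(1,2) m unfolding threshold_def by blast+
    then show False by simp
  qed
  then show "c = c'" using c c' by (metis linorder_neqE_linordered_idom)
qed

text \<open>By the zero-one law and monotonicity the probability jumps from \<open>0\<close> to \<open>1\<close> at a unique point, which by
reflection is the same for all directions; so a probability below \<open>1\<close> at \<open>1 - q\<close> bounds the threshold.\<close>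

lemma q_L_le:
  assumes q: "0 \<le> q" "q \<le> 1"
    and lt: "measure (perc d (1 - q)) (LIP \<alpha> d (\<lambda>i\<in>{..<d}. 1)) < 1"
  shows "q_L \<alpha> d d \<le> q"
proof -
  let ?one = "\<lambda>i\<in>{..<d}. 1 :: int"
  let ?f = "\<lambda>p. measure (perc d p) (LIP \<alpha> d ?one)"
  define c where "c = p_L_dir \<alpha> d ?one"
  have "\<exists>!c. threshold ?f c"
  proof (rule threshold_ex1)
    show "?f p = 0 \<or> ?f p = 1" for p unfolding LIP_eq_lip_above by (rule lip_above_0_1)
    show "?f p \<le> ?f p'" if "0 \<le> p" "p \<le> p'" "p' \<le> 1" for p p'
      unfolding LIP_eq_lip_above using that by (rule measure_lip_above_mono)
  qed
  then have "threshold ?f c" unfolding c_def p_L_dir_threshold by (rule theI')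
  then have c: "\<forall>p. c < p \<and> p \<le> 1 \<longrightarrow> ?f p = 1" by (simp add: threshold_def)
  have dir: "p_L_dir \<alpha> d \<eta> = c" if "\<eta> \<in> directions d" "norm1 d \<eta> = int d" for \<eta>
  proof -
    have le: "\<bar>\<eta> i\<bar> \<le> 1" if "i < d" for i
    proof -
      have "\<eta> i \<in> {-1, 0, 1}" using \<open>\<eta> \<in> directions d\<close> that by (auto simp: directions_def)
      then show ?thesis by auto
    qed
    have "(\<Sum>i<d. 1 - \<bar>\<eta> i\<bar>) = 0" using that(2) by (simp add: norm1_def sum_subtractf)
    then have "\<bar>\<eta> i\<bar> = 1" if "i < d" for i
      using le that by (subst (asm) sum_nonneg_eq_0_iff) auto
    then have "measure (perc d p) (LIP \<alpha> d \<eta>) = ?f p" for p by (rule measure_LIP_reflect)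
    then show ?thesis unfolding c_def p_L_dir_threshold by simp
  qed
  have one: "?one \<in> directions d" "norm1 d ?one = int d" by (auto simp: directions_def norm1_def)
  have "p_L \<alpha> d d = c"
    unfolding p_L_def using dir one by (intro the_equality) auto
  moreover have "1 - q \<le> c"
  proof (rule ccontr)
    assume "\<not> 1 - q \<le> c"
    then have "?f (1 - q) = 1" using c q by auto
    then show False using lt by simp
  qed
  ultimately show ?thesis by (simp add: q_L_def)
qed

section \<open>Closed paths as obstructions\<close>

(* Otherwise eta-expansion lets the simplifier turn a position x + v into a lambda term. *)
declare plus_fun_apply [simp del] zero_fun_apply [simp del]

text \<open>The second moment method for the weighted count in which event \<open>E j\<close> has weight \<open>1 / prob (E j)\<close>. With these
weights only the intersection of the site sets of two paths enters the bound.\<close>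

lemma (in prob_space) second_moment_union_bound:
  fixes E :: "'j \<Rightarrow> 'a set" and K :: real
  assumes J: "finite J" "J \<noteq> {}" and E: "\<And>j. j \<in> J \<Longrightarrow> E j \<in> events"
    and pos: "\<And>j. j \<in> J \<Longrightarrow> prob (E j) > 0" and K: "K > 0"
    and cor: "\<And>k. k \<in> J \<Longrightarrow> (\<Sum>j\<in>J. prob (E j \<inter> E k) / (prob (E j) * prob (E k))) \<le> K * card J"
  shows "prob (\<Union>j\<in>J. E j) \<ge> 1 / K"
proof -
  let ?U = "\<Union>j\<in>J. E j"
  let ?c = "real (card J)"
  have c: "?c > 0" using J by (simp add: card_gt_0_iff)
  define N where "N w = (\<Sum>j\<in>J. indicator (E j) w / prob (E j))" for w
  \<comment> \<open>The bound on the second moment divided by the first moment: this multiple of the indicator of the union is a near-optimal approximation of \<open>N\<close>.\<close>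
  define l where "l = K * ?c"
  have U: "?U \<in> events" using J E by auto
  have ind: "integrable M (indicator A :: _ \<Rightarrow> real)" if "A \<in> events" for A
    using that by (simp add: integrable_real_indicator emeasure_eq_measure)
  have EE: "E j \<inter> E k \<in> events" if "j \<in> J" "k \<in> J" for j k using E that by auto
  have expand: "(N w - l * indicator ?U w)\<^sup>2 =
     (\<Sum>k\<in>J. \<Sum>j\<in>J. indicator (E j \<inter> E k) w / (prob (E j) * prob (E k)))
      - 2 * l * N w + l\<^sup>2 * indicator ?U w" for w
  proof -
    have "N w * indicator ?U w = N w"
      unfolding N_def sum_distrib_right by (rule sum.cong) (auto simp: indicator_def)
    moreover have "(N w)\<^sup>2 = (\<Sum>k\<in>J. \<Sum>j\<in>J. indicator (E j \<inter> E k) w / (prob (E j) * prob (E k)))"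
      unfolding N_def power2_eq_square sum_product
      by (subst sum.swap) (simp add: indicator_inter_arith)
    moreover have "(indicator ?U w :: real)\<^sup>2 = indicator ?U w" by (auto simp: indicator_def)
    ultimately show ?thesis
      by (auto simp: power2_diff power_mult_distrib)
  qed
  have "0 \<le> (\<integral>w. (N w - l * indicator ?U w)\<^sup>2 \<partial>M)" by simp
  also have "\<dots> = (\<Sum>k\<in>J. \<Sum>j\<in>J. prob (E j \<inter> E k) / (prob (E j) * prob (E k)))
      - 2 * l * (\<Sum>j\<in>J. prob (E j) / prob (E j)) + l\<^sup>2 * prob ?U"
    unfolding expand unfolding N_def
    using E EE U by (simp add: ind Bochner_Integration.integral_add Bochner_Integration.integral_diff
      Bochner_Integration.integral_sum integrable_sum integrable_diff)
  also have "(\<Sum>j\<in>J. prob (E j) / prob (E j)) = ?c"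
    using pos by (simp add: less_imp_neq[THEN not_sym])
  also have "(\<Sum>k\<in>J. \<Sum>j\<in>J. prob (E j \<inter> E k) / (prob (E j) * prob (E k))) \<le> (\<Sum>k\<in>J. K * ?c)"
    by (rule sum_mono) (rule cor)
  finally have "0 \<le> ?c * (K * ?c) - 2 * l * ?c + l\<^sup>2 * prob ?U" by simp
  then have "K * ?c\<^sup>2 \<le> K * ?c\<^sup>2 * (K * prob ?U)"
    unfolding l_def by (simp add: power2_eq_square algebra_simps)
  then have "1 \<le> K * prob ?U" using K c by simp
  then show ?thesis using K by (simp add: field_simps)
qed

definition embed :: "nat \<Rightarrow> (nat \<Rightarrow> nat) \<Rightarrow> (nat \<Rightarrow> int)" where
  "embed d x = (\<lambda>i\<in>{..<d}. int (x i))"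

definition mass :: "nat \<Rightarrow> (nat \<Rightarrow> nat) \<Rightarrow> nat" where
  "mass d v = (\<Sum>i<d. v i)"

lemma mass_add [simp]: "mass d (x + v) = mass d x + mass d v"
  by (simp add: mass_def sum.distrib plus_fun_apply)

lemma mass_0 [simp]: "mass d 0 = 0"
  by (simp add: mass_def zero_fun_apply)

lemma embed_Zd [simp]: "embed d x \<in> Zd d"
  by (auto simp: embed_def Zd_def)

lemma lipschitz_embed_add:
  assumes "lipschitz_fun d F"
  shows "F (embed d (x + v)) \<le> F (embed d x) + int (mass d v)"
proof (induction "mass d v" arbitrary: v)
  case 0
  then have "embed d (x + v) = embed d x" by (auto simp: embed_def mass_def fun_eq_iff plus_fun_apply)
  then show ?case by (metis le_add_same_cancel1 of_nat_0_le_iff)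
next
  case (Suc k)
  then obtain i where i: "i < d" "v i > 0" unfolding mass_def
    by (metis (no_types, lifting) Zero_not_Suc gr0I lessThan_iff sum.neutral)
  define w where "w = v(i := v i - 1)"
  have "mass d v = mass d w + 1"
    using i by (simp add: mass_def w_def sum.remove[of "{..<d}" i])
  then have "F (embed d (x + w)) \<le> F (embed d x) + int k" using Suc by simp
  moreover have "norm1 d (\<lambda>j. embed d (x + v) j - embed d (x + w) j) = 1"
  proof -
    have "norm1 d (\<lambda>j. embed d (x + v) j - embed d (x + w) j) = (\<Sum>j<d. if j = i then 1 else 0)"
      unfolding norm1_def using i by (intro sum.cong) (auto simp: embed_def w_def plus_fun_apply)
    then show ?thesis using i by simp
  qed
  then have "\<bar>F (embed d (x + v)) - F (embed d (x + w))\<bar> \<le> 1"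
    using assms unfolding lipschitz_fun_def by simp
  ultimately show ?case using Suc(2) by linarith
qed

text \<open>A path is given by its list of horizontal displacements, one between any two consecutive drops; displacements
have nonnegative coordinates, so that a displacement \<open>v\<close> raises the height by \<open>mass d v\<close>. The set collects
the sites from which the path drops, with \<open>(x, h)\<close> as starting point.\<close>

fun path_sites :: "nat \<Rightarrow> (nat \<Rightarrow> nat) \<Rightarrow> int \<Rightarrow> (nat \<Rightarrow> nat) list \<Rightarrow> ((nat \<Rightarrow> int) \<times> int) set" where
  "path_sites d x h [] = {}"
| "path_sites d x h (v # vs) = insert (embed d (x + v), h + int (mass d v))
     (path_sites d (x + v) (h + int (mass d v) - 1) vs)"

text \<open>Only the first \<open>n\<close> coordinates are compared, because main and reserved coordinates are treated separately.\<close>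

fun overlaps :: "nat \<Rightarrow> (nat \<Rightarrow> nat) \<Rightarrow> (nat \<Rightarrow> nat) \<Rightarrow> (nat \<Rightarrow> nat) list \<Rightarrow> (nat \<Rightarrow> nat) list \<Rightarrow> nat" where
  "overlaps n x x' (v # vs) (v' # vs') =
     (if \<forall>i<n. (x + v) i = (x' + v') i then 1 else 0) + overlaps n (x + v) (x' + v') vs vs'"
| "overlaps n x x' _ _ = 0"

lemma finite_path_sites [simp]: "finite (path_sites d x h vs)"
  by (induction d x h vs rule: path_sites.induct) auto

lemma path_sites_subset: "path_sites d x h vs \<subseteq> sites d"
  by (induction d x h vs rule: path_sites.induct) (auto simp: sites_def)

text \<open>If the surface lies above the end of the path, then it lies above every point of the path: a drop is undone
because the surface cannot pass through a closed site, and a free step because the surface is Lipschitz.\<close>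

lemma closed_path_lifts:
  assumes F: "lipschitz_fun d F" "\<And>x. x \<in> Zd d \<Longrightarrow> \<omega> (x, F x)"
  shows "\<forall>s\<in>path_sites d x h vs. \<not> \<omega> s \<Longrightarrow>
    F (embed d (x + sum_list vs)) > h + int (mass d (sum_list vs)) - int (length vs) \<Longrightarrow> F (embed d x) > h"
proof (induction vs arbitrary: x h)
  case Nil
  then show ?case by simp
next
  case (Cons v vs)
  let ?h = "h + int (mass d v)"
  have "F (embed d (x + v)) > ?h - 1"
    by (rule Cons.IH) (use Cons.prems in \<open>auto simp: add.assoc\<close>)
  moreover have "F (embed d (x + v)) \<noteq> ?h"
    using Cons.prems(1) F(2)[of "embed d (x + v)"] by auto
  ultimately have "F (embed d (x + v)) > ?h" by linarith
  then show ?case using lipschitz_embed_add[OF F(1), of x v] by linarith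
qed

text \<open>The sum of the base coordinates minus the height only changes at drops and thus counts them. Hence two paths
can share a site only if it has the same index in both.\<close>

lemma path_sites_drop_number:
  "(y, k) \<in> path_sites d x h vs \<Longrightarrow> (\<Sum>i<d. y i) - k \<ge> int (mass d x) - h"
proof (induction vs arbitrary: x h)
  case (Cons v vs)
  have "(\<Sum>i<d. embed d (x + v) i) = int (mass d (x + v))"
    unfolding mass_def of_nat_sum by (rule sum.cong) (auto simp: embed_def)
  then show ?case using Cons.prems Cons.IH[of "x + v" "h + int (mass d v) - 1"] by fastforce
qed simp

lemma card_path_sites_Int:
  "int (mass d x) - h = int (mass d x') - h' \<Longrightarrow>
   card (path_sites d x h vs \<inter> path_sites d x' h' vs') \<le> overlaps d x x' vs vs'"
proof (induction vs arbitrary: vs' x h x' h')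
  case Nil
  then show ?case by simp
next
  case (Cons v vs)
  show ?case
  proof (cases vs')
    case Nil
    then show ?thesis by simp
  next
    case c: (Cons v' ws)
    let ?T = "path_sites d (x + v) (h + int (mass d v) - 1) vs"
    let ?T' = "path_sites d (x' + v') (h' + int (mass d v') - 1) ws"
    let ?a = "(embed d (x + v), h + int (mass d v))"
    let ?a' = "(embed d (x' + v'), h' + int (mass d v'))"
    have tag: "(\<Sum>i<d. embed d y i) = int (mass d y)" for y
      unfolding mass_def of_nat_sum by (rule sum.cong) (auto simp: embed_def)
    have 1: "?a \<notin> ?T'" using path_sites_drop_number[of "fst ?a" "snd ?a"] Cons.prems tag by fastforce
    have 2: "?a' \<notin> ?T" using path_sites_drop_number[of "fst ?a'" "snd ?a'"] Cons.prems tag by fastforce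
    have sub: "path_sites d x h (v # vs) \<inter> path_sites d x' h' (v' # ws) \<subseteq> ({?a} \<inter> {?a'}) \<union> (?T \<inter> ?T')"
      using 1 2 by auto
    have "card ({?a} \<inter> {?a'}) \<le> (if \<forall>i<d. (x + v) i = (x' + v') i then 1 else 0)"
    proof (cases "?a = ?a'")
      case True
      then have "embed d (x + v) i = embed d (x' + v') i" for i by simp
      then have "\<forall>i<d. (x + v) i = (x' + v') i" unfolding embed_def by (metis lessThan_iff of_nat_eq_iff restrict_apply')
      then show ?thesis using True by simp
    next
      case False
      then have "{?a} \<inter> {?a'} = {}" by blast
      then show ?thesis by simp
    qed
    moreover have "card (?T \<inter> ?T') \<le> overlaps d (x + v) (x' + v') vs ws"
      using Cons.prems by (intro Cons.IH) simp
    moreover have "card (path_sites d x h (v # vs) \<inter> path_sites d x' h' (v' # ws))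
       \<le> card ({?a} \<inter> {?a'}) + card (?T \<inter> ?T')"
      by (rule order_trans[OF card_mono[OF _ sub] card_Un_le]) auto
    ultimately show ?thesis unfolding c by simp
  qed
qed

text \<open>Under the hypothesis, for every \<open>H\<close> the surfaces at \<open>0\<close> exceed \<open>H\<close> with probability at least \<open>1 / 2\<close>. A
surface has a finite height at \<open>0\<close>, so it can only exist where these events fail for all large \<open>H\<close>.\<close>

lemma LIP_not_almost_sure:
  fixes q \<alpha> :: real
  assumes q: "0 < q" "q \<le> 1"
    and family: "\<And>H. \<exists>(J :: 'j set) \<pi>. finite J \<and> J \<noteq> {} \<and>
      (\<forall>j\<in>J. int H + int (mass d (sum_list (\<pi> j))) - int (length (\<pi> j)) \<le> \<lfloor>\<alpha> * mass d (sum_list (\<pi> j))\<rfloor>) \<and>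
      (\<forall>k\<in>J. (\<Sum>j\<in>J. (1 / q) ^ overlaps d 0 0 (\<pi> j) (\<pi> k)) \<le> 2 * card J)"
  shows "measure (perc d (1 - q)) (LIP \<alpha> d (\<lambda>i\<in>{..<d}. 1)) < 1"
proof (cases "LIP \<alpha> d (\<lambda>i\<in>{..<d}. 1) \<in> sets (perc d (1 - q))")
  case False
  then show ?thesis by (simp add: measure_notin_sets)
next
  case LIP: True
  interpret P: prob_space "perc d (1 - q)" by (rule prob_space_perc)
  define high where "high H U \<longleftrightarrow> U \<in> P.events \<and> P.prob U \<ge> 1 / 2 \<and>
     (\<forall>\<omega>\<in>U. \<forall>F. lipschitz_fun d F \<longrightarrow> (\<forall>x\<in>Zd d. \<omega> (x, F x) \<and>
         F x > \<lfloor>\<alpha> * real_of_int (\<Sum>i<d. (\<lambda>i\<in>{..<d}. 1) i * x i)\<rfloor>) \<longrightarrow> F (embed d 0) > int H)" for H U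
  have "\<exists>U. high H U" for H
  proof -
    obtain J :: "'j set" and \<pi> where J: "finite J" "J \<noteq> {}"
      and low: "\<And>j. j \<in> J \<Longrightarrow> int H + int (mass d (sum_list (\<pi> j))) - int (length (\<pi> j)) \<le> \<lfloor>\<alpha> * mass d (sum_list (\<pi> j))\<rfloor>"
      and ov: "\<And>k. k \<in> J \<Longrightarrow> (\<Sum>j\<in>J. (1 / q) ^ overlaps d 0 0 (\<pi> j) (\<pi> k)) \<le> 2 * card J"
      using family[of H] by metis
    define S where "S j = path_sites d 0 (int H) (\<pi> j)" for j
    define E where "E j = {w \<in> configs d. \<forall>s\<in>S j. \<not> w s}" for j
    have S: "finite (S j)" "S j \<subseteq> sites d" for j unfolding S_def using path_sites_subset by auto
    have E: "E j \<in> P.events" "P.prob (E j) = q ^ card (S j)" for j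
      using all_closed_event[OF S[of j], of "1 - q"] q unfolding E_def by auto
    have EE: "P.prob (E j \<inter> E k) = q ^ card (S j \<union> S k)" for j k
    proof -
      have "E j \<inter> E k = {w \<in> configs d. \<forall>s\<in>S j \<union> S k. \<not> w s}" unfolding E_def by auto
      then show ?thesis using all_closed_event(2)[of "S j \<union> S k" d "1 - q"] S q by simp
    qed
    have "P.prob (\<Union>j\<in>J. E j) \<ge> 1 / 2"
    proof (rule P.second_moment_union_bound[OF J])
      fix k assume k: "k \<in> J"
      have "P.prob (E j \<inter> E k) / (P.prob (E j) * P.prob (E k)) \<le> (1 / q) ^ overlaps d 0 0 (\<pi> j) (\<pi> k)" for j
      proof -
        have "q ^ card (S j \<union> S k) * q ^ card (S j \<inter> S k) = q ^ card (S j) * q ^ card (S k)"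
          using card_Un_Int[OF S(1)[of j] S(1)[of k]] by (simp flip: power_add)
        then have "q ^ card (S j \<union> S k) / (q ^ card (S j) * q ^ card (S k)) = (1 / q) ^ card (S j \<inter> S k)"
          using q by (simp add: field_simps)
        also have "\<dots> \<le> (1 / q) ^ overlaps d 0 0 (\<pi> j) (\<pi> k)"
          using q unfolding S_def by (intro power_increasing card_path_sites_Int) auto
        finally show ?thesis by (simp add: E EE)
      qed
      then have "(\<Sum>j\<in>J. P.prob (E j \<inter> E k) / (P.prob (E j) * P.prob (E k)))
          \<le> (\<Sum>j\<in>J. (1 / q) ^ overlaps d 0 0 (\<pi> j) (\<pi> k))" by (intro sum_mono)
      also have "\<dots> \<le> 2 * real (card J)" using ov[OF k] by simp
      finally show "(\<Sum>j\<in>J. P.prob (E j \<inter> E k) / (P.prob (E j) * P.prob (E k))) \<le> 2 * real (card J)" .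
    qed (use q E in auto)
    moreover have "F (embed d 0) > int H" if w: "\<omega> \<in> E j" "j \<in> J" and F: "lipschitz_fun d F"
      "\<And>x. x \<in> Zd d \<Longrightarrow> \<omega> (x, F x) \<and> F x > \<lfloor>\<alpha> * real_of_int (\<Sum>i<d. (\<lambda>i\<in>{..<d}. 1) i * x i)\<rfloor>" for \<omega> j F
    proof -
      let ?y = "sum_list (\<pi> j)"
      have "(\<Sum>i<d. (\<lambda>i\<in>{..<d}. 1) i * embed d ?y i) = int (mass d ?y)"
        unfolding mass_def of_nat_sum by (rule sum.cong) (auto simp: embed_def)
      then have "F (embed d ?y) > \<lfloor>\<alpha> * mass d ?y\<rfloor>"
        using F(2)[of "embed d ?y"] by simp
      then have "F (embed d (0 + ?y)) > int H + int (mass d ?y) - int (length (\<pi> j))"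
        using low[OF w(2)] by simp
      then show ?thesis
        by (intro closed_path_lifts[OF F(1), of \<omega> 0 "int H" "\<pi> j"]) (use F(2) w in \<open>auto simp: E_def S_def\<close>)
    qed
    moreover have "(\<Union>j\<in>J. E j) \<in> P.events" using E J by auto
    ultimately show ?thesis by (intro exI[of _ "\<Union>j\<in>J. E j"]) (auto simp: high_def)
  qed
  then obtain U where good: "\<And>H. high H (U H)" by metis
  then have U: "\<And>H. U H \<in> P.events" "\<And>H. P.prob (U H) \<ge> 1 / 2"
    by (auto simp: high_def)
  have low: "F (embed d 0) > int H" if "\<omega> \<in> U H" "lipschitz_fun d F" "\<forall>x\<in>Zd d. \<omega> (x, F x) \<and>
         F x > \<lfloor>\<alpha> * real_of_int (\<Sum>i<d. (\<lambda>i\<in>{..<d}. 1) i * x i)\<rfloor>" for H \<omega> F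
    using good[of H] that unfolding high_def by blast
  define B where "B N = (\<Inter>H\<in>{N..}. space (perc d (1 - q)) - U H)" for N
  have B: "B N \<in> P.events" for N unfolding B_def using U(1) by (intro sets.countable_INT') auto
  have PB: "P.prob (B N) \<le> 1 / 2" for N
  proof -
    have "P.prob (B N) \<le> P.prob (space (perc d (1 - q)) - U N)"
      using U(1) by (intro P.finite_measure_mono) (auto simp: B_def)
    then show ?thesis using P.prob_compl[OF U(1)[of N]] U(2)[of N] by simp
  qed
  have "incseq B" unfolding B_def incseq_def by (auto intro: INT_anti_mono)
  then have "(\<lambda>N. P.prob (B N)) \<longlonglongrightarrow> P.prob (\<Union>N. B N)"
    using B by (intro P.finite_Lim_measure_incseq) auto
  then have PUB: "P.prob (\<Union>N. B N) \<le> 1 / 2"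
    by (rule LIMSEQ_le_const2) (use PB in auto)
  have "LIP \<alpha> d (\<lambda>i\<in>{..<d}. 1) \<subseteq> (\<Union>N. B N)"
  proof
    fix \<omega> assume "\<omega> \<in> LIP \<alpha> d (\<lambda>i\<in>{..<d}. 1)"
    then obtain F where c: "\<omega> \<in> configs d" and F: "lipschitz_fun d F" "\<forall>x\<in>Zd d. \<omega> (x, F x) \<and>
         F x > \<lfloor>\<alpha> * real_of_int (\<Sum>i<d. (\<lambda>i\<in>{..<d}. 1) i * x i)\<rfloor>" unfolding LIP_def by blast
    have "\<omega> \<notin> U H" if "H \<ge> nat (F (embed d 0))" for H
      using low[OF _ F, of H] that by linarith
    then have "\<omega> \<in> B (nat (F (embed d 0)))" unfolding B_def using c by (auto simp: space_perc)
    then show "\<omega> \<in> (\<Union>N. B N)" by blast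
  qed
  then have "P.prob (LIP \<alpha> d (\<lambda>i\<in>{..<d}. 1)) \<le> P.prob (\<Union>N. B N)"
    using B by (intro P.finite_measure_mono) auto
  then show ?thesis using PUB by simp
qed

section \<open>Overlaps of short paths\<close>

definition words :: "'a set \<Rightarrow> nat \<Rightarrow> 'a list set" where
  "words A L = {xs. set xs \<subseteq> A \<and> length xs = L}"

lemma words_0 [simp]: "words A 0 = {[]}"
  by (auto simp: words_def)

lemma finite_words [simp]: "finite A \<Longrightarrow> finite (words A L)"
  by (simp add: words_def finite_lists_length_eq)

lemma card_words: "finite A \<Longrightarrow> card (words A L) = card A ^ L"
  by (simp add: words_def card_lists_length_eq)

lemma words_length: "xs \<in> words A L \<Longrightarrow> length xs = L"
  by (simp add: words_def)

lemma sum_words_Suc: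
  "(\<Sum>xs\<in>words A (Suc L). f xs) = (\<Sum>a\<in>A. \<Sum>xs\<in>words A L. f (a # xs))"
proof -
  have "words A (Suc L) = (\<lambda>(a, xs). a # xs) ` (A \<times> words A L)"
    by (auto simp: words_def length_Suc_conv image_iff)
  then have "(\<Sum>xs\<in>words A (Suc L). f xs) = (\<Sum>(a, xs)\<in>A \<times> words A L. f (a # xs))"
    by (simp add: sum.reindex inj_on_def case_prod_beta)
  then show ?thesis by (simp add: sum.cartesian_product)
qed

lemma sum_words_snoc:
  "(\<Sum>xs\<in>words A (Suc L). f xs) = (\<Sum>xs\<in>words A L. \<Sum>a\<in>A. f (xs @ [a]))"
proof -
  have "words A (Suc L) = (\<lambda>(xs, a). xs @ [a]) ` (words A L \<times> A)"
    by (auto simp: words_def length_Suc_conv_rev image_iff)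
  then have "(\<Sum>xs\<in>words A (Suc L). f xs) = (\<Sum>(xs, a)\<in>words A L \<times> A. f (xs @ [a]))"
    by (simp add: sum.reindex inj_on_def case_prod_beta)
  then show ?thesis by (simp add: sum.cartesian_product)
qed

lemma sum_words_append:
  "(\<Sum>xs\<in>words A (L + k). f xs) = (\<Sum>xs\<in>words A L. \<Sum>ys\<in>words A k. f (xs @ ys))"
  by (induction L arbitrary: f) (simp_all add: sum_words_Suc)

lemma overlaps_append:
  "length vs = length vs' \<Longrightarrow> overlaps n x x' (vs @ ws) (vs' @ ws') =
     overlaps n x x' vs vs' + overlaps n (x + sum_list vs) (x' + sum_list vs') ws ws'"
  by (induction vs vs' arbitrary: x x' rule: list_induct2) (simp_all add: add.assoc)

definition agree :: "nat \<Rightarrow> (nat \<Rightarrow> nat) \<Rightarrow> (nat \<Rightarrow> nat) \<Rightarrow> bool" where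
  "agree n x y \<longleftrightarrow> (\<forall>i<n. x i = y i)"

lemma overlaps_Cons: "overlaps n x x' (v # vs) (v' # vs') =
    (if agree n (x + v) (x' + v') then 1 else 0) + overlaps n (x + v) (x' + v') vs vs'"
  by (simp add: agree_def)

lemmas [simp del] = overlaps.simps(1)

lemma overlaps_snoc:
  "length vs = length vs' \<Longrightarrow> overlaps n x x' (vs @ [v]) (vs' @ [v']) =
     overlaps n x x' vs vs' + (if agree n (x + sum_list (vs @ [v])) (x' + sum_list (vs' @ [v'])) then 1 else 0)"
  by (simp add: overlaps_append overlaps_Cons add.assoc)

lemma overlaps_antimono: "n \<le> d \<Longrightarrow> overlaps d x x' vs vs' \<le> overlaps n x x' vs vs'"
proof (induction vs arbitrary: x x' vs')
  case (Cons v vs)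
  then show ?case
    by (cases vs') (auto simp: overlaps_Cons agree_def intro: le_SucI)
qed simp

lemma overlaps_replicate_0:
  "overlaps n x x' (replicate z 0) (replicate z 0) = (if agree n x x' then z else 0)"
  by (induction z) (auto simp: overlaps_Cons)

definition indicator_vec :: "nat set \<Rightarrow> nat \<Rightarrow> nat" where
  "indicator_vec D = (\<lambda>i. if i \<in> D then 1 else 0)"

text \<open>The free steps made between two drops. They go in distinct directions, so that they are counted by binomial
coefficients; the other coordinates are reserved.\<close>

definition steps :: "nat \<Rightarrow> nat \<Rightarrow> (nat \<Rightarrow> nat) set" where
  "steps n K = indicator_vec ` {D. D \<subseteq> {..<n} \<and> D \<noteq> {} \<and> card D \<le> K}"

lemma card_small_subsets:
  assumes "finite S"
  shows "card {D. D \<subseteq> S \<and> D \<noteq> {} \<and> card D \<le> K} \<le> card S ^ K"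
proof -
  have "{D. D \<subseteq> S \<and> D \<noteq> {} \<and> card D \<le> K} \<subseteq> set ` words S K"
  proof
    fix D assume "D \<in> {D. D \<subseteq> S \<and> D \<noteq> {} \<and> card D \<le> K}"
    then have D: "D \<subseteq> S" "D \<noteq> {}" "card D \<le> K" by auto
    obtain xs where xs: "set xs = D" "length xs = card D"
      using finite_distinct_list[of D] finite_subset[OF D(1) assms] distinct_card by metis
    obtain a where a: "a \<in> D" using D(2) by blast
    have "set (xs @ replicate (K - card D) a) = D" using xs a by (auto simp: set_replicate_conv_if)
    moreover have "xs @ replicate (K - card D) a \<in> words S K"
      unfolding words_def using xs a D by (auto simp: set_replicate_conv_if)
    ultimately show "D \<in> set ` words S K" by blast
  qed
  then have "card {D. D \<subseteq> S \<and> D \<noteq> {} \<and> card D \<le> K} \<le> card (set ` words S K)"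
    using assms by (intro card_mono) auto
  also have "\<dots> \<le> card (words S K)" using assms by (intro card_image_le) auto
  finally show ?thesis using assms by (simp add: card_words)
qed

lemma finite_small_subsets: "finite S \<Longrightarrow> finite {D. D \<subseteq> S \<and> D \<noteq> {} \<and> card D \<le> K}"
  by (rule finite_subset[of _ "Pow S"]) auto

lemma finite_steps [simp]: "finite (steps n K)"
  unfolding steps_def by (rule finite_imageI, rule finite_small_subsets) simp

lemma card_steps_le: "card (steps n K) \<le> n ^ K"
proof -
  have "card (steps n K) \<le> card {D. D \<subseteq> {..<n} \<and> D \<noteq> {} \<and> card D \<le> K}"
    unfolding steps_def by (rule card_image_le, rule finite_small_subsets) simp
  then show ?thesis using card_small_subsets[of "{..<n}" K] by simp
qed

lemma mass_indicator_vec: "D \<subseteq> {..<n} \<Longrightarrow> mass n (indicator_vec D) = card D"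
  by (simp add: mass_def indicator_vec_def sum.If_cases Int_absorb1)

lemma mass_steps: "v \<in> steps n K \<Longrightarrow> mass n v \<le> K"
  by (auto simp: steps_def mass_indicator_vec)

lemma mass_words_steps: "vs \<in> words (steps n K) L \<Longrightarrow> mass n (sum_list vs) \<le> K * L"
proof (induction L arbitrary: vs)
  case (Suc L)
  then obtain v ws where "vs = v # ws" "v \<in> steps n K" "ws \<in> words (steps n K) L"
    by (auto simp: words_def length_Suc_conv)
  then show ?case using Suc.IH[of ws] mass_steps[of v n K] by simp
qed simp

lemma indicator_vec_agree_eq:
  assumes "D \<subseteq> {..<n}" "D' \<subseteq> {..<n}" "agree n (x + indicator_vec D) y" "agree n (x + indicator_vec D') y"
  shows "D = D'"
proof -
  have "indicator_vec D i = indicator_vec D' i" if "i < n" for i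
  proof -
    have "x i + indicator_vec D i = y i" "x i + indicator_vec D' i = y i"
      using assms(3,4) that by (auto simp: agree_def plus_fun_apply)
    then show ?thesis by linarith
  qed
  then have "i \<in> D \<longleftrightarrow> i \<in> D'" if "i < n" for i
    using that by (metis indicator_vec_def zero_neq_one)
  then show ?thesis using assms(1,2) by blast
qed

text \<open>Paths from \<open>x\<close> to a prescribed end point have few choices at every step, and at most one
  choice that overlaps with the target path.\<close>

lemma pinned_overlap_sum:
  fixes u :: real
  assumes u: "u \<ge> 1" and "L \<le> B"
  shows "(\<Sum>vs\<in>words (steps n K) L. if agree n (x + sum_list vs) y then u ^ overlaps n x x' vs ts else 0)
      \<le> (u + real ((K * B) ^ K)) ^ L"
  using assms(2)
proof (induction L arbitrary: x x' ts)
  case 0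
  show ?case unfolding words_0 by simp
next
  case (Suc L)
  let ?U = "steps n K" and ?Y = "real ((K * B) ^ K)"
  let ?f = "\<lambda>x x' ts vs. if agree n (x + sum_list vs) y then u ^ overlaps n x x' vs ts else 0"
  define V where "V = {v \<in> ?U. \<exists>vs\<in>words ?U L. agree n (x + sum_list (v # vs)) y}"
  \<comment> \<open>Only coordinates in which the end point still lies ahead can be incremented; there are at most \<open>K * B\<close> of them.\<close>
  define S where "S = {i. i < n \<and> x i < y i}"
  have Vsub: "V \<subseteq> ?U" by (auto simp: V_def)
  then have finV: "finite V" using finite_subset[OF Vsub finite_steps] by simp
  have cardV: "real (card V) \<le> ?Y"
  proof (cases "V = {}")
    case False
    then obtain v vs where v: "v \<in> ?U" "vs \<in> words ?U L" "agree n (x + sum_list (v # vs)) y"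
      by (auto simp: V_def)
    have "v # vs \<in> words ?U (Suc L)" using v by (auto simp: words_def)
    then have "mass n (sum_list (v # vs)) \<le> K * Suc L" by (rule mass_words_steps)
    moreover have "card S \<le> mass n (sum_list (v # vs))"
    proof -
      have "card S = (\<Sum>i\<in>S. 1)" by simp
      also have "\<dots> \<le> (\<Sum>i\<in>S. sum_list (v # vs) i)"
      proof (rule sum_mono)
        fix i assume "i \<in> S"
        then show "1 \<le> sum_list (v # vs) i"
          using v(3) unfolding agree_def S_def by (metis (no_types, lifting) One_nat_def Suc_leI add_0_right mem_Collect_eq not_gr_zero order_less_irrefl plus_fun_apply)
      qed
      also have "\<dots> \<le> mass n (sum_list (v # vs))"
        unfolding mass_def by (rule sum_mono2) (auto simp: S_def)
      finally show ?thesis .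
    qed
    moreover have "K * Suc L \<le> K * B" using Suc.prems by (intro mult_left_mono) auto
    ultimately have cS: "card S \<le> K * B" by linarith
    have "V \<subseteq> indicator_vec ` {D. D \<subseteq> S \<and> D \<noteq> {} \<and> card D \<le> K}"
    proof
      fix w assume "w \<in> V"
      then obtain ws D where w: "w = indicator_vec D" "D \<subseteq> {..<n}" "D \<noteq> {}" "card D \<le> K"
        and ag: "agree n (x + sum_list (w # ws)) y" unfolding V_def steps_def by blast
      have "D \<subseteq> S"
      proof
        fix i assume i: "i \<in> D"
        then have "w i = 1" "i < n" using w by (auto simp: indicator_vec_def)
        moreover have "x i + (w i + sum_list ws i) = y i"
          using ag \<open>i < n\<close> by (simp add: agree_def plus_fun_apply)
        ultimately show "i \<in> S" by (simp add: S_def)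
      qed
      then show "w \<in> indicator_vec ` {D. D \<subseteq> S \<and> D \<noteq> {} \<and> card D \<le> K}" using w by blast
    qed
    then have "card V \<le> card {D. D \<subseteq> S \<and> D \<noteq> {} \<and> card D \<le> K}"
      by (intro surj_card_le[of _ _ indicator_vec] finite_small_subsets) (auto simp: S_def)
    also have "\<dots> \<le> card S ^ K" by (rule card_small_subsets) (auto simp: S_def)
    also have "\<dots> \<le> (K * B) ^ K" using cS by (rule power_mono) simp
    finally show ?thesis by (metis of_nat_le_iff)
  qed simp
  define v' where "v' = hd ts"
  define c where "c v = (if ts \<noteq> [] \<and> agree n (x + v) (x' + v') then u else 1)" for v
  have c_sum: "(\<Sum>v\<in>V. c v) \<le> u + ?Y"
  proof -
    define Ov where "Ov = {v\<in>V. ts \<noteq> [] \<and> agree n (x + v) (x' + v')}"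
    have Ov1: "card Ov \<le> 1"
    proof (rule card_le_Suc0_iff_eq[THEN iffD2, unfolded One_nat_def[symmetric]])
      show "finite Ov" using finV by (simp add: Ov_def)
      show "\<forall>a1\<in>Ov. \<forall>a2\<in>Ov. a1 = a2"
      proof (intro ballI)
        fix a1 a2 assume a: "a1 \<in> Ov" "a2 \<in> Ov"
        then obtain D1 D2 where D: "a1 = indicator_vec D1" "D1 \<subseteq> {..<n}" "a2 = indicator_vec D2" "D2 \<subseteq> {..<n}"
          using Vsub unfolding Ov_def steps_def by blast
        then have "D1 = D2"
          using a unfolding Ov_def by (intro indicator_vec_agree_eq[of D1 n D2 x "x' + v'"]) auto
        then show "a1 = a2" using D by simp
      qed
    qed
    have "(\<Sum>v\<in>V. c v) \<le> (\<Sum>v\<in>V. 1 + (if v \<in> Ov then u - 1 else 0))"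
      by (rule sum_mono) (auto simp: c_def Ov_def)
    also have "\<dots> = card V + card Ov * (u - 1)"
      using finV by (simp add: sum.distrib sum.If_cases Ov_def Int_def)
    also have "\<dots> \<le> ?Y + 1 * (u - 1)"
      using cardV Ov1 u by (intro add_mono mult_right_mono) auto
    finally show ?thesis using u by simp
  qed
  have step: "(\<Sum>vs\<in>words ?U L. ?f x x' ts (v # vs)) \<le> c v * (u + ?Y) ^ L" for v
  proof (cases ts)
    case Nil
    have "(\<Sum>vs\<in>words ?U L. ?f x x' ts (v # vs)) = (\<Sum>vs\<in>words ?U L. ?f (x + v) x' [] vs)"
      by (rule sum.cong) (auto simp: Nil add.assoc)
    also have "\<dots> \<le> (u + ?Y) ^ L" using Suc by (intro Suc.IH) auto
    finally show ?thesis using Nil by (simp add: c_def)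
  next
    case (Cons w ws)
    have "(\<Sum>vs\<in>words ?U L. ?f x x' ts (v # vs)) = c v * (\<Sum>vs\<in>words ?U L. ?f (x + v) (x' + v') ws vs)"
      unfolding sum_distrib_left
      by (rule sum.cong) (auto simp: Cons add.assoc overlaps_Cons c_def v'_def)
    also have "\<dots> \<le> c v * (u + ?Y) ^ L" using Suc u by (intro mult_left_mono Suc.IH) (auto simp: c_def)
    finally show ?thesis .
  qed
  have "(\<Sum>vs\<in>words ?U (Suc L). ?f x x' ts vs) = (\<Sum>v\<in>?U. \<Sum>vs\<in>words ?U L. ?f x x' ts (v # vs))"
    by (rule sum_words_Suc)
  also have "\<dots> = (\<Sum>v\<in>V. \<Sum>vs\<in>words ?U L. ?f x x' ts (v # vs))"
    by (rule sum.mono_neutral_right) (auto simp: V_def)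
  also have "\<dots> \<le> (\<Sum>v\<in>V. c v * (u + ?Y) ^ L)" by (intro sum_mono step)
  also have "\<dots> \<le> (u + ?Y) * (u + ?Y) ^ L"
    unfolding sum_distrib_right[symmetric] using c_sum u by (intro mult_right_mono) auto
  finally show ?case by simp
qed

text \<open>Split a path at its last overlap: up to it the path is pinned to the target, and the at most \<open>b\<close> steps after it
are counted without constraint.\<close>

lemma late_overlap_sum:
  fixes u :: real
  assumes u: "u \<ge> 1" and n: "n \<ge> 1" "K \<ge> 1"
    and "length ts = L" "length ts' = b" "L + b \<le> B"
  defines "N \<equiv> real (card (steps n K))"
  shows "(\<Sum>vs\<in>words (steps n K) L. \<Sum>ws\<in>words (steps n K) b.
      if overlaps n (x + sum_list vs) (x' + sum_list ts) ws ts' = 0 then 0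
      else u ^ overlaps n x x' (vs @ ws) (ts @ ts'))
      \<le> real b * (u + real ((K * B) ^ K)) ^ (L + b) * N ^ b"
  using assms(5,6)
proof (induction b arbitrary: ts')
  case 0
  then show ?case unfolding words_0 by simp
next
  case (Suc b)
  let ?U = "steps n K" and ?Y = "real ((K * B) ^ K)"
  obtain rs r where ts': "ts' = rs @ [r]" "length rs = b" using Suc.prems by (metis length_Suc_conv_rev)
  have "indicator_vec {0} \<in> ?U" unfolding steps_def using n by (intro imageI) auto
  then have N: "N \<ge> 1" unfolding N_def by (metis Suc_leI card_gt_0_iff empty_iff finite_steps of_nat_1 of_nat_le_iff One_nat_def)
  let ?ov = "\<lambda>vs ws. overlaps n (x + sum_list vs) (x' + sum_list ts) ws"
  let ?end = "\<lambda>zs. agree n (x + sum_list zs) (x' + sum_list (ts @ ts'))"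
  have pt: "(if ?ov vs (ws @ [a]) ts' = 0 then 0 else u ^ overlaps n x x' (vs @ ws @ [a]) (ts @ ts'))
     \<le> (if ?end (vs @ ws @ [a]) then u ^ overlaps n x x' (vs @ ws @ [a]) (ts @ ts') else 0)
      + (if ?ov vs ws rs = 0 then 0 else u ^ overlaps n x x' (vs @ ws) (ts @ rs))"
    if "length vs = L" "length ws = b" for vs ws a
    using that assms(4) ts' u overlaps_snoc[of "vs @ ws" "ts @ rs" n x x' a r] overlaps_snoc[of ws rs n "x + sum_list vs" "x' + sum_list ts" a r]
    by (auto simp: add.assoc)
  have "(\<Sum>vs\<in>words ?U L. \<Sum>ws\<in>words ?U (Suc b).
      if ?ov vs ws ts' = 0 then 0 else u ^ overlaps n x x' (vs @ ws) (ts @ ts'))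
    = (\<Sum>vs\<in>words ?U L. \<Sum>ws\<in>words ?U b. \<Sum>a\<in>?U.
      if ?ov vs (ws @ [a]) ts' = 0 then 0 else u ^ overlaps n x x' (vs @ ws @ [a]) (ts @ ts'))"
    by (simp add: sum_words_snoc)
  also have "\<dots> \<le> (\<Sum>vs\<in>words ?U L. \<Sum>ws\<in>words ?U b. \<Sum>a\<in>?U.
       (if ?end (vs @ ws @ [a]) then u ^ overlaps n x x' (vs @ ws @ [a]) (ts @ ts') else 0)
      + (if ?ov vs ws rs = 0 then 0 else u ^ overlaps n x x' (vs @ ws) (ts @ rs)))"
    by (intro sum_mono pt) (auto simp: words_length)
  also have "\<dots> = (\<Sum>vs\<in>words ?U L. \<Sum>ws\<in>words ?U b. \<Sum>a\<in>?U.
       (if ?end (vs @ ws @ [a]) then u ^ overlaps n x x' (vs @ ws @ [a]) (ts @ ts') else 0))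
      + (\<Sum>vs\<in>words ?U L. \<Sum>ws\<in>words ?U b. \<Sum>a\<in>?U.
       (if ?ov vs ws rs = 0 then 0 else u ^ overlaps n x x' (vs @ ws) (ts @ rs)))"
    by (simp only: sum.distrib)
  also have "\<dots> = (\<Sum>zs\<in>words ?U (L + Suc b). if ?end zs then u ^ overlaps n x x' zs (ts @ ts') else 0)
      + (\<Sum>vs\<in>words ?U L. \<Sum>ws\<in>words ?U b. if ?ov vs ws rs = 0 then 0 else u ^ overlaps n x x' (vs @ ws) (ts @ rs)) * N"
  proof (rule arg_cong2[where f = "(+)"])
    show "(\<Sum>vs\<in>words ?U L. \<Sum>ws\<in>words ?U b. \<Sum>a\<in>?U.
       (if ?end (vs @ ws @ [a]) then u ^ overlaps n x x' (vs @ ws @ [a]) (ts @ ts') else 0))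
     = (\<Sum>zs\<in>words ?U (L + Suc b). if ?end zs then u ^ overlaps n x x' zs (ts @ ts') else 0)"
    by (simp only: sum_words_append sum_words_snoc)
    show "(\<Sum>vs\<in>words ?U L. \<Sum>ws\<in>words ?U b. \<Sum>a\<in>?U.
       (if ?ov vs ws rs = 0 then 0 else u ^ overlaps n x x' (vs @ ws) (ts @ rs)))
     = (\<Sum>vs\<in>words ?U L. \<Sum>ws\<in>words ?U b. if ?ov vs ws rs = 0 then 0 else u ^ overlaps n x x' (vs @ ws) (ts @ rs)) * N"
    by (simp only: sum_constant sum_distrib_right N_def mult.commute[of "real (card ?U)"])
  qed
  also have "\<dots> \<le> (u + ?Y) ^ (L + Suc b) + (real b * (u + ?Y) ^ (L + b) * N ^ b) * N"
    using Suc.prems ts' N by (intro add_mono mult_right_mono pinned_overlap_sum[OF u] Suc.IH) auto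
  also have "\<dots> \<le> (u + ?Y) ^ (L + Suc b) * N ^ Suc b + (real b * (u + ?Y) ^ (L + Suc b)) * N ^ Suc b"
  proof (rule add_mono)
    have "1 \<le> N ^ Suc b" using N by (rule one_le_power)
    then show "(u + ?Y) ^ (L + Suc b) \<le> (u + ?Y) ^ (L + Suc b) * N ^ Suc b"
      using u mult_left_mono[of 1 "N ^ Suc b" "(u + ?Y) ^ (L + Suc b)"] by simp
    have "(u + ?Y) ^ (L + b) \<le> (u + ?Y) ^ (L + Suc b)" using u of_nat_0_le_iff[of "(K * B) ^ K"] by (intro power_increasing) linarith+
    then have "real b * (u + ?Y) ^ (L + b) * N ^ Suc b \<le> real b * (u + ?Y) ^ (L + Suc b) * N ^ Suc b"
      using N by (intro mult_right_mono mult_left_mono) auto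
    then show "real b * (u + ?Y) ^ (L + b) * N ^ b * N \<le> real b * (u + ?Y) ^ (L + Suc b) * N ^ Suc b"
      by (simp add: mult.assoc mult.commute)
  qed
  also have "\<dots> = real (Suc b) * (u + ?Y) ^ (L + Suc b) * N ^ Suc b" by (simp add: algebra_simps)
  finally show ?case .
qed

section \<open>Superblocks and long paths\<close>

lemma steps_outside: "v \<in> steps n K \<Longrightarrow> n \<le> i \<Longrightarrow> v i = 0"
proof -
  assume "v \<in> steps n K" "n \<le> i"
  then obtain D where "v = indicator_vec D" "D \<subseteq> {..<n}" by (auto simp: steps_def)
  moreover from this \<open>n \<le> i\<close> have "i \<notin> D" by auto
  ultimately show ?thesis by (simp add: indicator_vec_def)
qed

text \<open>Blocks have \<open>b\<close> drops and \<open>f\<close> free steps; a stretch is a sequence of blocks with prescribed numbers of free steps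
\<open>\<phi> 0, \<phi> 1, \<dots>\<close>. Fixing these numbers keeps all paths close to the plane.\<close>

definition block :: "nat \<Rightarrow> nat \<Rightarrow> nat \<Rightarrow> nat \<Rightarrow> (nat \<Rightarrow> nat) list set" where
  "block n K b f = {ws \<in> words (steps n K) b. mass n (sum_list ws) = f}"

primrec stretch :: "nat \<Rightarrow> nat \<Rightarrow> nat \<Rightarrow> (nat \<Rightarrow> nat) \<Rightarrow> nat \<Rightarrow> (nat \<Rightarrow> nat) list set" where
  "stretch n K b \<phi> 0 = {[]}"
| "stretch n K b \<phi> (Suc i) = (\<lambda>(vs, ws). vs @ ws) ` (stretch n K b \<phi> i \<times> block n K b (\<phi> i))"

lemma block_words: "block n K b f \<subseteq> words (steps n K) b"
  by (auto simp: block_def)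

lemma finite_block [simp]: "finite (block n K b f)"
  by (rule finite_subset[OF block_words]) simp

lemma stretch_words: "stretch n K b \<phi> i \<subseteq> words (steps n K) (b * i)"
proof (induction i)
  case (Suc i)
  then show ?case using block_words[of n K b "\<phi> i"] by (fastforce simp: words_def)
qed simp

lemma finite_stretch [simp]: "finite (stretch n K b \<phi> i)"
  by (rule finite_subset[OF stretch_words]) simp

lemma stretch_length: "vs \<in> stretch n K b \<phi> i \<Longrightarrow> length vs = b * i"
  using stretch_words words_length by blast

lemma sum_stretch_Suc:
  "(\<Sum>zs\<in>stretch n K b \<phi> (Suc i). f zs) = (\<Sum>vs\<in>stretch n K b \<phi> i. \<Sum>ws\<in>block n K b (\<phi> i). f (vs @ ws))"
proof -
  have "inj_on (\<lambda>(vs, ws). vs @ ws) (stretch n K b \<phi> i \<times> block n K b (\<phi> i))"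
    by (auto simp: inj_on_def dest!: stretch_length)
  then show ?thesis
    unfolding stretch.simps by (subst sum.reindex) (simp_all add: sum.cartesian_product case_prod_unfold comp_def)
qed

lemma card_stretch_Suc: "card (stretch n K b \<phi> (Suc i)) = card (stretch n K b \<phi> i) * card (block n K b (\<phi> i))"
  using sum_stretch_Suc[of "\<lambda>_. 1 :: nat"] by simp

declare stretch.simps(2) [simp del]

lemma card_stretch: "card (stretch n K b \<phi> i) = (\<Prod>j<i. card (block n K b (\<phi> j)))"
  by (induction i) (simp_all add: card_stretch_Suc)

lemma mass_stretch: "vs \<in> stretch n K b \<phi> i \<Longrightarrow> mass n (sum_list vs) = (\<Sum>j<i. \<phi> j)"
  by (induction i arbitrary: vs) (auto simp: block_def stretch.simps(2))

text \<open>Each block either adds no overlap, or it contains a late overlap, which by hypothesis costs at most \<open>\<Gamma>\<close> on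
average.\<close>

lemma stretch_overlap_sum:
  fixes u :: real
  assumes u: "u \<ge> 1" and n: "n \<ge> 1" "K \<ge> 1" and \<Gamma>: "\<Gamma> \<ge> 0"
    and h: "\<And>i. i < I \<Longrightarrow> real b * (u + real ((K * B) ^ K)) ^ (b * Suc i) * real (card (steps n K)) ^ b
        \<le> \<Gamma> * real (card (stretch n K b \<phi> (Suc i)))"
    and B: "b * I \<le> B"
  shows "i \<le> I \<Longrightarrow> length ts = b * i \<Longrightarrow>
    (\<Sum>vs\<in>stretch n K b \<phi> i. u ^ overlaps n x x' vs ts) \<le> (1 + real i * \<Gamma>) * real (card (stretch n K b \<phi> i))"
proof (induction i arbitrary: ts)
  case 0
  then show ?case by simp
next
  case (Suc i)
  let ?D = "stretch n K b \<phi>" and ?Bl = "block n K b (\<phi> i)" and ?U = "steps n K"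
  define t1 t2 where "t1 = take (b * i) ts" and "t2 = drop (b * i) ts"
  have t: "ts = t1 @ t2" "length t1 = b * i" "length t2 = b"
    using Suc.prems by (simp_all add: t1_def t2_def)
  let ?late = "\<lambda>vs ws. if overlaps n (x + sum_list vs) (x' + sum_list t1) ws t2 = 0 then 0
      else u ^ overlaps n x x' (vs @ ws) (t1 @ t2)"
  have late0: "?late vs ws \<ge> 0" for vs ws using u by auto
  have pt: "u ^ overlaps n x x' (vs @ ws) ts \<le> u ^ overlaps n x x' vs t1 + ?late vs ws"
    if "vs \<in> ?D i" for vs ws
    using u t stretch_length[OF that] by (auto simp: overlaps_append)
  have "(\<Sum>zs\<in>?D (Suc i). u ^ overlaps n x x' zs ts) \<le> (\<Sum>vs\<in>?D i. \<Sum>ws\<in>?Bl. u ^ overlaps n x x' vs t1 + ?late vs ws)"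
    unfolding sum_stretch_Suc by (intro sum_mono pt)
  also have "\<dots> = (\<Sum>vs\<in>?D i. u ^ overlaps n x x' vs t1) * card ?Bl + (\<Sum>vs\<in>?D i. \<Sum>ws\<in>?Bl. ?late vs ws)"
    by (simp only: sum.distrib sum_constant sum_distrib_right mult.commute[of "real (card ?Bl)"])
  also have "(\<Sum>vs\<in>?D i. \<Sum>ws\<in>?Bl. ?late vs ws) \<le> (\<Sum>vs\<in>words ?U (b * i). \<Sum>ws\<in>words ?U b. ?late vs ws)"
    by (intro order_trans[OF sum_mono sum_mono2] sum_mono2 stretch_words block_words sum_nonneg late0) auto
  also have "\<dots> \<le> real b * (u + real ((K * B) ^ K)) ^ (b * i + b) * real (card ?U) ^ b"
  proof (rule late_overlap_sum[OF u n t(2,3)])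
    have "b * Suc i \<le> b * I" using Suc.prems by (intro mult_left_mono) auto
    then show "b * i + b \<le> B" using B by simp
  qed
  also have "\<dots> \<le> \<Gamma> * real (card (?D (Suc i)))" using h[of i] Suc.prems by (simp add: add.commute)
  also have "(\<Sum>vs\<in>?D i. u ^ overlaps n x x' vs t1) * card ?Bl \<le> ((1 + real i * \<Gamma>) * real (card (?D i))) * card ?Bl"
    using Suc t by (intro mult_right_mono Suc.IH) auto
  also have "\<dots> = (1 + real i * \<Gamma>) * real (card (?D (Suc i)))" by (simp add: card_stretch_Suc)
  finally show ?case by (simp add: algebra_simps)
qed

text \<open>The \<open>z\<close> additional drops at the end count as overlaps only if the whole stretch ends on the target; such
stretches are so rare that hypothesis \<open>z\<close> absorbs the factor \<open>(1 / q)\<close> to the power \<open>z\<close>.\<close>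

lemma superblock_overlap_sum:
  fixes u :: real
  assumes u: "u \<ge> 1" and n: "n \<ge> 1" "K \<ge> 1" and \<Gamma>: "\<Gamma> \<ge> 0"
    and h: "\<And>i. i < I \<Longrightarrow> real b * (u + real ((K * (b * I)) ^ K)) ^ (b * Suc i) * real (card (steps n K)) ^ b
        \<le> \<Gamma> * real (card (stretch n K b \<phi> (Suc i)))"
    and z: "u ^ z * (u + real ((K * (b * I)) ^ K)) ^ (b * I) \<le> real (card (stretch n K b \<phi> I))"
    and ts: "length ts = b * I"
  shows "(\<Sum>vs\<in>stretch n K b \<phi> I. u ^ overlaps n x x' (vs @ replicate z 0) (ts @ replicate z 0))
      \<le> (2 + real I * \<Gamma>) * real (card (stretch n K b \<phi> I))"
proof -
  let ?D = "stretch n K b \<phi> I" and ?U = "steps n K"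
  let ?pin = "\<lambda>vs. if agree n (x + sum_list vs) (x' + sum_list ts) then u ^ overlaps n x x' vs ts else 0"
  have "u ^ overlaps n x x' (vs @ replicate z 0) (ts @ replicate z 0)
      \<le> u ^ overlaps n x x' vs ts + u ^ z * ?pin vs" if "vs \<in> ?D" for vs
    using u ts stretch_length[OF that] by (auto simp: overlaps_append overlaps_replicate_0 power_add)
  then have "(\<Sum>vs\<in>?D. u ^ overlaps n x x' (vs @ replicate z 0) (ts @ replicate z 0))
      \<le> (\<Sum>vs\<in>?D. u ^ overlaps n x x' vs ts + u ^ z * ?pin vs)"
    by (rule sum_mono)
  also have "\<dots> = (\<Sum>vs\<in>?D. u ^ overlaps n x x' vs ts) + u ^ z * (\<Sum>vs\<in>?D. ?pin vs)"
    by (simp only: sum.distrib sum_distrib_left)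
  also have "(\<Sum>vs\<in>?D. ?pin vs) \<le> (\<Sum>vs\<in>words ?U (b * I). ?pin vs)"
    using u by (intro sum_mono2 stretch_words) auto
  also have "\<dots> \<le> (u + real ((K * (b * I)) ^ K)) ^ (b * I)"
    by (rule pinned_overlap_sum[OF u]) simp
  also have "(\<Sum>vs\<in>?D. u ^ overlaps n x x' vs ts) \<le> (1 + real I * \<Gamma>) * real (card ?D)"
    by (rule stretch_overlap_sum[OF u n \<Gamma> h _ order_refl ts]) auto
  finally have "(\<Sum>vs\<in>?D. u ^ overlaps n x x' (vs @ replicate z 0) (ts @ replicate z 0))
     \<le> (1 + real I * \<Gamma>) * real (card ?D) + u ^ z * (u + real ((K * (b * I)) ^ K)) ^ (b * I)"
    using u by (simp add: mult_left_mono)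
  then show ?thesis using z by (simp add: algebra_simps)
qed

text \<open>The reserved step of a superblock is attached to its first displacement, so that it makes no drop of its own.\<close>

definition shift_hd :: "(nat \<Rightarrow> nat) \<Rightarrow> (nat \<Rightarrow> nat) list \<Rightarrow> (nat \<Rightarrow> nat) list" where
  "shift_hd r vs = (r + hd vs) # tl vs"

definition segment :: "nat \<Rightarrow> (nat \<Rightarrow> nat) \<times> (nat \<Rightarrow> nat) list \<Rightarrow> (nat \<Rightarrow> nat) list" where
  "segment z s = shift_hd (fst s) (snd s @ replicate z 0)"

definition long_path :: "nat \<Rightarrow> ((nat \<Rightarrow> nat) \<times> (nat \<Rightarrow> nat) list) list \<Rightarrow> (nat \<Rightarrow> nat) list" where
  "long_path z ss = concat (map (segment z) ss)"

lemma length_shift_hd: "vs \<noteq> [] \<Longrightarrow> length (shift_hd r vs) = length vs"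
  by (simp add: shift_hd_def)

lemma sum_list_shift_hd: "vs \<noteq> [] \<Longrightarrow> sum_list (shift_hd r vs) = r + sum_list vs"
  by (cases vs) (simp_all add: shift_hd_def add.assoc)

lemma overlaps_shift_hd:
  "vs \<noteq> [] \<Longrightarrow> vs' \<noteq> [] \<Longrightarrow>
    overlaps n x x' (shift_hd r vs) (shift_hd r' vs') = overlaps n (x + r) (x' + r') vs vs'"
  by (cases vs; cases vs') (simp_all add: shift_hd_def overlaps_Cons add.assoc)

lemma sum_list_replicate_0 [simp]: "sum_list (replicate z (0 :: nat \<Rightarrow> nat)) = 0"
  by (induction z) auto

text \<open>The probability that a random walk with uniform steps from \<open>S\<close> and start \<open>x\<close> agrees after \<open>t\<close> steps with \<open>y\<close>
on the coordinates in \<open>C\<close>.\<close>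

primrec hit_prob :: "(nat \<Rightarrow> nat) set \<Rightarrow> nat set \<Rightarrow> nat \<Rightarrow> (nat \<Rightarrow> nat) \<Rightarrow> (nat \<Rightarrow> nat) \<Rightarrow> real" where
  "hit_prob S C 0 x y = (if \<forall>i\<in>C. x i = y i then 1 else 0)"
| "hit_prob S C (Suc t) x y = (\<Sum>r\<in>S. hit_prob S C t (x + r) y) / card S"

lemma hit_prob_cong:
  "(\<And>i. i \<in> C \<Longrightarrow> x i = x2 i) \<Longrightarrow> (\<And>i. i \<in> C \<Longrightarrow> y i = y2 i) \<Longrightarrow> hit_prob S C t x y = hit_prob S C t x2 y2"
proof (induction t arbitrary: x x2)
  case 0
  then show ?case by simp
next
  case (Suc t)
  have "hit_prob S C t (x + r) y = hit_prob S C t (x2 + r) y2" for r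
    using Suc.prems by (intro Suc.IH) (simp_all add: plus_fun_apply)
  then show ?case by simp
qed

lemma hit_prob_nonneg: "hit_prob S C t x y \<ge> 0"
  by (induction t arbitrary: x) (simp_all add: sum_nonneg)

text \<open>Twice the expected excess weight \<open>M - 1\<close> collected at future meetings with the target walk \<open>x'\<close>, plus one. It
bounds the expected product of these weights because it is at most \<open>2\<close>: at a meeting the product grows by
\<open>(M - 1)\<close> times a quantity that is again at most \<open>2\<close>.\<close>

definition potential :: "real \<Rightarrow> (nat \<Rightarrow> nat) set \<Rightarrow> nat set \<Rightarrow> (nat \<Rightarrow> nat) \<Rightarrow> (nat \<Rightarrow> nat) \<Rightarrow> (nat \<Rightarrow> nat) list \<Rightarrow> real" where
  "potential M S C x x' rs = 1 + 2 * (M - 1) * (\<Sum>t<length rs. hit_prob S C (Suc t) x (x' + sum_list (take (Suc t) rs)))"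

lemma potential_cong:
  "(\<And>i. i \<in> C \<Longrightarrow> x i = x2 i) \<Longrightarrow> (\<And>i. i \<in> C \<Longrightarrow> x' i = x2' i) \<Longrightarrow>
    potential M S C x x' rs = potential M S C x2 x2' rs"
  unfolding potential_def
  by (intro arg_cong2[where f = "(+)"] refl arg_cong2[where f = "(*)"] sum.cong hit_prob_cong) (auto simp: plus_fun_apply)

lemma potential_step:
  assumes "finite S" "S \<noteq> {}"
  shows "potential M S C x x' (r' # rs) =
    ((\<Sum>r\<in>S. potential M S C (x + r) (x' + r') rs) + 2 * (M - 1) * (\<Sum>r\<in>S. hit_prob S C 0 (x + r) (x' + r'))) / card S"
proof -
  let ?c = "real (card S)"
  have c: "?c > 0" using assms by (simp add: card_gt_0_iff)
  define h where "h t r = hit_prob S C t (x + r) (x' + r' + sum_list (take t rs))" for t r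
  have "(\<Sum>t<length (r' # rs). hit_prob S C (Suc t) x (x' + sum_list (take (Suc t) (r' # rs))))
      = (\<Sum>t<Suc (length rs). (\<Sum>r\<in>S. h t r) / ?c)"
    by (simp add: h_def add.assoc)
  also have "\<dots> = (\<Sum>r\<in>S. h 0 r) / ?c + (\<Sum>t<length rs. (\<Sum>r\<in>S. h (Suc t) r) / ?c)"
    by (rule sum.lessThan_Suc_shift)
  also have "(\<Sum>t<length rs. (\<Sum>r\<in>S. h (Suc t) r) / ?c) = (\<Sum>r\<in>S. \<Sum>t<length rs. h (Suc t) r) / ?c"
    by (simp only: sum_divide_distrib[symmetric] sum.swap[of _ S])
  finally have e: "(\<Sum>t<length (r' # rs). hit_prob S C (Suc t) x (x' + sum_list (take (Suc t) (r' # rs))))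
     = (\<Sum>r\<in>S. h 0 r) / ?c + (\<Sum>r\<in>S. \<Sum>t<length rs. h (Suc t) r) / ?c" .
  have p: "potential M S C (x + r) (x' + r') rs = 1 + 2 * (M - 1) * (\<Sum>t<length rs. h (Suc t) r)" for r
    unfolding potential_def h_def by simp
  have h0: "h 0 r = hit_prob S C 0 (x + r) (x' + r')" for r by (simp add: h_def)
  have "(\<Sum>r\<in>S. potential M S C (x + r) (x' + r') rs) = ?c + 2 * (M - 1) * (\<Sum>r\<in>S. \<Sum>t<length rs. h (Suc t) r)"
    unfolding p by (simp add: sum.distrib sum_distrib_left)
  then show ?thesis
    unfolding potential_def[of M S C x] e h0[symmetric] using c by (simp add: field_simps)
qed

text \<open>Induction over the superblocks, in which the potential of the reserved walk is a supersolution. If the reserved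
coordinates differ, the superblock has no overlaps and weight \<open>1\<close>; if they agree, its average weight is at
most \<open>M\<close>, irrespective of the main coordinates. The main coordinates may therefore be forgotten after each
superblock.\<close>

lemma long_path_overlap_sum:
  fixes u M :: real and D :: "(nat \<Rightarrow> nat) list set"
  assumes u: "u \<ge> 1" and M: "M \<ge> 1"
    and S: "finite S" "S \<noteq> {}" and D: "finite D" "D \<noteq> {}"
    and n: "n \<le> d" "C \<subseteq> {n..<d}" and B: "B \<ge> 1"
    and DU: "D \<subseteq> words (steps n K) B"
    and hitsum: "\<And>R x ys. (\<Sum>t<R. hit_prob S C (Suc t) x (ys t)) \<le> 1 / (2 * M)"
    and super: "\<And>x x' ts. length ts = B \<Longrightarrow>
      (\<Sum>vs\<in>D. u ^ overlaps n x x' (vs @ replicate z 0) (ts @ replicate z 0)) \<le> M * card D"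
  shows "ts \<in> words (S \<times> D) R \<Longrightarrow>
    (\<Sum>ss\<in>words (S \<times> D) R. u ^ overlaps d x x' (long_path z ss) (long_path z ts))
      \<le> real (card (S \<times> D)) ^ R * potential M S C x x' (map fst ts)"
proof (induction R arbitrary: ts x x')
  case 0
  show ?case using 0 unfolding words_0 by (simp add: long_path_def potential_def)
next
  case (Suc R)
  obtain r' vs' ts' where ts: "ts = (r', vs') # ts'" and r': "r' \<in> S" and vs': "vs' \<in> D" and ts': "ts' \<in> words (S \<times> D) R"
    using Suc.prems by (auto simp: words_def length_Suc_conv)
  let ?Z = "replicate z (0 :: nat \<Rightarrow> nat)"
  let ?W = "words (S \<times> D) R" and ?N = "real (card (S \<times> D)) ^ R"
  let ?pot = "\<lambda>r. potential M S C (x + r) (x' + r') (map fst ts')"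
  let ?ov = "\<lambda>r vs. overlaps d (x + r) (x' + r') (vs @ ?Z) (vs' @ ?Z)"
  have len: "length vs = B" "vs \<noteq> []" if "vs \<in> D" for vs using DU that B words_length by fastforce+
  have res: "sum_list vs i = 0" if vs: "vs \<in> D" and i: "i \<in> C" for vs i
  proof -
    have "set vs \<subseteq> steps n K" using DU vs by (auto simp: words_def)
    moreover have "v i = 0" if "v \<in> steps n K" for v
      using that n(2) i by (intro steps_outside) auto
    ultimately have "\<forall>v\<in>set vs. v i = 0" by blast
    then show ?thesis by (induction vs) (auto simp: plus_fun_apply zero_fun_apply)
  qed
  have pot2: "?pot r \<le> 2" for r
  proof -
    have "(\<Sum>t<length (map fst ts'). hit_prob S C (Suc t) (x + r) (x' + r' + sum_list (take (Suc t) (map fst ts')))) \<le> 1 / (2 * M)"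
      by (rule hitsum)
    then have "2 * (M - 1) * (\<Sum>t<length (map fst ts'). hit_prob S C (Suc t) (x + r) (x' + r' + sum_list (take (Suc t) (map fst ts')))) \<le> 2 * (M - 1) * (1 / (2 * M))"
      using M by (intro mult_left_mono) auto
    also have "\<dots> \<le> 1" using M by (simp add: field_simps)
    finally show ?thesis unfolding potential_def by simp
  qed
  have pot0: "?pot r \<ge> 0" for r
    unfolding potential_def using M by (intro add_nonneg_nonneg mult_nonneg_nonneg sum_nonneg hit_prob_nonneg) auto
  have split: "overlaps d x x' (long_path z ((r, vs) # ss)) (long_path z ts)
      = ?ov r vs + overlaps d (x + (r + sum_list vs)) (x' + (r' + sum_list vs')) (long_path z ss) (long_path z ts')"
    if "vs \<in> D" for r vs ss
    using len[OF that] len[OF vs']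
    by (simp add: long_path_def segment_def ts overlaps_append length_shift_hd sum_list_shift_hd overlaps_shift_hd)
  have rest: "(\<Sum>ss\<in>?W. u ^ overlaps d x x' (long_path z ((r, vs) # ss)) (long_path z ts)) \<le> u ^ ?ov r vs * (?N * ?pot r)"
    if vs: "vs \<in> D" for r vs
  proof -
    have "(\<Sum>ss\<in>?W. u ^ overlaps d x x' (long_path z ((r, vs) # ss)) (long_path z ts))
      = u ^ ?ov r vs * (\<Sum>ss\<in>?W. u ^ overlaps d (x + (r + sum_list vs)) (x' + (r' + sum_list vs')) (long_path z ss) (long_path z ts'))"
      by (simp add: split[OF vs] power_add sum_distrib_left)
    also have "\<dots> \<le> u ^ ?ov r vs * (?N * potential M S C (x + (r + sum_list vs)) (x' + (r' + sum_list vs')) (map fst ts'))"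
      using u by (intro mult_left_mono Suc.IH ts') auto
    also have "potential M S C (x + (r + sum_list vs)) (x' + (r' + sum_list vs')) (map fst ts') = ?pot r"
      by (rule potential_cong) (simp_all add: plus_fun_apply res vs vs')
    finally show ?thesis .
  qed
  have one: "(\<Sum>vs\<in>D. u ^ ?ov r vs) \<le> card D * (1 + (M - 1) * hit_prob S C 0 (x + r) (x' + r'))" for r
  proof (cases "\<forall>i\<in>C. (x + r) i = (x' + r') i")
    case True
    have "(\<Sum>vs\<in>D. u ^ ?ov r vs) \<le> (\<Sum>vs\<in>D. u ^ overlaps n (x + r) (x' + r') (vs @ ?Z) (vs' @ ?Z))"
      using u n by (intro sum_mono power_increasing overlaps_antimono) auto
    also have "\<dots> \<le> M * card D" using len(1)[OF vs'] by (rule super)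
    finally show ?thesis using True by (simp add: mult.commute)
  next
    case False
    then obtain i where i: "i \<in> C" "(x + r) i \<noteq> (x' + r') i" by blast
    have apart: "overlaps d a a' ws ws' = 0" if "a i \<noteq> a' i" "\<forall>w\<in>set ws. w i = 0" "\<forall>w\<in>set ws'. w i = 0" for a a' ws ws'
      using that
    proof (induction ws arbitrary: a a' ws')
      case (Cons w ws)
      show ?case
      proof (cases ws')
        case c: (Cons w' ws2)
        have "\<not> agree d (a + w) (a' + w')"
        proof
          assume "agree d (a + w) (a' + w')"
          moreover have "i < d" using i(1) n(2) by auto
          ultimately have "(a + w) i = (a' + w') i" unfolding agree_def by blast
          then show False using Cons.prems c by (simp add: plus_fun_apply)
        qed
        moreover have "overlaps d (a + w) (a' + w') ws ws2 = 0"
          using Cons.prems c by (intro Cons.IH) (auto simp: plus_fun_apply)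
        ultimately show ?thesis by (simp add: c overlaps_Cons)
      qed simp
    qed simp
    have zero: "\<forall>w\<in>set (vs @ ?Z). w i = 0" if vs: "vs \<in> D" for vs
    proof -
      have "set vs \<subseteq> steps n K" using DU vs by (auto simp: words_def)
      moreover have "v i = 0" if "v \<in> steps n K" for v
        using that n(2) i(1) by (intro steps_outside) auto
      ultimately show ?thesis by (auto simp: zero_fun_apply)
    qed
    have "?ov r vs = 0" if "vs \<in> D" for vs
      using apart[of "x + r" "x' + r'"] i(2) zero[OF that] zero[OF vs'] by blast
    then have "(\<Sum>vs\<in>D. u ^ ?ov r vs) = card D" by simp
    moreover have "hit_prob S C 0 (x + r) (x' + r') = 0" using False by simp
    ultimately show ?thesis by simp
  qed
  have "(\<Sum>ss\<in>words (S \<times> D) (Suc R). u ^ overlaps d x x' (long_path z ss) (long_path z ts))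
     = (\<Sum>r\<in>S. \<Sum>vs\<in>D. \<Sum>ss\<in>?W. u ^ overlaps d x x' (long_path z ((r, vs) # ss)) (long_path z ts))"
  proof -
    define G where "G r vs = (\<Sum>ss\<in>?W. u ^ overlaps d x x' (long_path z ((r, vs) # ss)) (long_path z ts))" for r vs
    have "(\<Sum>a\<in>S \<times> D. G (fst a) (snd a)) = (\<Sum>r\<in>S. \<Sum>vs\<in>D. G r vs)"
      by (simp only: sum.cartesian_product case_prod_unfold)
    then show ?thesis by (simp add: sum_words_Suc G_def)
  qed
  also have "\<dots> \<le> (\<Sum>r\<in>S. \<Sum>vs\<in>D. u ^ ?ov r vs * (?N * ?pot r))"
    by (intro sum_mono rest)
  also have "\<dots> = (\<Sum>r\<in>S. (\<Sum>vs\<in>D. u ^ ?ov r vs) * (?N * ?pot r))"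
    by (simp only: sum_distrib_right)
  also have "\<dots> \<le> (\<Sum>r\<in>S. (card D * (1 + (M - 1) * hit_prob S C 0 (x + r) (x' + r'))) * (?N * ?pot r))"
    using pot0 by (intro sum_mono mult_right_mono one) auto
  also have "\<dots> \<le> (\<Sum>r\<in>S. ?N * card D * (?pot r + 2 * (M - 1) * hit_prob S C 0 (x + r) (x' + r')))"
  proof (rule sum_mono)
    fix r
    have "(M - 1) * hit_prob S C 0 (x + r) (x' + r') * ?pot r \<le> (M - 1) * hit_prob S C 0 (x + r) (x' + r') * 2"
      using M hit_prob_nonneg pot2 by (intro mult_left_mono) auto
    then have "(1 + (M - 1) * hit_prob S C 0 (x + r) (x' + r')) * ?pot r \<le> ?pot r + 2 * (M - 1) * hit_prob S C 0 (x + r) (x' + r')"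
      by (simp add: algebra_simps del: hit_prob.simps)
    then have "(?N * card D) * ((1 + (M - 1) * hit_prob S C 0 (x + r) (x' + r')) * ?pot r) \<le> (?N * card D) * (?pot r + 2 * (M - 1) * hit_prob S C 0 (x + r) (x' + r'))"
      by (rule mult_left_mono) simp
    then show "(card D * (1 + (M - 1) * hit_prob S C 0 (x + r) (x' + r'))) * (?N * ?pot r) \<le> ?N * card D * (?pot r + 2 * (M - 1) * hit_prob S C 0 (x + r) (x' + r'))"
      by (simp only: mult.assoc mult.commute mult.left_commute)
  qed
  also have "\<dots> = ?N * card D * (card S * potential M S C x x' (r' # map fst ts'))"
    unfolding potential_step[OF S] using S
    by (simp add: sum_distrib_left[symmetric] sum.distrib card_gt_0_iff del: hit_prob.simps)
  also have "\<dots> = real (card (S \<times> D)) ^ Suc R * potential M S C x x' (map fst ts)"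
    by (simp add: ts card_cartesian_product mult.commute mult.left_commute)
  finally show ?case .
qed

section \<open>Reserved coordinates\<close>

text \<open>The analogue of \<open>hit_prob\<close> for a walk on \<open>k\<close> coordinates that increments a uniformly chosen coordinate in each
step.\<close>

primrec group_hit :: "nat \<Rightarrow> nat \<Rightarrow> (nat \<Rightarrow> nat) \<Rightarrow> (nat \<Rightarrow> nat) \<Rightarrow> real" where
  "group_hit k 0 a y = (if \<forall>c<k. a c = y c then 1 else 0)"
| "group_hit k (Suc t) a y = (\<Sum>c<k. group_hit k t (a(c := Suc (a c))) y) / k"

lemma group_hit_cong:
  "(\<And>c. c < k \<Longrightarrow> a c = a' c) \<Longrightarrow> group_hit k t a y = group_hit k t a' y"
proof (induction t arbitrary: a a')
  case (Suc t)
  have "group_hit k t (a(c := Suc (a c))) y = group_hit k t (a'(c := Suc (a' c))) y" if "c < k" for c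
    using Suc.prems that by (intro Suc.IH) auto
  then show ?case by simp
qed auto

lemma group_hit_nonneg: "group_hit k t a y \<ge> 0"
  by (induction t arbitrary: a) (auto intro!: divide_nonneg_nonneg sum_nonneg)

text \<open>Given all earlier steps, at most one choice of the last step leads to the target.\<close>

lemma group_hit_le_inverse:
  assumes "k \<ge> 1"
  shows "group_hit k (Suc t) a y \<le> 1 / k"
proof (induction t arbitrary: a)
  case 0
  define Q where "Q = {c. c < k \<and> (\<forall>c'<k. (a(c := Suc (a c))) c' = y c')}"
  have "c1 = c2" if "c1 \<in> Q" "c2 \<in> Q" for c1 c2
  proof (rule ccontr)
    assume "c1 \<noteq> c2"
    then have "Suc (a c1) = y c1" "a c1 = y c1" using that unfolding Q_def by force+
    then show False by simp
  qed
  moreover have "finite Q" by (simp add: Q_def)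
  ultimately have "card Q \<le> Suc 0" using card_le_Suc0_iff_eq[of Q] by blast
  moreover have "(\<Sum>c<k. group_hit k 0 (a(c := Suc (a c))) y) = (\<Sum>c\<in>Q. 1)"
    by (rule sum.mono_neutral_cong_right) (auto simp: Q_def)
  ultimately have "(\<Sum>c<k. group_hit k 0 (a(c := Suc (a c))) y) \<le> 1" by simp
  then show ?case unfolding group_hit.simps(2) by (intro divide_right_mono) auto
next
  case (Suc t)
  have "(\<Sum>c<k. group_hit k (Suc t) (a(c := Suc (a c))) y) \<le> (\<Sum>c<k. 1 / k)"
    by (intro sum_mono Suc.IH)
  then have "group_hit k (Suc (Suc t)) a y \<le> (\<Sum>c<k. 1 / k) / k"
    unfolding group_hit.simps(2)[of k "Suc t"] by (rule divide_right_mono) simp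
  then show ?case using assms by simp
qed

text \<open>With two coordinates the number of increments of the first one is binomial.\<close>

lemma coin_hit_le_binomial:
  "group_hit 2 t a y \<le> (if a 0 \<le> y 0 then real (t choose (y 0 - a 0)) / 2 ^ t else 0)"
proof (induction t arbitrary: a)
  case (Suc t)
  define a0 a1 where "a0 = a(0 := Suc (a 0))" and "a1 = a(1 := Suc (a 1))"
  have e: "group_hit 2 (Suc t) a y = (group_hit 2 t a0 y + group_hit 2 t a1 y) / 2"
    by (simp add: numeral_2_eq_2 a0_def a1_def)
  have at0: "a0 0 = Suc (a 0)" "a1 0 = a 0" by (simp_all add: a0_def a1_def)
  have i0: "group_hit 2 t a0 y \<le> (if Suc (a 0) \<le> y 0 then real (t choose (y 0 - Suc (a 0))) / 2 ^ t else 0)"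
    using Suc.IH[of a0] unfolding at0 .
  have i1: "group_hit 2 t a1 y \<le> (if a 0 \<le> y 0 then real (t choose (y 0 - a 0)) / 2 ^ t else 0)"
    using Suc.IH[of a1] unfolding at0 .
  consider "y 0 < a 0" | "y 0 = a 0" | j where "y 0 = a 0 + Suc j"
    by (metis add_Suc_right less_iff_Suc_add linorder_neqE_nat)
  then show ?case
  proof cases
    case 1
    then show ?thesis using i0 i1 unfolding e by simp
  next
    case 2
    then show ?thesis using i0 i1 unfolding e by simp
  next
    case (3 j)
    then show ?thesis using i0 i1 unfolding e by (simp add: field_simps)
  qed
qed simp

lemma central_binomial_sq_le: "(2 * real m + 1) * real ((2 * m) choose m) ^ 2 \<le> (4 ^ m) ^ 2"
proof (induction m)
  case (Suc m)
  have nat_eq: "Suc m * ((2 * Suc m) choose Suc m) = 2 * (2 * m + 1) * ((2 * m) choose m)"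
  proof -
    have "Suc m * ((2 * Suc m) choose Suc m) = (2 * Suc m) * ((2 * m + 1) choose m)"
      using Suc_times_binomial[of m "2 * m + 1"] by simp
    moreover have "(m + 1) * ((2 * m + 1) choose m) = (2 * m + 1) * ((2 * m) choose m)"
      using binomial_absorb_comp[of "2 * m + 1" m] by simp
    ultimately show ?thesis by simp
  qed
  have "real (Suc m * ((2 * Suc m) choose Suc m)) = real (2 * (2 * m + 1) * ((2 * m) choose m))"
    by (simp only: nat_eq)
  then have r: "real (Suc m) * real ((2 * Suc m) choose Suc m) = 2 * (2 * real m + 1) * real ((2 * m) choose m)"
    unfolding of_nat_mult of_nat_add of_nat_numeral of_nat_1 .
  define A B where "A = real ((2 * Suc m) choose Suc m)" and "B = real ((2 * m) choose m)"
  note r = r[folded A_def B_def]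
  have "(real (Suc m))\<^sup>2 * ((2 * real (Suc m) + 1) * A\<^sup>2) = (2 * real m + 3) * (real (Suc m) * A)\<^sup>2"
    by (simp add: power_mult_distrib)
  also have "\<dots> = (2 * real m + 3) * 4 * (2 * real m + 1) * ((2 * real m + 1) * B\<^sup>2)"
    unfolding r by (simp add: power2_eq_square algebra_simps)
  also have "\<dots> \<le> (2 * real m + 3) * 4 * (2 * real m + 1) * (4 ^ m)\<^sup>2"
    using Suc.IH[folded B_def] by (intro mult_left_mono) auto
  also have "\<dots> \<le> 16 * (real (Suc m))\<^sup>2 * (4 ^ m)\<^sup>2"
    by (intro mult_right_mono) (auto simp: power2_eq_square algebra_simps)
  also have "\<dots> = (real (Suc m))\<^sup>2 * (4 ^ Suc m)\<^sup>2"
    by (simp add: power2_eq_square)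
  finally have "(2 * real (Suc m) + 1) * A\<^sup>2 \<le> (4 ^ Suc m)\<^sup>2" by (simp add: mult_le_cancel_left)
  then show ?case by (simp only: A_def)
qed simp

lemma middle_binomial_sq_le: "real (t + 1) * real (t choose (t div 2)) ^ 2 \<le> (2 ^ t) ^ 2"
proof (cases "even t")
  case True
  then obtain m where t: "t = 2 * m" by blast
  then show ?thesis using central_binomial_sq_le[of m] by (simp add: power_mult add.commute)
next
  case False
  then obtain m where t: "t = 2 * m + 1" by (auto elim: oddE)
  have "(2 * Suc m) choose Suc m = 2 * (t choose m)"
    using binomial_symmetric[of m t] by (simp add: t)
  then have "(2 * real (Suc m) + 1) * (2 * real (t choose m))\<^sup>2 \<le> (4 ^ Suc m)\<^sup>2"
    using central_binomial_sq_le[of "Suc m"] by (simp del: binomial_Suc_Suc)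
  moreover have "(4 ^ Suc m :: real)\<^sup>2 = 4 * (2 ^ t)\<^sup>2" by (simp add: t power_mult power_mult_distrib)
  moreover have "(2 * real (Suc m) + 1) * (2 * real (t choose m))\<^sup>2 = 4 * ((2 * real (Suc m) + 1) * (real (t choose m))\<^sup>2)"
    by (simp add: power_mult_distrib)
  ultimately have "(2 * real (Suc m) + 1) * (real (t choose m))\<^sup>2 \<le> (2 ^ t)\<^sup>2" by linarith
  moreover have "real (t + 1) * (real (t choose m))\<^sup>2 \<le> (2 * real (Suc m) + 1) * (real (t choose m))\<^sup>2"
    by (intro mult_right_mono) (auto simp: t)
  ultimately have "real (t + 1) * (real (t choose m))\<^sup>2 \<le> (2 ^ t)\<^sup>2" by linarith
  moreover have "t div 2 = m" by (simp add: t)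
  ultimately show ?thesis by simp
qed

lemma coin_hit_sq_le: "(group_hit 2 t a y)\<^sup>2 \<le> 1 / (real t + 1)"
proof -
  have "group_hit 2 t a y \<le> real (t choose (t div 2)) / 2 ^ t"
  proof -
    have "real (t choose (y 0 - a 0)) / 2 ^ t \<le> real (t choose (t div 2)) / 2 ^ t"
      using binomial_maximum[of t "y 0 - a 0"] by (intro divide_right_mono) auto
    moreover have "0 \<le> real (t choose (t div 2)) / 2 ^ t" by simp
    ultimately show ?thesis using coin_hit_le_binomial[of t a y] by (smt (verit))
  qed
  then have "(group_hit 2 t a y)\<^sup>2 \<le> (real (t choose (t div 2)) / 2 ^ t)\<^sup>2"
    by (intro power_mono group_hit_nonneg)
  also have "\<dots> \<le> 1 / (real t + 1)"
    using middle_binomial_sq_le[of t] by (simp add: power_divide field_simps)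
  finally show ?thesis .
qed

text \<open>Four groups of two coordinates make the return probabilities summable, since each of them contributes a factor
of order \<open>t powr - (1 / 2)\<close>. The other groups have \<open>s\<close> coordinates, and each of them contributes a factor \<open>1 / s\<close>.\<close>

definition group_size :: "nat \<Rightarrow> nat \<Rightarrow> nat" where
  "group_size s g = (if g < 4 then 2 else s)"

definition choices :: "nat \<Rightarrow> nat \<Rightarrow> (nat \<Rightarrow> nat) set" where
  "choices s G = (\<Pi>\<^sub>E g\<in>{..<G}. {..<group_size s g})"

text \<open>Coordinate \<open>n + g * s + c\<close> is the \<open>c\<close>-th one of group \<open>g\<close>; it is incremented if group \<open>g\<close> chooses \<open>c\<close>.\<close>

definition choice_vec :: "nat \<Rightarrow> nat \<Rightarrow> nat \<Rightarrow> (nat \<Rightarrow> nat) \<Rightarrow> nat \<Rightarrow> nat" where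
  "choice_vec n s G \<kappa> = (\<lambda>i. if n \<le> i \<and> i < n + G * s \<and> \<kappa> ((i - n) div s) = (i - n) mod s then 1 else 0)"

definition reserved :: "nat \<Rightarrow> nat \<Rightarrow> nat \<Rightarrow> (nat \<Rightarrow> nat) set" where
  "reserved n s G = choice_vec n s G ` choices s G"

lemma group_index_bound:
  assumes "g < G" "c < s" shows "g * s + c < G * (s::nat)"
proof -
  have "g * s + c < Suc g * s" using assms by simp
  also have "\<dots> \<le> G * s" using assms by (intro mult_right_mono) auto
  finally show ?thesis .
qed

lemma choice_vec_at:
  assumes "g < G" "c < s"
  shows "choice_vec n s G \<kappa> (n + (g * s + c)) = (if \<kappa> g = c then 1 else 0)"
  using group_index_bound[OF assms] assms by (simp add: choice_vec_def)

lemma group_size_le: "s \<ge> 2 \<Longrightarrow> group_size s g \<le> s"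
  by (simp add: group_size_def)

lemma inj_choice_vec:
  assumes s: "s \<ge> 2" shows "inj_on (choice_vec n s G) (choices s G)"
proof (rule inj_onI)
  fix \<kappa> \<kappa>' assume \<kappa>: "\<kappa> \<in> choices s G" "\<kappa>' \<in> choices s G" and eq: "choice_vec n s G \<kappa> = choice_vec n s G \<kappa>'"
  show "\<kappa> = \<kappa>'"
  proof (rule PiE_ext[OF \<kappa>[unfolded choices_def]])
    fix g assume g: "g \<in> {..<G}"
    have "\<kappa> g \<in> {..<group_size s g}" using PiE_mem[OF \<kappa>(1)[unfolded choices_def] g] .
    then have lt: "\<kappa> g < s" using group_size_le[OF s, of g] by simp
    have gG: "g < G" using g by simp
    have 1: "choice_vec n s G \<kappa> (n + (g * s + \<kappa> g)) = 1"
      by (simp only: choice_vec_at[OF gG lt]) simp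
    have 2: "choice_vec n s G \<kappa>' (n + (g * s + \<kappa> g)) = (if \<kappa>' g = \<kappa> g then 1 else 0)"
      by (rule choice_vec_at[OF gG lt])
    show "\<kappa> g = \<kappa>' g" using 1 2 unfolding eq by (metis zero_neq_one)
  qed
qed

lemma finite_choices [simp]: "finite (choices s G)"
  by (auto simp: choices_def intro: finite_PiE)

lemma card_choices: "card (choices s G) = (\<Prod>g<G. group_size s g)"
  by (simp add: choices_def card_PiE)

text \<open>The groups choose independently of each other.\<close>

lemma hit_reserved_le_prod:
  assumes s: "s \<ge> 2"
  shows "hit_prob (reserved n s G) {n..<n + G * s} t x y
      \<le> (\<Prod>g<G. group_hit (group_size s g) t (\<lambda>c. x (n + (g * s + c))) (\<lambda>c. y (n + (g * s + c))))"
proof (induction t arbitrary: x)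
  case 0
  have "(\<forall>g<G. \<forall>c<group_size s g. x (n + (g * s + c)) = y (n + (g * s + c)))"
    if "\<forall>i\<in>{n..<n + G * s}. x i = y i"
    using that group_index_bound group_size_le[OF s] by (meson atLeastLessThan_iff le_add1 nat_add_left_cancel_less order_less_le_trans)
  then show ?case by (auto intro!: prod_nonneg)
next
  case (Suc t)
  let ?b = "\<lambda>g x. group_hit (group_size s g) t (\<lambda>c. x (n + (g * s + c))) (\<lambda>c. y (n + (g * s + c)))"
  define W where "W = (\<lambda>g k. group_hit (group_size s g) t ((\<lambda>c. x (n + (g * s + c)))(k := Suc (x (n + (g * s + k))))) (\<lambda>c. y (n + (g * s + c))))"
  have card: "card (reserved n s G) = card (choices s G)"
    unfolding reserved_def by (rule card_image[OF inj_choice_vec[OF s]])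
  have "hit_prob (reserved n s G) {n..<n + G * s} (Suc t) x y
      = (\<Sum>\<kappa>\<in>choices s G. hit_prob (reserved n s G) {n..<n + G * s} t (x + choice_vec n s G \<kappa>) y) / card (choices s G)"
    unfolding hit_prob.simps card unfolding reserved_def by (subst sum.reindex[OF inj_choice_vec[OF s]]) simp
  also have "\<dots> \<le> (\<Sum>\<kappa>\<in>choices s G. \<Prod>g<G. ?b g (x + choice_vec n s G \<kappa>)) / card (choices s G)"
    by (intro divide_right_mono sum_mono Suc.IH) simp
  also have "(\<Sum>\<kappa>\<in>choices s G. \<Prod>g<G. ?b g (x + choice_vec n s G \<kappa>)) = (\<Sum>\<kappa>\<in>choices s G. \<Prod>g<G. W g (\<kappa> g))"
  proof (intro sum.cong prod.cong refl)
    fix \<kappa> g assume "\<kappa> \<in> choices s G" and g: "g \<in> {..<G}"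
    show "?b g (x + choice_vec n s G \<kappa>) = W g (\<kappa> g)"
      unfolding W_def
    proof (rule group_hit_cong)
      fix c assume "c < group_size s g"
      then have "c < s" using group_size_le[OF s, of g] by simp
      then show "(x + choice_vec n s G \<kappa>) (n + (g * s + c)) =
          ((\<lambda>c. x (n + (g * s + c)))(\<kappa> g := Suc (x (n + (g * s + \<kappa> g))))) c"
        using choice_vec_at[of g G c s n \<kappa>] g by (cases "c = \<kappa> g") (simp_all add: plus_fun_apply)
    qed
  qed
  also have "\<dots> = (\<Prod>g<G. \<Sum>k<group_size s g. W g k)"
    unfolding choices_def by (subst prod_sum_PiE[of "{..<G}" "\<lambda>g. {..<group_size s g}" W]) simp_all
  also have "(\<Prod>g<G. \<Sum>k<group_size s g. W g k) / card (choices s G)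
      = (\<Prod>g<G. group_hit (group_size s g) (Suc t) (\<lambda>c. x (n + (g * s + c))) (\<lambda>c. y (n + (g * s + c))))"
    by (simp add: card_choices prod_dividef W_def)
  finally show ?case .
qed

lemma hit_reserved_le:
  assumes s: "s \<ge> 2" and G: "G \<ge> 4"
  shows "hit_prob (reserved n s G) {n..<n + G * s} (Suc t) x y \<le> 1 / (real t + 2)\<^sup>2 / real s ^ (G - 4)"
proof -
  let ?b = "\<lambda>g. group_hit (group_size s g) (Suc t) (\<lambda>c. x (n + (g * s + c))) (\<lambda>c. y (n + (g * s + c)))"
  have "hit_prob (reserved n s G) {n..<n + G * s} (Suc t) x y \<le> (\<Prod>g<G. ?b g)"
    by (rule hit_reserved_le_prod[OF s])
  also have "\<dots> = (\<Prod>g<4. ?b g) * (\<Prod>g\<in>{4..<G}. ?b g)"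
    using G by (subst prod.union_disjoint[symmetric]) (auto intro!: prod.cong)
  also have "\<dots> \<le> (\<Prod>g<4::nat. sqrt (1 / (real t + 2))) * (\<Prod>g\<in>{4..<G}. 1 / real s)"
  proof (intro mult_mono prod_mono prod_nonneg conjI group_hit_nonneg ballI)
    fix g :: nat assume "g \<in> {..<4}"
    then have gs: "group_size s g = 2" by (simp add: group_size_def)
    have "(?b g)\<^sup>2 \<le> 1 / (real (Suc t) + 1)" unfolding gs by (rule coin_hit_sq_le)
    then have "(?b g)\<^sup>2 \<le> 1 / (real t + 2)" by (simp add: add.commute)
    then show "?b g \<le> sqrt (1 / (real t + 2))" by (rule real_le_rsqrt)
  next
    fix g assume "g \<in> {4..<G}"
    then have gs: "group_size s g = s" by (simp add: group_size_def)
    show "?b g \<le> 1 / real s" unfolding gs by (rule group_hit_le_inverse) (use s in simp)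
  qed auto
  also have "(\<Prod>g<4::nat. sqrt (1 / (real t + 2))) = ((sqrt (1 / (real t + 2)))\<^sup>2)\<^sup>2"
    by (simp flip: power_mult del: real_sqrt_pow2)
  also have "\<dots> = 1 / (real t + 2)\<^sup>2" by (simp add: power_divide)
  finally show ?thesis by (simp add: power_divide)
qed

lemma sum_inverse_squares_le: "(\<Sum>t<R. 1 / (real t + 2)\<^sup>2) \<le> 1"
proof -
  have "(\<Sum>t<R. 1 / (real t + 2)\<^sup>2) \<le> 1 - 1 / (real R + 1)"
  proof (induction R)
    case (Suc R)
    have "1 / (real R + 2)\<^sup>2 \<le> 1 / ((real R + 1) * (real R + 2))"
      by (intro divide_left_mono) (auto simp: power2_eq_square intro: mult_right_mono)
    also have "\<dots> = 1 / (real R + 1) - 1 / (real (Suc R) + 1)" by (simp add: field_simps)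
    finally show ?case using Suc by simp
  qed simp
  also have "\<dots> \<le> 1" by simp
  finally show ?thesis .
qed

lemma hit_reserved_sum_le:
  assumes "s \<ge> 2" "G \<ge> 4"
  shows "(\<Sum>t<R. hit_prob (reserved n s G) {n..<n + G * s} (Suc t) x (ys t)) \<le> 1 / real s ^ (G - 4)"
proof -
  have "(\<Sum>t<R. hit_prob (reserved n s G) {n..<n + G * s} (Suc t) x (ys t)) \<le> (\<Sum>t<R. 1 / (real t + 2)\<^sup>2 / real s ^ (G - 4))"
    by (intro sum_mono hit_reserved_le assms)
  also have "\<dots> = (\<Sum>t<R. 1 / (real t + 2)\<^sup>2) / real s ^ (G - 4)" by (rule sum_divide_distrib[symmetric])
  also have "\<dots> \<le> 1 / real s ^ (G - 4)" by (intro divide_right_mono sum_inverse_squares_le) simp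
  finally show ?thesis .
qed

lemma mass_reserved: "v \<in> reserved n s G \<Longrightarrow> mass d v \<le> G"
proof -
  assume "v \<in> reserved n s G"
  then obtain \<kappa> where v: "v = choice_vec n s G \<kappa>" by (auto simp: reserved_def)
  let ?A = "{i. n \<le> i \<and> i < n + G * s \<and> \<kappa> ((i - n) div s) = (i - n) mod s}"
  have "?A \<subseteq> (\<lambda>g. n + (g * s + \<kappa> g)) ` {..<G}"
  proof
    fix i assume i: "i \<in> ?A"
    then have "i = n + ((i - n) div s * s + \<kappa> ((i - n) div s))" by simp
    moreover have "(i - n) div s < G" using i by (auto intro!: less_mult_imp_div_less)
    ultimately show "i \<in> (\<lambda>g. n + (g * s + \<kappa> g)) ` {..<G}" by blast
  qed
  then have "card ?A \<le> G" using surj_card_le[of "{..<G}" ?A] by simp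
  moreover have "mass d v = card ({..<d} \<inter> ?A)"
    unfolding mass_def v choice_vec_def by (simp add: sum.If_cases)
  moreover have "card ({..<d} \<inter> ?A) \<le> card ?A" by (intro card_mono) auto
  ultimately show ?thesis by linarith
qed

lemma reserved_nonempty: "s \<ge> 2 \<Longrightarrow> reserved n s G \<noteq> {}"
  unfolding reserved_def choices_def by (auto simp: PiE_eq_empty_iff group_size_def lessThan_empty_iff)

lemma mass_words_extend: "vs \<in> words (steps n K) L \<Longrightarrow> n \<le> d \<Longrightarrow> mass d (sum_list vs) = mass n (sum_list vs)"
proof -
  assume vs: "vs \<in> words (steps n K) L" and "n \<le> d"
  have "sum_list vs i = 0" if "n \<le> i" for i
  proof -
    have "\<forall>v\<in>set vs. v i = 0" using vs steps_outside that by (auto simp: words_def)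
    then show ?thesis by (induction vs) (auto simp: plus_fun_apply zero_fun_apply)
  qed
  then show ?thesis unfolding mass_def using \<open>n \<le> d\<close> by (intro sum.mono_neutral_right) auto
qed

section \<open>A criterion in fixed dimension\<close>

text \<open>The assumptions on \<open>\<Gamma>\<close> and \<open>z\<close> say that pinned paths are rare among all paths; \<open>M\<close> that the reserved groups are
large enough to compensate the average weight \<open>2 + I \<Gamma>\<close> of a superblock; and \<open>tilt\<close> that each superblock gains at
least \<open>1\<close> on the plane, so that \<open>H\<close> superblocks lead from height \<open>H\<close> to the plane.\<close>

theorem no_surface_criterion:
  fixes q \<alpha> \<Gamma> :: real
  assumes q: "0 < q" "q \<le> 1" and \<alpha>: "\<alpha> < 1"
    and pos: "n \<ge> 1" "K \<ge> 1" "b \<ge> 1" "I \<ge> 1" and s: "s \<ge> 2" and G: "G \<ge> 4"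
    and d: "n + G * s \<le> d" and \<Gamma>: "\<Gamma> \<ge> 0"
    and h: "\<And>i. i < I \<Longrightarrow> real b * (1 / q + real ((K * (b * I)) ^ K)) ^ (b * Suc i) * real (card (steps n K)) ^ b
        \<le> \<Gamma> * real (card (stretch n K b \<phi> (Suc i)))"
    and z: "(1 / q) ^ z * (1 / q + real ((K * (b * I)) ^ K)) ^ (b * I) \<le> real (card (stretch n K b \<phi> I))"
    and M: "2 * (2 + real I * \<Gamma>) \<le> real s ^ (G - 4)"
    and tilt: "(1 - \<alpha>) * (real (\<Sum>j<I. \<phi> j) + real G) + 1 \<le> real (b * I + z)"
  shows "measure (perc d (1 - q)) (LIP \<alpha> d (\<lambda>i\<in>{..<d}. 1)) < 1"
proof (rule LIP_not_almost_sure[OF q])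
  fix H :: nat
  define D where "D = stretch n K b \<phi> I"
  define S where "S = reserved n s G"
  let ?M = "2 + real I * \<Gamma>"
  have M1: "?M \<ge> 1" using \<Gamma> by simp
  have u: "1 / q \<ge> 1" using q by simp
  have S: "finite S" "S \<noteq> {}" using reserved_nonempty[OF s] by (auto simp: S_def reserved_def)
  have "1 \<le> (1 / q) ^ z * (1 / q + real ((K * (b * I)) ^ K)) ^ (b * I)"
    using u of_nat_0_le_iff[of "(K * (b * I)) ^ K", where 'a = real]
    by (intro mult_ge1_I one_le_power) linarith+
  then have D: "finite D" "D \<noteq> {}" using z by (auto simp: D_def)
  have B: "b * I \<ge> 1" using pos by simp
  have sub: "{n..<n + G * s} \<subseteq> {n..<d}" "n \<le> d" using d by auto
  have DU: "D \<subseteq> words (steps n K) (b * I)" unfolding D_def by (rule stretch_words)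
  have Mb: "1 / real s ^ (G - 4) \<le> 1 / (2 * ?M)" 
  proof (rule frac_le)
    have "0 \<le> real I * \<Gamma>" using \<Gamma> by simp
    then show "0 < 2 * ?M" by simp
  qed (use M in auto)
  have hs: "(\<Sum>t<R. hit_prob S {n..<n + G * s} (Suc t) x (ys t)) \<le> 1 / (2 * ?M)" for R x ys
    unfolding S_def using hit_reserved_sum_le[OF s G] Mb by (rule order_trans)
  have sb: "(\<Sum>vs\<in>D. (1 / q) ^ overlaps n x x' (vs @ replicate z 0) (ts @ replicate z 0)) \<le> ?M * card D"
    if "length ts = b * I" for x x' ts
    unfolding D_def by (rule superblock_overlap_sum[OF u pos(1,2) \<Gamma> h z that])
  define J where "J = words (S \<times> D) H"
  have J: "finite J" "card J = card (S \<times> D) ^ H" using S D by (auto simp: J_def card_words)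
  have Jne: "J \<noteq> {}"
  proof -
    obtain a where "a \<in> S \<times> D" using S D by auto
    then have "replicate H a \<in> J" by (auto simp: J_def words_def)
    then show ?thesis by blast
  qed
  have sum: "(\<Sum>j\<in>J. (1 / q) ^ overlaps d 0 0 (long_path z j) (long_path z k)) \<le> 2 * card J" if k: "k \<in> J" for k
  proof -
    have "(\<Sum>j\<in>J. (1 / q) ^ overlaps d 0 0 (long_path z j) (long_path z k))
        \<le> real (card (S \<times> D)) ^ H * potential ?M S {n..<n + G * s} 0 0 (map fst k)"
      using k unfolding J_def by (intro long_path_overlap_sum[OF u M1 S D sub(2,1) B DU hs sb])
    also have "\<dots> \<le> real (card (S \<times> D)) ^ H * 2"
    proof (rule mult_left_mono)
      have "2 * (?M - 1) * (\<Sum>t<length (map fst k). hit_prob S {n..<n + G * s} (Suc t) 0 (0 + sum_list (take (Suc t) (map fst k)))) \<le> 2 * (?M - 1) * (1 / (2 * ?M))"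
        using M1 by (intro mult_left_mono hs) auto
      also have "\<dots> \<le> 1" using M1 by (simp add: field_simps)
      finally show "potential ?M S {n..<n + G * s} 0 0 (map fst k) \<le> 2" unfolding potential_def by linarith
    qed simp
    finally show ?thesis by (simp add: J)
  qed
  have low: "int H + int (mass d (sum_list (long_path z j))) - int (length (long_path z j)) \<le> \<lfloor>\<alpha> * mass d (sum_list (long_path z j))\<rfloor>"
    if j: "j \<in> J" for j
  proof -
    have seg: "mass d (sum_list (segment z a)) \<le> (\<Sum>j<I. \<phi> j) + G" "length (segment z a) = b * I + z" if "a \<in> S \<times> D" for a
    proof -
      obtain r vs where a: "a = (r, vs)" "r \<in> S" "vs \<in> D" using \<open>a \<in> S \<times> D\<close> by auto
      have l: "length vs = b * I" "vs \<noteq> []" using a DU B words_length by fastforce+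
      have "mass d (sum_list vs) = (\<Sum>j<I. \<phi> j)"
        using mass_words_extend[of vs n K "b * I" d] DU a sub(2) mass_stretch[of vs n K b \<phi> I] by (auto simp: D_def)
      moreover have "mass d r \<le> G" using a mass_reserved by (simp add: S_def)
      ultimately show "mass d (sum_list (segment z a)) \<le> (\<Sum>j<I. \<phi> j) + G"
        using l by (simp add: a segment_def sum_list_shift_hd)
      show "length (segment z a) = b * I + z" using l by (simp add: a segment_def length_shift_hd)
    qed
    have gen: "mass d (sum_list (long_path z j)) \<le> R * ((\<Sum>j<I. \<phi> j) + G) \<and> length (long_path z j) = R * (b * I + z)"
      if "j \<in> words (S \<times> D) R" for j R
      using that
    proof (induction R arbitrary: j)
      case 0
      then show ?case by (simp add: long_path_def)
    next
      case (Suc R)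
      then obtain a k where "j = a # k" "a \<in> S \<times> D" "k \<in> words (S \<times> D) R"
        by (auto simp: words_def length_Suc_conv)
      then show ?case using Suc.IH[of k] seg[of a] by (simp add: long_path_def)
    qed
    let ?m = "mass d (sum_list (long_path z j))"
    have m: "?m \<le> H * ((\<Sum>j<I. \<phi> j) + G)" and len: "length (long_path z j) = H * (b * I + z)"
      using gen[of j H] j by (auto simp: J_def)
    have "(1 - \<alpha>) * real ?m \<le> (1 - \<alpha>) * real (H * ((\<Sum>j<I. \<phi> j) + G))"
      using m \<alpha> by (intro mult_left_mono) (auto simp only: of_nat_le_iff)
    also have "\<dots> = real H * ((1 - \<alpha>) * (real (\<Sum>j<I. \<phi> j) + real G))" by simp
    also have "\<dots> \<le> real H * (real (b * I + z) - 1)"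
      using tilt by (intro mult_left_mono) auto
    finally have "real H + real ?m - real (H * (b * I + z)) \<le> \<alpha> * real ?m"
      by (simp add: algebra_simps)
    then show ?thesis unfolding len by (subst le_floor_iff) simp
  qed
  show "\<exists>(J :: ((nat \<Rightarrow> nat) \<times> (nat \<Rightarrow> nat) list) list set) \<pi>. finite J \<and> J \<noteq> {} \<and>
      (\<forall>j\<in>J. int H + int (mass d (sum_list (\<pi> j))) - int (length (\<pi> j)) \<le> \<lfloor>\<alpha> * mass d (sum_list (\<pi> j))\<rfloor>) \<and>
      (\<forall>k\<in>J. (\<Sum>j\<in>J. (1 / q) ^ overlaps d 0 0 (\<pi> j) (\<pi> k)) \<le> 2 * card J)"
    using J(1) Jne low sum by (intro exI[of _ J] exI[of _ "long_path z"]) auto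
qed

section \<open>The growth rate of the number of paths\<close>

text \<open>The mean of a Poisson variable with parameter \<open>t\<close> conditioned to be positive. In a typical path the number of
free steps before a drop is such a variable, with the parameter for which the mean is \<open>\<beta>\<close>.\<close>

definition tp_mean :: "real \<Rightarrow> real" where "tp_mean t = t * exp t / (exp t - 1)"

lemma exp_gt_one_plus: "t \<noteq> 0 \<Longrightarrow> 1 + t < exp (t :: real)"
proof -
  assume "t \<noteq> 0"
  then have sq: "(t / 2)\<^sup>2 > 0" by simp
  show ?thesis
  proof (cases "1 + t / 2 \<ge> 0")
    case True
    then have "(1 + t / 2)\<^sup>2 \<le> (exp (t / 2))\<^sup>2"
      using exp_ge_add_one_self[of "t / 2"] by (intro power_mono) auto
    also have "\<dots> = exp t" by (simp add: power2_eq_square flip: exp_add)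
    finally have "(1 + t / 2)\<^sup>2 \<le> exp t" .
    moreover have "(1 + t / 2)\<^sup>2 = 1 + t + (t / 2)\<^sup>2" by (simp add: power2_sum)
    ultimately show ?thesis using sq by linarith
  next
    case False
    then have "1 + t < 0" by simp
    then show ?thesis using exp_gt_zero[of t] by linarith
  qed
qed

text \<open>Excludes negative solutions of the equation for \<open>\<theta>\<close>, whose right-hand side exceeds \<open>1\<close>.\<close>

lemma tp_mean_neg_less_1: "t < 0 \<Longrightarrow> tp_mean t < 1"
proof -
  assume t: "t < 0"
  have "exp t - 1 < 0" using t by simp
  moreover have "exp t - 1 < t * exp t"
    using exp_gt_one_plus[of "- t"] t by (simp add: exp_minus field_simps)
  ultimately show ?thesis unfolding tp_mean_def by (simp add: divide_less_eq)
qed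

lemma tp_mean_le_add_1: "t > 0 \<Longrightarrow> tp_mean t \<le> 1 + t"
  using exp_ge_add_one_self[of t] unfolding tp_mean_def by (simp add: divide_le_eq algebra_simps)

lemma tp_mean_strict_mono: assumes "0 < s" "s < t" shows "tp_mean s < tp_mean t"
proof (rule DERIV_pos_imp_increasing[OF assms(2)])
  fix x assume x: "s \<le> x" "x \<le> t"
  have x0: "x > 0" using x assms by simp
  then have e: "exp x - 1 > 0" by simp
  have "(tp_mean has_real_derivative ((exp x + x * exp x) * (exp x - 1) - x * exp x * exp x) / ((exp x - 1) * (exp x - 1))) (at x)"
    unfolding tp_mean_def[abs_def] using e by (auto intro!: derivative_eq_intros)
  moreover have "((exp x + x * exp x) * (exp x - 1) - x * exp x * exp x) = exp x * (exp x - 1 - x)"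
    by (simp add: algebra_simps)
  moreover have "exp x * (exp x - 1 - x) > 0" using exp_gt_one_plus[of x] x0 by simp
  ultimately show "\<exists>y. (tp_mean has_real_derivative y) (at x) \<and> 0 < y" using e by (metis divide_pos_pos mult_pos_pos)
qed

lemma tp_mean_solution:
  assumes "\<beta> > 1" obtains \<theta> where "\<theta> > 0" "tp_mean \<theta> = \<beta>"
proof -
  \<comment> \<open>A point at which \<open>tp_mean\<close> is still below \<open>\<beta>\<close>, by \<open>tp_mean t \<le> 1 + t\<close>.\<close>
  define a where "a = (\<beta> - 1) / 2"
  have a: "0 < a" "a < \<beta>" "tp_mean a \<le> \<beta>" using tp_mean_le_add_1[of a] assms by (auto simp: a_def field_simps)
  have "\<beta> \<le> tp_mean \<beta>"
    using assms unfolding tp_mean_def by (simp add: le_divide_eq algebra_simps)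
  moreover have "continuous_on {a..\<beta>} tp_mean"
    unfolding tp_mean_def[abs_def] using a by (intro continuous_intros) auto
  ultimately obtain x where "a \<le> x" "tp_mean x = \<beta>" using IVT'[of tp_mean a \<beta> \<beta>] a by auto
  then show ?thesis using that[of x] a by auto
qed

lemma tp_mean_unique_solution:
  assumes "\<beta> > 1" shows "\<exists>!\<theta>::real. \<theta> \<noteq> 0 \<and> \<theta> * exp \<theta> / (exp \<theta> - 1) = \<beta>"
proof -
  obtain \<theta> where \<theta>: "\<theta> > 0" "tp_mean \<theta> = \<beta>" using tp_mean_solution[OF assms] .
  show ?thesis
  proof (rule ex1I[of _ \<theta>])
    show "\<theta> \<noteq> 0 \<and> \<theta> * exp \<theta> / (exp \<theta> - 1) = \<beta>" using \<theta> by (simp add: tp_mean_def)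
    fix t :: real assume t: "t \<noteq> 0 \<and> t * exp t / (exp t - 1) = \<beta>"
    then have rt: "tp_mean t = \<beta>" by (simp add: tp_mean_def)
    have "t > 0" using tp_mean_neg_less_1[of t] rt t assms by fastforce
    then show "t = \<theta>" using tp_mean_strict_mono[of t \<theta>] tp_mean_strict_mono[of \<theta> t] \<theta> rt by (metis less_irrefl linorder_neqE_linordered_idom)
  qed
qed

text \<open>The logarithmic derivative of \<open>(exp x - 1) x powr - \<beta>\<close> is \<open>(tp_mean x - \<beta>) / x\<close>, so the function has a strict
minimum where \<open>tp_mean\<close> equals \<open>\<beta>\<close>.\<close>

lemma tilted_exp_minimum:
  assumes \<theta>: "\<theta> > 0" "tp_mean \<theta> = \<beta>" and t: "t > 0" "t \<noteq> \<theta>"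
  shows "(t / \<theta>) powr \<beta> * (exp \<theta> - 1) < exp t - 1"
proof -
  define k where "k x = ln (exp x - 1) - \<beta> * ln x" for x :: real
  have D: "(k has_real_derivative (tp_mean x - \<beta>) / x) (at x)" if "x > 0" for x
  proof -
    have "(k has_real_derivative (exp x / (exp x - 1) - \<beta> * (1 / x))) (at x)"
      unfolding k_def[abs_def] using that by (auto intro!: derivative_eq_intros)
    moreover have "exp x / (exp x - 1) - \<beta> * (1 / x) = (tp_mean x - \<beta>) / x"
      using that by (simp add: tp_mean_def field_simps)
    ultimately show ?thesis by simp
  qed
  have cont: "continuous_on {a..b} k" if "a > 0" for a b
  proof (intro continuous_at_imp_continuous_on ballI)
    fix x assume "x \<in> {a..b}"
    then show "isCont k x" using D[of x] that by (auto intro: DERIV_isCont)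
  qed
  have "k \<theta> < k t"
  proof (cases "t < \<theta>")
    case True
    show ?thesis
    proof (rule DERIV_neg_imp_decreasing_open[OF True _ cont[OF t(1)]])
      fix x assume x: "t < x" "x < \<theta>"
      then have "tp_mean x < \<beta>" using tp_mean_strict_mono[of x \<theta>] \<theta> t by simp
      then show "\<exists>y. (k has_real_derivative y) (at x) \<and> y < 0"
        using D[of x] x t by (intro exI[of _ "(tp_mean x - \<beta>) / x"]) (auto simp: divide_less_0_iff)
    qed
  next
    case False
    then have gt: "\<theta> < t" using t by simp
    show ?thesis
    proof (rule DERIV_pos_imp_increasing_open[OF gt _ cont[OF \<theta>(1)]])
      fix x assume x: "\<theta> < x" "x < t"
      then have "tp_mean x > \<beta>" using tp_mean_strict_mono[of \<theta> x] \<theta> by simp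
      then show "\<exists>y. (k has_real_derivative y) (at x) \<and> 0 < y"
        using D[of x] x \<theta> by (intro exI[of _ "(tp_mean x - \<beta>) / x"]) auto
    qed
  qed
  then have "ln (exp \<theta> - 1) + \<beta> * (ln t - ln \<theta>) < ln (exp t - 1)" by (simp add: k_def algebra_simps)
  then have "exp (ln (exp \<theta> - 1) + \<beta> * (ln t - ln \<theta>)) < exp (ln (exp t - 1))" by simp
  moreover have "exp (ln (exp \<theta> - 1) + \<beta> * (ln t - ln \<theta>)) = (exp \<theta> - 1) * (t / \<theta>) powr \<beta>"
    using \<theta> t by (simp add: exp_add powr_def ln_div)
  ultimately show ?thesis using t by (simp add: mult.commute)
qed

definition exp_poly :: "nat \<Rightarrow> real \<Rightarrow> real" where
  "exp_poly K t = (\<Sum>k=1..K. t ^ k / fact k)"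

lemma exp_poly_tendsto: "(\<lambda>K. exp_poly K t) \<longlonglongrightarrow> exp t - 1"
proof -
  have "(\<lambda>n. \<Sum>k<n. t ^ k / fact k) \<longlonglongrightarrow> exp t"
    using exp_converges[of t] by (simp add: sums_def scaleR_conv_of_real divide_inverse_commute)
  then have "(\<lambda>n. (\<Sum>k<Suc n. t ^ k / fact k) - 1) \<longlonglongrightarrow> exp t - 1"
    by (intro tendsto_diff tendsto_const) (rule LIMSEQ_Suc)
  moreover have "(\<Sum>k<Suc n. t ^ k / fact k) - 1 = exp_poly n t" for n
  proof -
    have "(\<Sum>k<Suc n. t ^ k / fact k) = 1 + (\<Sum>k<n. t ^ Suc k / fact (Suc k))"
      by (subst sum.lessThan_Suc_shift) simp
    also have "(\<Sum>k<n. t ^ Suc k / fact (Suc k)) = exp_poly n t"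
      unfolding exp_poly_def by (rule sum.reindex_bij_witness[of _ "\<lambda>k. k - 1" Suc]) auto
    finally show ?thesis by simp
  qed
  ultimately show ?thesis by simp
qed

lemma exp_poly_nonneg: "t \<ge> 0 \<Longrightarrow> exp_poly K t \<ge> 0"
  by (simp add: exp_poly_def sum_nonneg)

lemma exp_poly_le: assumes "t \<ge> 0" shows "exp_poly K t \<le> exp t - 1"
proof (rule LIMSEQ_le_const[OF exp_poly_tendsto])
  show "\<exists>N. \<forall>n\<ge>N. exp_poly K t \<le> exp_poly n t"
    unfolding exp_poly_def using assms by (intro exI[of _ K] allI impI sum_mono2) auto
qed

definition inv_fact_prod :: "nat list \<Rightarrow> real" where
  "inv_fact_prod ks = prod_list (map (\<lambda>k. 1 / fact k) ks)"

lemma inv_fact_prod_nonneg: "inv_fact_prod ks \<ge> 0"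
  by (induction ks) (auto simp: inv_fact_prod_def)

lemma sum_words_exp_poly: "(\<Sum>ks\<in>words {1..K} b. inv_fact_prod ks * t ^ sum_list ks) = exp_poly K t ^ b"
proof (induction b)
  case 0
  show ?case by (simp add: inv_fact_prod_def)
next
  case (Suc b)
  have "(\<Sum>ks\<in>words {1..K} (Suc b). inv_fact_prod ks * t ^ sum_list ks)
      = (\<Sum>k\<in>{1..K}. \<Sum>ks\<in>words {1..K} b. (t ^ k / fact k) * (inv_fact_prod ks * t ^ sum_list ks))"
    unfolding sum_words_Suc by (intro sum.cong refl) (simp add: inv_fact_prod_def power_add)
  also have "\<dots> = exp_poly K t * exp_poly K t ^ b"
    unfolding sum_distrib_left[symmetric] Suc.IH by (simp add: exp_poly_def sum_distrib_right)
  finally show ?case by simp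
qed

text \<open>The coefficient of \<open>t\<close> to the power \<open>f\<close> in \<open>exp_poly K t ^ b\<close>.\<close>

definition exp_poly_coeff :: "nat \<Rightarrow> nat \<Rightarrow> nat \<Rightarrow> real" where
  "exp_poly_coeff K b f = (\<Sum>ks\<in>{ks \<in> words {1..K} b. sum_list ks = f}. inv_fact_prod ks)"

lemma exp_poly_coeff_nonneg: "exp_poly_coeff K b f \<ge> 0"
  by (simp add: exp_poly_coeff_def sum_nonneg inv_fact_prod_nonneg)

lemma exp_poly_coeff_select:
  assumes "finite R" "R \<noteq> {}" "t > 0"
    and A: "(\<Sum>ks\<in>{ks \<in> words {1..K} b. sum_list ks \<in> R}. inv_fact_prod ks * t ^ sum_list ks) \<ge> A"
  shows "\<exists>f\<in>R. exp_poly_coeff K b f * t ^ f \<ge> A / card R"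
proof (rule ccontr)
  let ?X = "{ks \<in> words {1..K} b. sum_list ks \<in> R}"
  assume "\<not> ?thesis"
  then have lt: "exp_poly_coeff K b f * t ^ f < A / card R" if "f \<in> R" for f using that by force
  have "(\<Sum>ks\<in>?X. inv_fact_prod ks * t ^ sum_list ks) = (\<Sum>f\<in>R. \<Sum>ks\<in>{ks \<in> ?X. sum_list ks = f}. inv_fact_prod ks * t ^ sum_list ks)"
    using assms(1) by (intro sum.group[symmetric]) auto
  also have "\<dots> = (\<Sum>f\<in>R. exp_poly_coeff K b f * t ^ f)"
    unfolding exp_poly_coeff_def sum_distrib_right by (intro sum.cong) auto
  also have "\<dots> < (\<Sum>f\<in>R. A / card R)" using assms lt by (intro sum_strict_mono) auto
  also have "\<dots> = A" using assms by simp
  finally show False using A by simp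
qed

text \<open>Chernoff's bound, by an exponential change of measure from \<open>t\<close> to \<open>t'\<close>.\<close>

lemma tail_sum_le:
  assumes t: "t > 0" "t' > 0"
    and X: "\<And>f. P f \<Longrightarrow> (t / t') ^ f \<le> c ^ b" and c: "c \<ge> 0"
  shows "(\<Sum>ks\<in>{ks \<in> words {1..K} b. P (sum_list ks)}. inv_fact_prod ks * t ^ sum_list ks) \<le> (c * (exp t' - 1)) ^ b"
proof -
  have "(\<Sum>ks\<in>{ks \<in> words {1..K} b. P (sum_list ks)}. inv_fact_prod ks * t ^ sum_list ks)
      \<le> (\<Sum>ks\<in>{ks \<in> words {1..K} b. P (sum_list ks)}. c ^ b * (inv_fact_prod ks * t' ^ sum_list ks))"
  proof (rule sum_mono)
    fix ks assume "ks \<in> {ks \<in> words {1..K} b. P (sum_list ks)}"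
    then have "(t / t') ^ sum_list ks * (inv_fact_prod ks * t' ^ sum_list ks) \<le> c ^ b * (inv_fact_prod ks * t' ^ sum_list ks)"
      using X t by (intro mult_right_mono) (auto intro: mult_nonneg_nonneg inv_fact_prod_nonneg)
    then show "inv_fact_prod ks * t ^ sum_list ks \<le> c ^ b * (inv_fact_prod ks * t' ^ sum_list ks)"
      using t by (simp add: power_divide mult.commute)
  qed
  also have "\<dots> \<le> (\<Sum>ks\<in>words {1..K} b. c ^ b * (inv_fact_prod ks * t' ^ sum_list ks))"
    using t c by (intro sum_mono2) (auto intro!: mult_nonneg_nonneg inv_fact_prod_nonneg)
  also have "\<dots> = c ^ b * exp_poly K t' ^ b"
    unfolding sum_distrib_left[symmetric] sum_words_exp_poly ..
  also have "\<dots> \<le> c ^ b * (exp t' - 1) ^ b"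
    using t c by (intro mult_left_mono power_mono exp_poly_le exp_poly_nonneg) auto
  finally show ?thesis by (simp add: power_mult_distrib)
qed

lemma sum_union_le:
  fixes g :: "'a \<Rightarrow> real"
  assumes "finite A" "finite B" "\<And>x. g x \<ge> 0"
  shows "sum g (A \<union> B) \<le> sum g A + sum g B"
  using sum.union_inter[OF assms(1,2), of g] sum_nonneg[of "A \<inter> B" g] assms(3) by simp

lemma eventually_power_le:
  fixes r e c :: real
  assumes "0 \<le> r" "r < e" "c > 0"
  shows "\<forall>\<^sub>F b in sequentially. r ^ b \<le> c * e ^ b"
proof -
  have "(\<lambda>b. (r / e) ^ b) \<longlonglongrightarrow> 0" using assms by (intro LIMSEQ_realpow_zero) auto
  then have "\<forall>\<^sub>F b in sequentially. (r / e) ^ b < c" using assms(3) by (rule order_tendstoD)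
  then show ?thesis by eventually_elim (use assms in \<open>simp add: power_divide field_simps\<close>)
qed

lemma eventually_linear_power_le:
  fixes r e c :: real
  assumes "0 \<le> r" "r < e" "c \<ge> 0"
  shows "\<forall>\<^sub>F b in sequentially. (c * real b + 1) * r ^ b \<le> e ^ b / 4"
proof -
  have "(\<lambda>b. c * (real b * (r / e) ^ b) + (r / e) ^ b) \<longlonglongrightarrow> c * 0 + 0"
    using assms by (intro tendsto_intros powser_times_n_limit_0 LIMSEQ_realpow_zero) auto
  then have "\<forall>\<^sub>F b in sequentially. c * (real b * (r / e) ^ b) + (r / e) ^ b < 1 / 4"
    by (rule order_tendstoD) simp
  then show ?thesis
  proof eventually_elim
    case (elim b)
    have "(c * real b + 1) * r ^ b = (c * (real b * (r / e) ^ b) + (r / e) ^ b) * e ^ b"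
      using assms by (simp add: power_divide field_simps)
    also have "\<dots> \<le> 1 / 4 * e ^ b" using elim assms by (intro mult_right_mono) auto
    finally show ?case by simp
  qed
qed

text \<open>For \<open>t\<close> slightly smaller than \<open>\<theta>\<close>, the strict minimum at \<open>\<theta>\<close> implies that the terms of \<open>exp_poly K t ^ b\<close> of order
larger than \<open>\<beta> b\<close> are negligible (Chernoff's bound). Among the at most \<open>\<beta> b + 1\<close> other orders, one carries
almost the full exponential rate. The parameter \<open>K\<close> only truncates the exponential series.\<close>

lemma lower_select:
  fixes \<theta> \<beta> \<eta> :: real
  assumes \<theta>: "\<theta> > 0" "tp_mean \<theta> = \<beta>" and \<beta>: "\<beta> \<ge> 0" and \<eta>: "0 < \<eta>" "\<eta> < exp \<theta> - 1"
  shows "\<forall>\<^sub>F K in sequentially. \<forall>\<^sub>F b in sequentially. \<exists>f. real f \<le> \<beta> * b \<and> exp_poly_coeff K b f * \<theta> ^ f \<ge> \<eta> ^ b"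
proof -
  have "((\<lambda>t. exp t - 1) \<longlongrightarrow> exp \<theta> - 1) (at_left \<theta>)" by (intro tendsto_intros)
  then have "\<forall>\<^sub>F t in at_left \<theta>. \<eta> < exp t - 1" using \<eta>(2) by (rule order_tendstoD)
  moreover have "\<forall>\<^sub>F t in at_left \<theta>. 0 < t \<and> t < \<theta>"
    using \<theta>(1) by (intro eventually_at_leftI[of 0]) auto
  ultimately have "\<forall>\<^sub>F t in at_left \<theta>. \<eta> < exp t - 1 \<and> 0 < t \<and> t < \<theta>" by eventually_elim auto
  then obtain t where t: "\<eta> < exp t - 1" "0 < t" "t < \<theta>"
    using eventually_happens trivial_limit_at_left_real by blast
  define r where "r = (t / \<theta>) powr \<beta> * (exp \<theta> - 1)"
  have r: "0 \<le> r" "r < exp t - 1" using tilted_exp_minimum[OF \<theta>, of t] t \<theta> by (auto simp: r_def)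
  have "\<forall>\<^sub>F K in sequentially. exp_poly K t > max \<eta> r"
    by (rule order_tendstoD[OF exp_poly_tendsto]) (use t r in auto)
  then show ?thesis
  proof eventually_elim
    case (elim K)
    define e where "e = exp_poly K t"
    have e: "\<eta> < e" "r < e" using elim by (auto simp: e_def)
    have "\<forall>\<^sub>F b in sequentially. r ^ b \<le> 1 / 2 * e ^ b" using r e by (intro eventually_power_le) auto
    moreover have "\<forall>\<^sub>F b in sequentially. (\<beta> * real b + 1) * \<eta> ^ b \<le> e ^ b / 4"
      using \<eta> e \<beta> by (intro eventually_linear_power_le) auto
    ultimately show ?case
    proof eventually_elim
      case (elim b)
      define R where "R = {f. real f \<le> \<beta> * b}"
      have R: "R = {..nat \<lfloor>\<beta> * b\<rfloor>}" using \<beta> by (auto simp: R_def le_nat_floor le_floor_iff) (simp add: le_nat_iff le_floor_iff)+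
      have cR: "real (card R) \<le> \<beta> * b + 1" "card R > 0" unfolding R using \<beta> by (auto simp: of_nat_nat)
      let ?m = "\<lambda>ks. inv_fact_prod ks * t ^ sum_list ks"
      have "(\<Sum>ks\<in>{ks \<in> words {1..K} b. sum_list ks \<notin> R}. ?m ks) \<le> r ^ b"
        unfolding r_def
      proof (rule tail_sum_le[OF t(2) \<theta>(1)])
        fix f assume "f \<notin> R"
        then have "(t / \<theta>) powr real f \<le> (t / \<theta>) powr (\<beta> * b)"
          using t by (intro powr_mono') (auto simp: R_def)
        then show "(t / \<theta>) ^ f \<le> ((t / \<theta>) powr \<beta>) ^ b"
          using t by (simp add: powr_realpow powr_powr flip: powr_realpow)
      qed simp
      moreover have "(\<Sum>ks\<in>{ks \<in> words {1..K} b. sum_list ks \<in> R}. ?m ks) + (\<Sum>ks\<in>{ks \<in> words {1..K} b. sum_list ks \<notin> R}. ?m ks) = e ^ b"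
        unfolding e_def sum_words_exp_poly[symmetric] by (subst sum.union_disjoint[symmetric]) (auto intro!: sum.cong)
      ultimately have "(\<Sum>ks\<in>{ks \<in> words {1..K} b. sum_list ks \<in> R}. ?m ks) \<ge> e ^ b / 2" using elim(1) by simp
      then obtain f where f: "f \<in> R" "exp_poly_coeff K b f * t ^ f \<ge> e ^ b / 2 / card R"
        using exp_poly_coeff_select[of R t "e ^ b / 2" K b] cR t by (auto simp: card_gt_0_iff)
      have "\<eta> ^ b \<le> e ^ b / 2 / card R"
      proof -
        have "card R * \<eta> ^ b \<le> (\<beta> * b + 1) * \<eta> ^ b" using cR \<eta> by (intro mult_right_mono) auto
        also have "\<dots> \<le> e ^ b / 4" by (rule elim(2))
        also have "\<dots> \<le> e ^ b / 2" using e \<eta> by simp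
        finally show ?thesis using cR by (simp add: field_simps)
      qed
      also have "\<dots> \<le> exp_poly_coeff K b f * t ^ f" by (rule f(2))
      also have "\<dots> \<le> exp_poly_coeff K b f * \<theta> ^ f" using t by (intro mult_left_mono power_mono exp_poly_coeff_nonneg) auto
      finally show ?case using f(1) by (auto simp: R_def)
    qed
  qed
qed

text \<open>As before, with \<open>t\<close> slightly larger than \<open>\<theta>\<close>. Here orders larger than \<open>L b\<close> are discarded as well, by comparison
with \<open>2 \<theta>\<close>, so that the factor \<open>(\<theta> / t) ^ f\<close>, lost on returning from \<open>t\<close> to \<open>\<theta>\<close>, is bounded below by the \<open>b\<close>-th
power of a number close to \<open>1\<close>.\<close>

lemma upper_select:
  fixes \<theta> \<beta> \<eta> :: real
  assumes \<theta>: "\<theta> > 0" "tp_mean \<theta> = \<beta>" and \<beta>: "\<beta> \<ge> 0" and \<eta>: "0 < \<eta>" "\<eta> < exp \<theta> - 1"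
  shows "\<forall>\<^sub>F K in sequentially. \<forall>\<^sub>F b in sequentially. \<exists>f. \<beta> * b \<le> real f \<and> exp_poly_coeff K b f * \<theta> ^ f \<ge> \<eta> ^ b"
proof -
  define A where "A = exp \<theta> - 1"
  have A: "0 < A" "\<eta> < A" using \<theta> \<eta> by (auto simp: A_def)
  have "(\<lambda>L. (3 / 4 :: real) ^ L * (exp (2 * \<theta>) - 1)) \<longlonglongrightarrow> 0 * (exp (2 * \<theta>) - 1)"
    by (intro tendsto_intros LIMSEQ_realpow_zero) auto
  then have "\<forall>\<^sub>F L in sequentially. (3 / 4 :: real) ^ L * (exp (2 * \<theta>) - 1) < A"
    using A by (intro order_tendstoD) auto
  then obtain L where L: "(3 / 4 :: real) ^ L * (exp (2 * \<theta>) - 1) < A"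
    using eventually_happens by fastforce
  have "((\<lambda>t. (\<theta> / t) ^ L * A) \<longlongrightarrow> (\<theta> / \<theta>) ^ L * A) (at_right \<theta>)" using \<theta> by (intro tendsto_intros) auto
  then have "\<forall>\<^sub>F t in at_right \<theta>. \<eta> < (\<theta> / t) ^ L * A" using A \<theta> by (intro order_tendstoD) auto
  moreover have "\<forall>\<^sub>F t in at_right \<theta>. \<theta> < t \<and> t < 3 / 2 * \<theta>"
    using \<theta>(1) by (intro eventually_at_rightI[of \<theta> "3 / 2 * \<theta>"]) auto
  ultimately have "\<forall>\<^sub>F t in at_right \<theta>. \<eta> < (\<theta> / t) ^ L * A \<and> \<theta> < t \<and> t < 3 / 2 * \<theta>" by eventually_elim auto
  then obtain t where t: "\<eta> < (\<theta> / t) ^ L * A" "\<theta> < t" "t < 3 / 2 * \<theta>"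
    using eventually_happens trivial_limit_at_right_real by blast
  have t0: "t > 0" using t \<theta> by simp
  define r where "r = (t / \<theta>) powr \<beta> * (exp \<theta> - 1)"
  have r: "0 \<le> r" "r < exp t - 1" using tilted_exp_minimum[OF \<theta>, of t] t \<theta> by (auto simp: r_def)
  define r' where "r' = (t / (2 * \<theta>)) ^ L * (exp (2 * \<theta>) - 1)"
  have At: "A < exp t - 1" using t by (simp add: A_def)
  have "(t / (2 * \<theta>)) ^ L \<le> (3 / 4) ^ L" using t \<theta> t0 by (intro power_mono) (auto simp: field_simps)
  then have "r' \<le> (3 / 4) ^ L * (exp (2 * \<theta>) - 1)" unfolding r'_def using \<theta> by (intro mult_right_mono) auto
  then have r': "0 \<le> r'" "r' < exp t - 1" 
    using L At \<theta> t0 by (simp add: r'_def) (use L At \<open>r' \<le> (3 / 4) ^ L * (exp (2 * \<theta>) - 1)\<close> in linarith)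
  have "\<forall>\<^sub>F K in sequentially. exp_poly K t > max A (max r r')"
    by (rule order_tendstoD[OF exp_poly_tendsto]) (use At r r' in auto)
  then show ?thesis
  proof eventually_elim
    case (elim K)
    define e where "e = exp_poly K t"
    have e: "A < e" "r < e" "r' < e" using elim by (auto simp: e_def)
    define e2 where "e2 = (\<theta> / t) ^ L * e"
    have e2: "\<eta> < e2"
    proof -
      have "(\<theta> / t) ^ L * A \<le> e2" unfolding e2_def using e \<theta> t0 by (intro mult_left_mono) auto
      then show ?thesis using t(1) by simp
    qed
    have "\<forall>\<^sub>F b in sequentially. r ^ b \<le> 1 / 4 * e ^ b" using r e by (intro eventually_power_le) auto
    moreover have "\<forall>\<^sub>F b in sequentially. r' ^ b \<le> 1 / 4 * e ^ b" using r' e by (intro eventually_power_le) auto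
    moreover have "\<forall>\<^sub>F b in sequentially. (real L * real b + 1) * \<eta> ^ b \<le> e2 ^ b / 4"
      using \<eta> e2 by (intro eventually_linear_power_le) auto
    ultimately show ?case
    proof eventually_elim
      case (elim b)
      define R where "R = {f. \<beta> * b \<le> real f \<and> f \<le> L * b}"
      have R: "R \<subseteq> {..L * b}" by (auto simp: R_def)
      then have finR: "finite R" using finite_subset by blast
      have cR: "real (card R) \<le> real L * b + 1" 
      proof -
        have "card R \<le> L * b + 1" using card_mono[OF _ R] by simp
        then have "real (card R) \<le> real (L * b + 1)" by (simp only: of_nat_le_iff)
        then show ?thesis by simp
      qed
      let ?m = "\<lambda>ks. inv_fact_prod ks * t ^ sum_list ks"
      have low: "(\<Sum>ks\<in>{ks \<in> words {1..K} b. real (sum_list ks) < \<beta> * b}. ?m ks) \<le> r ^ b"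
        unfolding r_def
      proof (rule tail_sum_le[OF t0 \<theta>(1)])
        fix f assume "real f < \<beta> * b"
        then have "(t / \<theta>) powr real f \<le> (t / \<theta>) powr (\<beta> * b)"
          using t \<theta> by (intro powr_mono) auto
        then show "(t / \<theta>) ^ f \<le> ((t / \<theta>) powr \<beta>) ^ b"
          using t0 \<theta> by (simp add: powr_realpow powr_powr flip: powr_realpow)
      qed simp
      have high: "(\<Sum>ks\<in>{ks \<in> words {1..K} b. sum_list ks > L * b}. ?m ks) \<le> r' ^ b"
        unfolding r'_def
      proof (rule tail_sum_le[OF t0])
        fix f assume "f > L * b"
        then have "(t / (2 * \<theta>)) ^ f \<le> (t / (2 * \<theta>)) ^ (L * b)"
          using t0 t \<theta> by (intro power_decreasing) (auto simp: field_simps)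
        then show "(t / (2 * \<theta>)) ^ f \<le> ((t / (2 * \<theta>)) ^ L) ^ b" by (simp add: power_mult)
      qed (use \<theta> t0 in auto)
      have "e ^ b = (\<Sum>ks\<in>words {1..K} b. ?m ks)" unfolding e_def sum_words_exp_poly ..
      also have "\<dots> \<le> (\<Sum>ks\<in>({ks \<in> words {1..K} b. sum_list ks \<in> R} \<union> {ks \<in> words {1..K} b. real (sum_list ks) < \<beta> * b}) \<union> {ks \<in> words {1..K} b. sum_list ks > L * b}. ?m ks)"
        using t0 by (intro sum_mono2) (auto simp: R_def intro!: mult_nonneg_nonneg inv_fact_prod_nonneg)
      also have "\<dots> \<le> ((\<Sum>ks\<in>{ks \<in> words {1..K} b. sum_list ks \<in> R}. ?m ks) + (\<Sum>ks\<in>{ks \<in> words {1..K} b. real (sum_list ks) < \<beta> * b}. ?m ks))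
          + (\<Sum>ks\<in>{ks \<in> words {1..K} b. sum_list ks > L * b}. ?m ks)"
        using t0 by (intro order_trans[OF sum_union_le] add_mono order_refl sum_union_le) (auto intro!: mult_nonneg_nonneg inv_fact_prod_nonneg)
      finally have half: "(\<Sum>ks\<in>{ks \<in> words {1..K} b. sum_list ks \<in> R}. ?m ks) \<ge> e ^ b / 2"
        using elim low high by simp
      have e0: "e > 0" using e A by simp
      have "R \<noteq> {}" using half zero_less_power[OF e0, of b] by auto
      then obtain f where f: "f \<in> R" "exp_poly_coeff K b f * t ^ f \<ge> e ^ b / 2 / card R"
        using exp_poly_coeff_select[of R t "e ^ b / 2" K b] finR half t0 by auto
      have cR0: "card R > 0" using \<open>R \<noteq> {}\<close> finR by (simp add: card_gt_0_iff)
      have "\<eta> ^ b \<le> (\<theta> / t) ^ (L * b) * (e ^ b / 2 / card R)"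
      proof -
        have "card R * \<eta> ^ b \<le> (real L * b + 1) * \<eta> ^ b" using cR \<eta> by (intro mult_right_mono) auto
        also have "\<dots> \<le> e2 ^ b / 4" by (rule elim(3))
        also have "\<dots> \<le> e2 ^ b / 2" using e2 \<eta> by simp
        finally have "card R * \<eta> ^ b \<le> e2 ^ b / 2" .
        then have "\<eta> ^ b \<le> e2 ^ b / 2 / card R" using cR0 by (simp add: pos_le_divide_eq mult_ac)
        moreover have "e2 ^ b = (\<theta> / t) ^ (L * b) * e ^ b" by (simp add: e2_def power_mult_distrib power_mult)
        ultimately show ?thesis by simp
      qed
      also have "\<dots> \<le> (\<theta> / t) ^ f * (exp_poly_coeff K b f * t ^ f)"
      proof (rule mult_mono)
        show "(\<theta> / t) ^ (L * b) \<le> (\<theta> / t) ^ f"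
          using f(1) t \<theta> t0 by (intro power_decreasing) (auto simp: R_def)
      qed (use f(2) e0 \<theta> t0 in auto)
      also have "\<dots> = exp_poly_coeff K b f * \<theta> ^ f" using t0 by (simp add: power_divide)
      finally show ?case using f(1) by (auto simp: R_def)
    qed
  qed
qed

section \<open>Counting blocks\<close>

lemma sum_steps:
  "(\<Sum>v\<in>steps n K. h (mass n v)) = (\<Sum>k\<in>{1..K}. real (n choose k) * h k)"
proof -
  let ?X = "{D. D \<subseteq> {..<n} \<and> D \<noteq> {} \<and> card D \<le> K}"
  have fin: "finite ?X" by (rule finite_small_subsets) simp
  have finD: "finite D" if "D \<in> ?X" for D using that finite_subset[of D "{..<n}"] by auto
  have "inj indicator_vec" by (rule injI) (metis indicator_vec_def set_eqI zero_neq_one)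
  then have "(\<Sum>v\<in>steps n K. h (mass n v)) = (\<Sum>D\<in>?X. h (mass n (indicator_vec D)))"
    unfolding steps_def by (subst sum.reindex) (auto intro: inj_on_subset)
  also have "\<dots> = (\<Sum>D\<in>?X. h (card D))" by (intro sum.cong) (auto simp: mass_indicator_vec)
  also have "\<dots> = (\<Sum>k\<in>{1..K}. \<Sum>D\<in>{D \<in> ?X. card D = k}. h (card D))"
  proof (rule sum.group[symmetric, OF fin finite_atLeastAtMost])
    show "card ` ?X \<subseteq> {1..K}"
    proof (rule image_subsetI)
      fix D assume D: "D \<in> ?X"
      then have "card D > 0" using finD[OF D] by (simp add: card_gt_0_iff)
      then show "card D \<in> {1..K}" using D by simp
    qed
  qed
  also have "\<dots> = (\<Sum>k\<in>{1..K}. real (n choose k) * h k)"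
  proof (intro sum.cong refl)
    fix k assume k: "k \<in> {1..K}"
    then have "{D \<in> ?X. card D = k} = {D. D \<subseteq> {..<n} \<and> card D = k}" by auto
    then show "(\<Sum>D\<in>{D \<in> ?X. card D = k}. h (card D)) = real (n choose k) * h k"
      using n_subsets[of "{..<n}" k] by simp
  qed
  finally show ?thesis .
qed

lemma sum_words_steps:
  "(\<Sum>ws\<in>words (steps n K) b. h (mass n (sum_list ws)))
    = (\<Sum>ks\<in>words {1..K} b. prod_list (map (\<lambda>k. real (n choose k)) ks) * h (sum_list ks))"
proof (induction b arbitrary: h)
  case 0
  show ?case unfolding words_0 by simp
next
  case (Suc b)
  have "(\<Sum>ws\<in>words (steps n K) (Suc b). h (mass n (sum_list ws)))
      = (\<Sum>v\<in>steps n K. \<Sum>ks\<in>words {1..K} b. prod_list (map (\<lambda>k. real (n choose k)) ks) * h (mass n v + sum_list ks))"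
    unfolding sum_words_Suc using Suc.IH[of "\<lambda>m. h (_ + m)"] by simp
  also have "\<dots> = (\<Sum>k\<in>{1..K}. real (n choose k) * (\<Sum>ks\<in>words {1..K} b. prod_list (map (\<lambda>k. real (n choose k)) ks) * h (k + sum_list ks)))"
    by (rule sum_steps)
  finally show ?case by (simp add: sum_words_Suc sum_distrib_left mult.assoc)
qed

lemma power_le_binomial:
  assumes "k \<le> K" "K \<le> n" shows "real (n - K) ^ k * (1 / fact k) \<le> real (n choose k)"
proof -
  have "real (n - K) ^ k = (\<Prod>i = 0..<k. real (n - K))" by simp
  also have "\<dots> \<le> (\<Prod>i = 0..<k. real n - real i)"
    using assms by (intro prod_mono) (auto simp: of_nat_diff)
  also have "\<dots> = fact k * real (n choose k)"
    by (simp add: binomial_gbinomial gbinomial_prod_rev)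
  finally show ?thesis by (simp add: field_simps)
qed

lemma card_block_ge:
  assumes "K \<le> n" shows "exp_poly_coeff K b f * real (n - K) ^ f \<le> real (card (block n K b f))"
proof -
  have "real (card (block n K b f)) = (\<Sum>ws\<in>words (steps n K) b. if mass n (sum_list ws) = f then 1 else 0)"
    unfolding block_def by (simp add: sum.If_cases Int_def)
  also have "\<dots> = (\<Sum>ks\<in>words {1..K} b. prod_list (map (\<lambda>k. real (n choose k)) ks) * (if sum_list ks = f then 1 else 0))"
    by (rule sum_words_steps)
  also have "\<dots> = (\<Sum>ks\<in>{ks \<in> words {1..K} b. sum_list ks = f}. prod_list (map (\<lambda>k. real (n choose k)) ks))"
    by (rule sum.mono_neutral_cong_right) auto
  also have "\<dots> \<ge> (\<Sum>ks\<in>{ks \<in> words {1..K} b. sum_list ks = f}. inv_fact_prod ks * real (n - K) ^ sum_list ks)"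
  proof (rule sum_mono)
    fix ks assume "ks \<in> {ks \<in> words {1..K} b. sum_list ks = f}"
    then have "set ks \<subseteq> {1..K}" by (auto simp: words_def)
    then show "inv_fact_prod ks * real (n - K) ^ sum_list ks \<le> prod_list (map (\<lambda>k. real (n choose k)) ks)"
    proof (induction ks)
      case (Cons k ks)
      have "(real (n - K) ^ k * (1 / fact k)) * (inv_fact_prod ks * real (n - K) ^ sum_list ks)
          \<le> real (n choose k) * prod_list (map (\<lambda>k. real (n choose k)) ks)"
      proof (rule mult_mono)
        show "0 \<le> inv_fact_prod ks * real (n - K) ^ sum_list ks" by (rule mult_nonneg_nonneg[OF inv_fact_prod_nonneg]) simp
        show "real (n - K) ^ k * (1 / fact k) \<le> real (n choose k)"
          using Cons.prems assms by (intro power_le_binomial) auto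
        show "inv_fact_prod ks * real (n - K) ^ sum_list ks \<le> prod_list (map (\<lambda>k. real (n choose k)) ks)"
          using Cons by simp
      qed simp
      then show ?case by (simp add: inv_fact_prod_def power_add mult_ac)
    qed (simp add: inv_fact_prod_def)
  qed
  also have "(\<Sum>ks\<in>{ks \<in> words {1..K} b. sum_list ks = f}. inv_fact_prod ks * real (n - K) ^ sum_list ks) = exp_poly_coeff K b f * real (n - K) ^ f"
    unfolding exp_poly_coeff_def sum_distrib_right by (intro sum.cong) auto
  finally show ?thesis by simp
qed

text \<open>Taking the smaller value when the partial sum is above the line and the larger one otherwise keeps the error
bounded. An irrational slope \<open>m\<close> is the reason for using two values.\<close>

lemma balanced_sequence:
  fixes m :: real
  assumes "real f1 \<le> m" "m \<le> real f2"
  obtains \<phi> :: "nat \<Rightarrow> nat" where "\<And>j. \<phi> j \<in> {f1, f2}" "\<And>i. \<bar>real (\<Sum>j<i. \<phi> j) - m * i\<bar> \<le> real f2"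
proof -
  define F where "F = rec_nat 0 (\<lambda>j s. s + (if real s \<ge> m * j then f1 else f2))"
  define \<phi> where "\<phi> j = (if real (F j) \<ge> m * j then f1 else f2)" for j
  have F: "F 0 = 0" "F (Suc j) = F j + \<phi> j" for j by (simp_all add: F_def \<phi>_def)
  have S: "(\<Sum>j<i. \<phi> j) = F i" for i by (induction i) (simp_all add: F)
  have "m \<ge> 0" using assms(1) of_nat_0_le_iff[of f1] by linarith
  have "- real f2 \<le> real (F i) - m * i \<and> real (F i) - m * i \<le> real f2" for i
  proof (induction i)
    case (Suc i)
    have "m * real (Suc i) = m * real i + m" by (simp add: algebra_simps)
    then show ?case using Suc assms \<open>m \<ge> 0\<close> of_nat_0_le_iff[of f1, where 'a = real]
      by (cases "real (F i) \<ge> m * i") (simp_all add: F \<phi>_def)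
  qed (simp add: F)
  then have "\<bar>real (\<Sum>j<i. \<phi> j) - m * i\<bar> \<le> real f2" for i unfolding S by (simp add: abs_le_iff algebra_simps)
  moreover have "\<phi> j \<in> {f1, f2}" for j by (simp add: \<phi>_def)
  ultimately show ?thesis using that by blast
qed

text \<open>Blocks of two sizes around \<open>\<beta> b\<close> whose number grows at least at the rate \<open>1 / C\<close> per drop, up to a factor \<open>1 - \<delta>\<close>
and up to a power of \<open>\<theta>\<close> that cancels along balanced sequences.\<close>

definition entropy_blocks :: "real \<Rightarrow> real \<Rightarrow> bool" where
  "entropy_blocks \<beta> C \<longleftrightarrow> (\<forall>\<delta>. 0 < \<delta> \<and> \<delta> < 1 \<longrightarrow> (\<exists>K b f1 f2 \<theta>. K \<ge> 1 \<and> b \<ge> 1 \<and> \<theta> > 0 \<and>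
     real f1 \<le> \<beta> * real b \<and> \<beta> * real b \<le> real f2 \<and>
     (\<forall>f\<in>{f1, f2}. ((1 - \<delta>) / C) ^ b \<le> exp_poly_coeff K b f * \<theta> powr (real f - \<beta> * real b))))"

lemma entropy_blocks_one: "entropy_blocks 1 1"
  unfolding entropy_blocks_def
proof (intro allI impI)
  fix \<delta> :: real assume d: "0 < \<delta> \<and> \<delta> < 1"
  have "{ks \<in> words {1..1} 1. sum_list ks = (1 :: nat)} = {[1]}" by (auto simp: words_def length_Suc_conv)
  then have a: "exp_poly_coeff 1 1 1 = 1" by (simp add: exp_poly_coeff_def inv_fact_prod_def)
  show "\<exists>K b f1 f2 \<theta>. K \<ge> 1 \<and> b \<ge> 1 \<and> \<theta> > 0 \<and>
     real f1 \<le> 1 * real b \<and> 1 * real b \<le> real f2 \<and>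
     (\<forall>f\<in>{f1, f2}. ((1 - \<delta>) / 1) ^ b \<le> exp_poly_coeff K b f * \<theta> powr (real f - 1 * real b))"
    using d a by (intro exI[of _ "1 :: nat"] exI[of _ "1 :: real"]) simp
qed

lemma entropy_blocks_tp_mean:
  assumes \<theta>: "\<theta> > 0" "tp_mean \<theta> = \<beta>" and \<beta>: "\<beta> > 1"
  shows "entropy_blocks \<beta> (\<theta> powr \<beta> / (exp \<theta> - 1))"
  unfolding entropy_blocks_def
proof (intro allI impI)
  fix \<delta> :: real assume d: "0 < \<delta> \<and> \<delta> < 1"
  define \<eta> where "\<eta> = (1 - \<delta>) * (exp \<theta> - 1)"
  have e: "exp \<theta> - 1 > 0" using \<theta> by simp
  have \<eta>: "0 < \<eta>" "\<eta> < exp \<theta> - 1" using d e by (auto simp: \<eta>_def)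
  have b0: "\<beta> \<ge> 0" using \<beta> by simp
  have "\<forall>\<^sub>F K in sequentially. K \<ge> 1 \<and> (\<forall>\<^sub>F b in sequentially. b \<ge> 1 \<and>
     (\<exists>f. real f \<le> \<beta> * b \<and> exp_poly_coeff K b f * \<theta> ^ f \<ge> \<eta> ^ b) \<and> (\<exists>f. \<beta> * b \<le> real f \<and> exp_poly_coeff K b f * \<theta> ^ f \<ge> \<eta> ^ b))"
    using lower_select[OF \<theta> b0 \<eta>] upper_select[OF \<theta> b0 \<eta>] eventually_ge_at_top[of "1 :: nat"]
    by eventually_elim (auto intro!: eventually_conj eventually_ge_at_top)
  then obtain K where K: "K \<ge> 1" and "\<forall>\<^sub>F b in sequentially. b \<ge> 1 \<and>
     (\<exists>f. real f \<le> \<beta> * b \<and> exp_poly_coeff K b f * \<theta> ^ f \<ge> \<eta> ^ b) \<and> (\<exists>f. \<beta> * b \<le> real f \<and> exp_poly_coeff K b f * \<theta> ^ f \<ge> \<eta> ^ b)"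
    using eventually_happens by fastforce
  then obtain b f1 f2 where b: "b \<ge> 1" and f: "real f1 \<le> \<beta> * real b" "\<beta> * real b \<le> real f2"
    and a: "exp_poly_coeff K b f1 * \<theta> ^ f1 \<ge> \<eta> ^ b" "exp_poly_coeff K b f2 * \<theta> ^ f2 \<ge> \<eta> ^ b"
    using eventually_happens[of _ "sequentially"] by fastforce
  have "((1 - \<delta>) / (\<theta> powr \<beta> / (exp \<theta> - 1))) ^ b \<le> exp_poly_coeff K b f * \<theta> powr (real f - \<beta> * real b)"
    if "exp_poly_coeff K b f * \<theta> ^ f \<ge> \<eta> ^ b" for f
  proof -
    have "((1 - \<delta>) / (\<theta> powr \<beta> / (exp \<theta> - 1))) ^ b = \<eta> ^ b / \<theta> powr (\<beta> * real b)"
      using \<theta> by (simp add: \<eta>_def power_divide power_mult_distrib powr_powr flip: powr_realpow)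
    also have "\<dots> \<le> exp_poly_coeff K b f * \<theta> ^ f / \<theta> powr (\<beta> * real b)" using that by (intro divide_right_mono) auto
    also have "\<dots> = exp_poly_coeff K b f * \<theta> powr (real f - \<beta> * real b)"
      using \<theta> by (simp add: powr_diff powr_realpow)
    finally show ?thesis .
  qed
  then show "\<exists>K b f1 f2 \<theta>'. K \<ge> 1 \<and> b \<ge> 1 \<and> \<theta>' > 0 \<and>
     real f1 \<le> \<beta> * real b \<and> \<beta> * real b \<le> real f2 \<and>
     (\<forall>f\<in>{f1, f2}. ((1 - \<delta>) / (\<theta> powr \<beta> / (exp \<theta> - 1))) ^ b \<le> exp_poly_coeff K b f * \<theta>' powr (real f - \<beta> * real b))"
    using K b f a \<theta>(1) by (intro exI[of _ K] exI[of _ b] exI[of _ f1] exI[of _ f2] exI[of _ \<theta>]) simp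
qed

text \<open>Along a balanced sequence the deviations \<open>f - \<beta> b\<close> add up to a bounded number, so a whole stretch loses only a
bounded power of \<open>n / \<theta>\<close>.\<close>

lemma card_stretch_ge:
  fixes \<beta> \<theta> C \<delta> :: real
  assumes K: "K \<le> n" and \<theta>: "\<theta> > 0" and m: "real (n - K) \<ge> \<theta>" and C: "C > 0" "0 < \<delta>" "\<delta> < 1"
    and \<phi>: "\<And>j. \<phi> j \<in> {f1, f2}" "\<bar>real (\<Sum>j<i. \<phi> j) - (\<beta> * real b) * i\<bar> \<le> real f2"
    and a: "\<forall>f\<in>{f1, f2}. ((1 - \<delta>) / C) ^ b \<le> exp_poly_coeff K b f * \<theta> powr (real f - \<beta> * real b)"
  shows "((1 - \<delta>) / C * real (n - K) powr \<beta>) ^ (b * i) \<le> (real (n - K) / \<theta>) ^ f2 * real (card (stretch n K b \<phi> i))"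
proof -
  define m where "m = real (n - K)"
  have m0: "m > 0" "m / \<theta> \<ge> 1" using m \<theta> by (auto simp: m_def)
  have blk: "((1 - \<delta>) / C * m powr \<beta>) ^ b * (m / \<theta>) powr (real (\<phi> j) - \<beta> * real b) \<le> real (card (block n K b (\<phi> j)))" for j
  proof -
    have "((1 - \<delta>) / C * m powr \<beta>) ^ b * (m / \<theta>) powr (real (\<phi> j) - \<beta> * real b)
        = ((1 - \<delta>) / C) ^ b * (m powr (\<beta> * real b) * (m / \<theta>) powr (real (\<phi> j) - \<beta> * real b))"
      using m0 by (simp only: power_mult_distrib mult.assoc) (simp add: powr_powr flip: powr_realpow)
    also have "\<dots> \<le> (exp_poly_coeff K b (\<phi> j) * \<theta> powr (real (\<phi> j) - \<beta> * real b)) * (m powr (\<beta> * real b) * (m / \<theta>) powr (real (\<phi> j) - \<beta> * real b))"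
      using a \<phi>(1)[of j] by (intro mult_right_mono) auto
    also have "\<dots> = exp_poly_coeff K b (\<phi> j) * m ^ \<phi> j"
      using m0 \<theta> by (simp add: powr_divide powr_diff powr_realpow)
    also have "\<dots> \<le> real (card (block n K b (\<phi> j)))"
      unfolding m_def by (rule card_block_ge[OF K])
    finally show ?thesis .
  qed
  have "((1 - \<delta>) / C * m powr \<beta>) ^ (b * i) * (m / \<theta>) powr (real (\<Sum>j<i. \<phi> j) - (\<beta> * real b) * i)
      = (\<Prod>j<i. ((1 - \<delta>) / C * m powr \<beta>) ^ b * (m / \<theta>) powr (real (\<phi> j) - \<beta> * real b))"
  proof -
    have "(\<Prod>j<i. (m / \<theta>) powr (real (\<phi> j) - \<beta> * real b)) = (m / \<theta>) powr (\<Sum>j<i. real (\<phi> j) - \<beta> * real b)"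
      using m0 \<theta> by (subst powr_sum) auto
    also have "(\<Sum>j<i. real (\<phi> j) - \<beta> * real b) = real (\<Sum>j<i. \<phi> j) - (\<beta> * real b) * i"
      by (simp add: sum_subtractf)
    finally show ?thesis by (simp add: prod.distrib power_mult)
  qed
  also have "\<dots> \<le> (\<Prod>j<i. real (card (block n K b (\<phi> j))))"
    using C by (intro prod_mono conjI blk mult_nonneg_nonneg zero_le_power) auto
  also have "\<dots> = real (card (stretch n K b \<phi> i))" by (simp add: card_stretch)
  finally have 1: "((1 - \<delta>) / C * m powr \<beta>) ^ (b * i) * (m / \<theta>) powr (real (\<Sum>j<i. \<phi> j) - (\<beta> * real b) * i)
      \<le> real (card (stretch n K b \<phi> i))" .
  have 2: "(m / \<theta>) powr (- real f2) \<le> (m / \<theta>) powr (real (\<Sum>j<i. \<phi> j) - (\<beta> * real b) * i)"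
    using m0 \<phi>(2) by (intro powr_mono) auto
  have "((1 - \<delta>) / C * m powr \<beta>) ^ (b * i) * (m / \<theta>) powr (- real f2)
      \<le> ((1 - \<delta>) / C * m powr \<beta>) ^ (b * i) * (m / \<theta>) powr (real (\<Sum>j<i. \<phi> j) - (\<beta> * real b) * i)"
    using C m0 by (intro mult_left_mono 2 zero_le_power) auto
  then have "((1 - \<delta>) / C * m powr \<beta>) ^ (b * i) * (m / \<theta>) powr (- real f2) \<le> real (card (stretch n K b \<phi> i))"
    using 1 by linarith
  moreover have "(m / \<theta>) powr (- real f2) = 1 / (m / \<theta>) ^ f2"
    using m0 \<theta> by (simp add: powr_minus powr_realpow divide_inverse)
  moreover have "(m / \<theta>) ^ f2 > 0" using m0 \<theta> by simp
  ultimately show ?thesis unfolding m_def[symmetric] by (simp add: divide_le_eq mult.commute)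
qed

section \<open>High dimension\<close>

text \<open>The quantity \<open>lam\<close> bounds the ratio, per drop, of the number of pinned paths (weighted with \<open>1 / q\<close> per overlap) to the
number of all paths. It is smaller than \<open>1\<close> because \<open>q\<close> exceeds \<open>C d powr - \<beta>\<close> by the factor \<open>1 + \<epsilon>\<close>; the errors
from the finite block length, from the coordinates set aside and from the detours of pinned paths are each
absorbed by a factor \<open>1 + \<delta>\<close> or \<open>1 - \<delta>\<close>.\<close>

lemma no_surface_at_density:
  fixes \<alpha> \<beta> C \<epsilon> \<delta> \<theta> q \<kappa> lam \<Gamma> :: real and \<phi> :: "nat \<Rightarrow> nat"
  assumes \<alpha>: "0 \<le> \<alpha>" "\<alpha> < 1" "\<beta> = 1 / (1 - \<alpha>)" and C: "C > 0" and \<epsilon>: "\<epsilon> > 0" and \<delta>: "0 < \<delta>" "\<delta> < 1"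
    and pos: "K \<ge> 1" "b \<ge> 1" "I \<ge> 1" "s \<ge> 2" and \<theta>: "\<theta> > 0"
    and a: "\<forall>f\<in>{f1, f2}. ((1 - \<delta>) / C) ^ b \<le> exp_poly_coeff K b f * \<theta> powr (real f - \<beta> * real b)"
    and \<phi>: "\<And>j. \<phi> j \<in> {f1, f2}" "\<And>i. \<bar>real (\<Sum>j<i. \<phi> j) - (\<beta> * real b) * i\<bar> \<le> real f2"
    and lam: "lam = (1 + \<delta>)\<^sup>2 / ((1 + \<epsilon>) * (1 - \<delta>))" "lam \<le> 1"
    and q: "q = (1 + \<epsilon>) * C * real d powr (- \<beta>)" "q \<le> 1"
    and n: "n + G * s = d" "K \<le> n" and \<kappa>: "\<kappa> = (1 + \<delta>) powr (- 1 / \<beta>)" "\<kappa> * d \<le> real (n - K)" "\<theta> \<le> \<kappa> * d" "d \<ge> 1"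
    and Y: "q * real ((K * (b * I)) ^ K) \<le> \<delta>"
    and G: "G \<ge> 4" "z = f2 + G + 1"
    and \<Gamma>: "\<Gamma> = real b * (real d / \<theta>) ^ f2 * (real d ^ K) ^ b" "2 * (2 + real I * \<Gamma>) \<le> real s ^ (G - 4)"
    and z: "(1 / q) ^ z * lam ^ (b * I) * (real d / \<theta>) ^ f2 \<le> 1"
  shows "measure (perc d (1 - q)) (LIP \<alpha> d (\<lambda>i\<in>{..<d}. 1)) < 1"
proof -
  define m where "m = real (n - K)"
  define Yr where "Yr = real ((K * (b * I)) ^ K)"
  have \<beta>: "\<beta> > 0" "(1 - \<alpha>) * \<beta> = 1" using \<alpha> by auto
  have d0: "real d > 0" using \<kappa> by simp
  have q0: "q > 0" using q C \<epsilon> d0 by simp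
  have \<kappa>0: "\<kappa> > 0" using \<kappa> \<delta> by simp
  have m: "m \<ge> \<kappa> * d" "m \<ge> \<theta>" "m > 0" "m \<le> d"
    using \<kappa> \<theta> n by (auto simp: m_def)
  have lam0: "lam > 0" using lam \<epsilon> \<delta> by simp
  have dm: "real d powr \<beta> \<le> (1 + \<delta>) * m powr \<beta>"
  proof -
    have "(\<kappa> * d) powr \<beta> \<le> m powr \<beta>" using m \<beta> \<kappa>0 d0 by (intro powr_mono2) auto
    moreover have "(\<kappa> * d) powr \<beta> = real d powr \<beta> / (1 + \<delta>)"
    proof -
      have "\<kappa> powr \<beta> = (1 + \<delta>) powr (- 1)" unfolding \<kappa>(1) powr_powr using \<beta> by simp
      then show ?thesis using \<kappa>0 d0 \<delta> by (simp add: powr_mult powr_minus divide_inverse mult.commute)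
    qed
    ultimately show ?thesis using \<delta> by (simp add: divide_le_eq mult.commute)
  qed
  have base: "1 / q + Yr \<le> lam * ((1 - \<delta>) / C * m powr \<beta>)"
  proof -
    have "Yr \<le> \<delta> / q" using Y q0 by (simp add: Yr_def le_divide_eq mult.commute)
    then have "1 / q + Yr \<le> (1 + \<delta>) / q" by (simp add: add_divide_distrib)
    also have "(1 + \<delta>) / q = (1 + \<delta>) / ((1 + \<epsilon>) * C) * real d powr \<beta>"
      unfolding q(1) powr_minus using d0 by (simp add: field_simps)
    also have "\<dots> \<le> (1 + \<delta>) / ((1 + \<epsilon>) * C) * ((1 + \<delta>) * m powr \<beta>)"
      using \<delta> \<epsilon> C by (intro mult_left_mono dm) auto
    also have "\<dots> = lam * ((1 - \<delta>) / C * m powr \<beta>)"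
    proof -
      have "lam * (1 - \<delta>) = (1 + \<delta>)\<^sup>2 / (1 + \<epsilon>)" using \<delta> by (simp add: lam(1))
      then have "lam * ((1 - \<delta>) / C * m powr \<beta>) = (1 + \<delta>)\<^sup>2 / (1 + \<epsilon>) / C * m powr \<beta>"
        by (metis mult.assoc times_divide_eq_right)
      then show ?thesis by (simp add: power2_eq_square mult.assoc)
    qed
    finally show ?thesis .
  qed
  have base0: "0 \<le> 1 / q + Yr" using q0 by (simp add: Yr_def)
  have count: "(1 / q + Yr) ^ (b * i) \<le> lam ^ (b * i) * (real d / \<theta>) ^ f2 * real (card (stretch n K b \<phi> i))" for i
  proof -
    have "(1 / q + Yr) ^ (b * i) \<le> (lam * ((1 - \<delta>) / C * m powr \<beta>)) ^ (b * i)"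
      by (intro power_mono base base0)
    also have "\<dots> = lam ^ (b * i) * ((1 - \<delta>) / C * m powr \<beta>) ^ (b * i)" by (rule power_mult_distrib)
    also have "\<dots> \<le> lam ^ (b * i) * ((m / \<theta>) ^ f2 * real (card (stretch n K b \<phi> i)))"
      using card_stretch_ge[OF n(2) \<theta> m(2)[unfolded m_def] C \<delta> \<phi> a, of i] lam0
      unfolding m_def[symmetric] by (intro mult_left_mono) auto
    also have "\<dots> \<le> lam ^ (b * i) * ((real d / \<theta>) ^ f2 * real (card (stretch n K b \<phi> i)))"
      using m \<theta> lam0 by (intro mult_left_mono mult_right_mono power_mono divide_right_mono) auto
    finally show ?thesis by (simp add: mult.assoc)
  qed
  show ?thesis
  proof (rule no_surface_criterion[OF q0 q(2) \<alpha>(2)])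
    show "n \<ge> 1" "n + G * s \<le> d" using m n by (auto simp: m_def)
    show "\<Gamma> \<ge> 0" unfolding \<Gamma>(1) using \<theta> by simp
    fix i assume "i < I"
    have "real (card (steps n K)) \<le> real d ^ K"
    proof -
      have "card (steps n K) \<le> d ^ K"
        by (rule order_trans[OF card_steps_le power_mono]) (use n in auto)
      then show ?thesis by (metis of_nat_le_iff of_nat_power)
    qed
    then have N: "real (card (steps n K)) ^ b \<le> (real d ^ K) ^ b" by (rule power_mono) simp
    have "lam ^ (b * Suc i) \<le> 1" using lam lam0 by (intro power_le_one) auto
    then have "(1 / q + Yr) ^ (b * Suc i) \<le> 1 * (real d / \<theta>) ^ f2 * real (card (stretch n K b \<phi> (Suc i)))"
      using \<theta> by (intro order_trans[OF count] mult_right_mono) auto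
    then have "real b * (1 / q + Yr) ^ (b * Suc i) * real (card (steps n K)) ^ b
        \<le> real b * (1 * (real d / \<theta>) ^ f2 * real (card (stretch n K b \<phi> (Suc i)))) * (real d ^ K) ^ b"
      using N \<theta> base0 by (intro mult_mono) (auto intro!: mult_nonneg_nonneg zero_le_power)
    then show "real b * (1 / q + real ((K * (b * I)) ^ K)) ^ (b * Suc i) * real (card (steps n K)) ^ b
        \<le> \<Gamma> * real (card (stretch n K b \<phi> (Suc i)))"
      unfolding \<Gamma>(1) Yr_def by (simp only: mult_1 mult_ac)
  next
    have "(1 / q) ^ z * (1 / q + Yr) ^ (b * I)
        \<le> (1 / q) ^ z * (lam ^ (b * I) * (real d / \<theta>) ^ f2 * real (card (stretch n K b \<phi> I)))"
      using q0 by (intro mult_left_mono count) auto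
    also have "\<dots> = ((1 / q) ^ z * lam ^ (b * I) * (real d / \<theta>) ^ f2) * real (card (stretch n K b \<phi> I))"
      by (simp only: mult.assoc)
    also have "\<dots> \<le> 1 * real (card (stretch n K b \<phi> I))" by (intro mult_right_mono z) simp
    finally show "(1 / q) ^ z * (1 / q + real ((K * (b * I)) ^ K)) ^ (b * I) \<le> real (card (stretch n K b \<phi> I))"
      by (simp add: Yr_def)
  next
    have "real (\<Sum>j<I. \<phi> j) \<le> (\<beta> * real b) * I + real f2" using \<phi>(2)[of I] by linarith
    then have "(1 - \<alpha>) * (real (\<Sum>j<I. \<phi> j) + real G) \<le> (1 - \<alpha>) * ((\<beta> * real b) * I + real f2 + real G)"
      using \<alpha> by (intro mult_left_mono) auto
    also have "\<dots> = ((1 - \<alpha>) * \<beta>) * (real b * I) + (1 - \<alpha>) * (real f2 + real G)" by (simp add: algebra_simps)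
    also have "\<dots> \<le> real b * I + 1 * (real f2 + real G)"
      unfolding \<beta>(2) using \<alpha> by (intro add_mono mult_right_mono) auto
    finally show "(1 - \<alpha>) * (real (\<Sum>j<I. \<phi> j) + real G) + 1 \<le> real (b * I + z)" using G by simp
  qed (use pos G \<Gamma> in auto)
qed

text \<open>The constants are chosen in this order: \<open>\<delta>\<close> so that \<open>lam < 1\<close>; then \<open>K\<close>, \<open>b\<close> and the block sizes; then the number
\<open>G\<close> of reserved groups, which has to beat the power \<open>f2 + K b + 1\<close> of \<open>d\<close> in the weight of a superblock; then the
number \<open>z\<close> of additional drops, which pays for the reserved steps; and finally \<open>A\<close> so large that superblocks of
\<open>A ln d\<close> blocks pay for \<open>z\<close>.\<close>

lemma eventually_q_L_le:
  fixes \<alpha> \<beta> C \<epsilon> :: real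
  assumes \<alpha>: "0 \<le> \<alpha>" "\<alpha> < 1" "\<beta> = 1 / (1 - \<alpha>)" and C: "C > 0" and \<epsilon>: "0 < \<epsilon>" "\<epsilon> \<le> 1"
    and blocks: "entropy_blocks \<beta> C"
  shows "\<forall>\<^sub>F d in sequentially. q_L \<alpha> d d \<le> (1 + \<epsilon>) * C * real d powr (- \<beta>)"
proof -
  \<comment> \<open>Small enough for \<open>(1 + \<delta>)\<^sup>2 < (1 + \<epsilon>) * (1 - \<delta>)\<close>.\<close>
  define \<delta> where "\<delta> = \<epsilon> / 10"
  have \<delta>: "0 < \<delta>" "\<delta> < 1" using \<epsilon> by (auto simp: \<delta>_def)
  obtain K b f1 f2 \<theta> where pos: "K \<ge> 1" "b \<ge> 1" and \<theta>: "\<theta> > 0"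
    and f: "real f1 \<le> \<beta> * real b" "\<beta> * real b \<le> real f2"
    and a: "\<forall>f\<in>{f1, f2}. ((1 - \<delta>) / C) ^ b \<le> exp_poly_coeff K b f * \<theta> powr (real f - \<beta> * real b)"
    using blocks \<delta> unfolding entropy_blocks_def by blast
  obtain \<phi> :: "nat \<Rightarrow> nat" where \<phi>: "\<And>j. \<phi> j \<in> {f1, f2}" "\<And>i. \<bar>real (\<Sum>j<i. \<phi> j) - (\<beta> * real b) * i\<bar> \<le> real f2"
    using balanced_sequence[OF f] by blast
  have \<beta>: "\<beta> > 0" using \<alpha> by simp
  define lam where "lam = (1 + \<delta>)\<^sup>2 / ((1 + \<epsilon>) * (1 - \<delta>))"
  have lam: "0 < lam" "lam < 1"
  proof -
    show "0 < lam" using \<delta> \<epsilon> by (simp add: lam_def)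
    have "\<delta>\<^sup>2 \<le> \<delta> * (1 / 10)" using \<epsilon> by (auto simp: \<delta>_def power2_eq_square)
    moreover have "(1 + \<epsilon>) * (1 - \<delta>) = 1 + 9 * \<delta> - 10 * \<delta>\<^sup>2" by (simp add: \<delta>_def field_simps power2_eq_square)
    moreover have "(1 + \<delta>)\<^sup>2 = 1 + 2 * \<delta> + \<delta>\<^sup>2" by (simp add: power2_sum)
    ultimately have "(1 + \<delta>)\<^sup>2 < (1 + \<epsilon>) * (1 - \<delta>)" using \<delta> by linarith
    then show "lam < 1" using \<delta> \<epsilon> by (simp add: lam_def)
  qed
  define e where "e = f2 + K * b + 2"
  define G where "G = 4 + 3 * e"
  define z where "z = f2 + G + 1"
  \<comment> \<open>Chosen such that \<open>lam\<close> to the power \<open>A * ln d\<close> is \<open>d\<close> to the power \<open>- (\<beta> * z + f2 + 1)\<close>.\<close>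
  define A where "A = (\<beta> * z + f2 + 1) / (- ln lam)"
  have A: "A > 0" unfolding A_def using lam \<beta> by (intro divide_pos_pos) (auto intro: add_nonneg_pos)
  have Alam: "A * ln lam = - (\<beta> * z + f2 + 1)" unfolding A_def using lam by (simp add: field_simps)
  define \<kappa> where "\<kappa> = (1 + \<delta>) powr (- 1 / \<beta>)"
  have \<kappa>: "0 < \<kappa>" "\<kappa> < 1"
    using \<delta> \<beta> powr_less_mono[of "- 1 / \<beta>" 0 "1 + \<delta>"] by (auto simp: \<kappa>_def divide_neg_pos)
  define q where "q d = (1 + \<epsilon>) * C * real d powr (- \<beta>)" for d :: nat
  define I where "I d = nat \<lceil>A * ln (real d)\<rceil> + 1" for d :: nat
  \<comment> \<open>Groups large enough that three of them beat a factor \<open>d\<close>, yet negligible in comparison with \<open>d\<close>.\<close>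
  define s where "s d = nat \<lceil>real d powr (1 / 3)\<rceil>" for d :: nat
  define Q where "Q = (1 / ((1 + \<epsilon>) * C)) ^ z * (1 / \<theta>) ^ f2"
  have E1: "\<forall>\<^sub>F d in sequentially. real d powr (1 / 3) > 1" by real_asymp
  have "(\<lambda>d. (real G * (real d powr (1 / 3) + 1) + real K) / real d) \<longlonglongrightarrow> 0" by real_asymp
  then have E2: "\<forall>\<^sub>F d in sequentially. (real G * (real d powr (1 / 3) + 1) + real K) / real d < 1 - \<kappa>"
    using \<kappa> by (intro order_tendstoD) auto
  have E3: "\<forall>\<^sub>F d in sequentially. \<theta> / \<kappa> + 1 / \<kappa> \<le> real d" by real_asymp
  have "(\<lambda>d. (1 + \<epsilon>) * C * real d powr (- \<beta>)) \<longlonglongrightarrow> 0" using \<beta> by real_asymp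
  then have E4: "\<forall>\<^sub>F d in sequentially. q d < 1" unfolding q_def by (rule order_tendstoD) simp
  have "(\<lambda>d. (1 + \<epsilon>) * C * ((real K * real b * (A * ln (real d) + 2)) ^ K * real d powr (- \<beta>))) \<longlonglongrightarrow> (1 + \<epsilon>) * C * 0"
    using pos A \<beta> by (intro tendsto_mult tendsto_const) real_asymp
  then have E5: "\<forall>\<^sub>F d in sequentially. (1 + \<epsilon>) * C * ((real K * real b * (A * ln (real d) + 2)) ^ K * real d powr (- \<beta>)) < \<delta>"
    using \<delta> by (intro order_tendstoD) auto
  have E6: "\<forall>\<^sub>F d in sequentially. A * ln (real d) + 2 \<le> real d" using A by real_asymp
  have E7: "\<forall>\<^sub>F d in sequentially. 4 + 2 * (real b * (1 / \<theta>) ^ f2) \<le> real d" by real_asymp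
  have E8: "\<forall>\<^sub>F d in sequentially. Q \<le> real d" by real_asymp
  have E9: "\<forall>\<^sub>F d in sequentially. d \<ge> (1 :: nat)" by (rule eventually_ge_at_top)
  from E1 E2 E3 E4 E5 E6 E7 E8 E9 show ?thesis
  proof eventually_elim
    case (elim d)
    have d: "real d \<ge> 1" using elim(9) by simp
    then have ln0: "0 \<le> A * ln (real d)" using A by simp
    have I: "A * ln (real d) \<le> real (I d)" "real (I d) \<le> A * ln (real d) + 2" "I d \<ge> 1"
      unfolding I_def using ln0 by linarith+
    have s: "real d powr (1 / 3) \<le> real (s d)" "real (s d) \<le> real d powr (1 / 3) + 1" "s d \<ge> 2"
      unfolding s_def using elim(1) by linarith+
    define n where "n = d - G * s d"
    have room: "real G * real (s d) + real K \<le> (1 - \<kappa>) * real d"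
    proof -
      have "real G * real (s d) \<le> real G * (real d powr (1 / 3) + 1)" using s by (intro mult_left_mono) auto
      moreover have "real G * (real d powr (1 / 3) + 1) + real K \<le> (1 - \<kappa>) * real d"
        using elim(2) d by (simp add: divide_less_eq)
      ultimately show ?thesis by linarith
    qed
    have "real (G * s d + K) \<le> real d"
    proof -
      have "(1 - \<kappa>) * real d \<le> real d" using \<kappa> by (simp add: mult_left_le_one_le)
      then show ?thesis using room by simp
    qed
    then have Gs: "G * s d + K \<le> d" by (simp only: of_nat_le_iff)
    then have n: "n + G * s d = d" "K \<le> n" by (auto simp: n_def)
    have nK: "\<kappa> * d \<le> real (n - K)"
    proof -
      have "real (n - K) = real d - real G * real (s d) - real K" using n(2) Gs by (simp add: n_def of_nat_diff)
      then show ?thesis using room by (simp add: algebra_simps)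
    qed
    have \<kappa>d: "\<theta> \<le> \<kappa> * d"
    proof -
      have "(\<theta> + 1) / \<kappa> \<le> real d" using elim(3) by (simp add: add_divide_distrib)
      then have "\<theta> + 1 \<le> \<kappa> * d" using \<kappa> by (simp add: divide_le_eq mult.commute)
      then show ?thesis by simp
    qed
    have q0: "q d > 0" using d C \<epsilon> by (simp add: q_def)
    have Y: "q d * real ((K * (b * I d)) ^ K) \<le> \<delta>"
    proof -
      have "real ((K * (b * I d)) ^ K) = (real K * real b * real (I d)) ^ K" by (simp add: mult.assoc)
      also have "\<dots> \<le> (real K * real b * (A * ln (real d) + 2)) ^ K"
        using I by (intro power_mono mult_left_mono) auto
      finally have "q d * real ((K * (b * I d)) ^ K) \<le> q d * (real K * real b * (A * ln (real d) + 2)) ^ K"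
        using q0 by (intro mult_left_mono) auto
      also have "\<dots> = (1 + \<epsilon>) * C * ((real K * real b * (A * ln (real d) + 2)) ^ K * real d powr (- \<beta>))"
        by (simp add: q_def)
      finally show ?thesis using elim(5) by linarith
    qed
    define \<Gamma> where "\<Gamma> = real b * (real d / \<theta>) ^ f2 * (real d ^ K) ^ b"
    have \<Gamma>0: "\<Gamma> \<ge> 0" using \<theta> by (simp add: \<Gamma>_def)
    have \<Gamma>: "2 * (2 + real (I d) * \<Gamma>) \<le> real (s d) ^ (G - 4)"
    proof -
      define k where "k = real b * (1 / \<theta>) ^ f2"
      have \<Gamma>k: "\<Gamma> = k * real d ^ (f2 + K * b)"
        by (simp add: \<Gamma>_def k_def power_divide power_add power_mult)
      have Id: "real (I d) \<le> real d" using I elim(6) by linarith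
      have "2 * (2 + real (I d) * \<Gamma>) \<le> 2 * (2 + real d * \<Gamma>)"
        using Id \<Gamma>0 by (intro mult_left_mono add_left_mono mult_right_mono) auto
      also have "\<dots> = 4 + 2 * k * real d ^ (f2 + K * b + 1)" by (simp add: \<Gamma>k)
      also have "\<dots> \<le> 4 * real d ^ (f2 + K * b + 1) + 2 * k * real d ^ (f2 + K * b + 1)"
      proof -
        have "1 \<le> real d ^ (f2 + K * b + 1)" using d by (rule one_le_power)
        then show ?thesis by linarith
      qed
      also have "\<dots> = (4 + 2 * k) * real d ^ (f2 + K * b + 1)" by (simp only: distrib_right)
      also have "\<dots> \<le> real d * real d ^ (f2 + K * b + 1)"
        using elim(7) by (intro mult_right_mono) (auto simp: k_def)
      also have "\<dots> = real d ^ e" by (simp add: e_def)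
      also have "\<dots> \<le> (real (s d) ^ 3) ^ e"
      proof (rule power_mono)
        have "(real d powr (1 / 3)) ^ 3 = real d" using d by (simp add: powr_powr flip: powr_realpow)
        then show "real d \<le> real (s d) ^ 3" using power_mono[OF s(1), of 3] by simp
      qed simp
      also have "\<dots> = real (s d) ^ (G - 4)" by (simp add: G_def power_mult)
      finally show ?thesis .
    qed
    have zb: "(1 / q d) ^ z * lam ^ (b * I d) * (real d / \<theta>) ^ f2 \<le> 1"
    proof -
      have qz: "(1 / q d) ^ z = (1 / ((1 + \<epsilon>) * C)) ^ z * real d powr (\<beta> * z)"
      proof -
        have "1 / q d = 1 / ((1 + \<epsilon>) * C) * real d powr \<beta>"
          using d by (simp add: q_def powr_minus divide_inverse)
        then have "(1 / q d) ^ z = (1 / ((1 + \<epsilon>) * C)) ^ z * (real d powr \<beta>) ^ z"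
          by (simp only: power_mult_distrib)
        moreover have "(real d powr \<beta>) ^ z = real d powr (\<beta> * z)"
          using d by (simp add: powr_powr flip: powr_realpow)
        ultimately show ?thesis by simp
      qed
      have "lam ^ (b * I d) \<le> lam ^ I d" using lam pos by (intro power_decreasing) auto
      also have "\<dots> = lam powr real (I d)" using lam by (simp add: powr_realpow)
      also have "\<dots> \<le> lam powr (A * ln (real d))" using lam I by (intro powr_mono') auto
      also have "\<dots> = real d powr (A * ln lam)" using lam d by (simp add: powr_def mult_ac)
      also have "\<dots> = real d powr (- (\<beta> * z + f2 + 1))" unfolding Alam ..
      finally have "lam ^ (b * I d) \<le> real d powr (- (\<beta> * z + f2 + 1))" .
      then have "(1 / q d) ^ z * lam ^ (b * I d) * (real d / \<theta>) ^ f2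
          \<le> (1 / q d) ^ z * real d powr (- (\<beta> * z + f2 + 1)) * (real d / \<theta>) ^ f2"
        using q0 \<theta> by (intro mult_right_mono mult_left_mono) auto
      also have "\<dots> = Q * (real d powr (\<beta> * z) * real d powr (- (\<beta> * z + f2 + 1)) * real d powr (real f2))"
        unfolding qz Q_def using d by (simp add: power_divide powr_realpow)
      also have "\<dots> = Q * real d powr (- 1)" using d by (simp flip: powr_add)
      also have "\<dots> = Q / real d" using d by (simp add: powr_minus divide_inverse)
      also have "\<dots> \<le> 1" using elim(8) d by (simp add: divide_le_eq)
      finally show ?thesis .
    qed
    have "measure (perc d (1 - q d)) (LIP \<alpha> d (\<lambda>i\<in>{..<d}. 1)) < 1"
      by (rule no_surface_at_density[OF \<alpha> C \<epsilon>(1) \<delta> pos I(3) s(3) \<theta> a \<phi> lam_def less_imp_le[OF lam(2)] q_def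
        less_imp_le[OF elim(4)] n \<kappa>_def nK \<kappa>d _ Y _ z_def \<Gamma>_def \<Gamma> zb]) (use elim(9) in \<open>auto simp: G_def\<close>)
    then have "q_L \<alpha> d d \<le> q d" using q0 elim(4) by (intro q_L_le) auto
    then show ?case by (simp add: q_def)
  qed
qed

lemma asymp_le_powr:
  fixes f :: "nat \<Rightarrow> real"
  assumes C: "C > 0" and le: "\<And>\<epsilon>. 0 < \<epsilon> \<Longrightarrow> \<epsilon> \<le> 1 \<Longrightarrow> \<forall>\<^sub>F d in sequentially. f d \<le> (1 + \<epsilon>) * C * real d powr r"
  shows "asymp_le sequentially f (\<lambda>d. C * real d powr r)"
  unfolding asymp_le_def
proof (rule ereal_le_epsilon2)
  fix e :: real assume e: "0 < e"
  define \<epsilon> where "\<epsilon> = min e 1"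
  have \<epsilon>: "0 < \<epsilon>" "\<epsilon> \<le> 1" "\<epsilon> \<le> e" using e by (auto simp: \<epsilon>_def)
  have "\<forall>\<^sub>F d in sequentially. ereal (f d / (C * real d powr r)) \<le> ereal (1 + e)"
    using le[OF \<epsilon>(1,2)] eventually_gt_at_top[of "0 :: nat"]
  proof eventually_elim
    case (elim d)
    have p: "C * real d powr r > 0" using C elim(2) by simp
    have "f d / (C * real d powr r) \<le> 1 + \<epsilon>" using elim(1) p by (simp add: divide_le_eq mult.assoc)
    then show ?case using \<epsilon> by simp
  qed
  then have "Limsup sequentially (\<lambda>d. ereal (f d / (C * real d powr r))) \<le> ereal (1 + e)"
    by (rule Limsup_bounded)
  then show "Limsup sequentially (\<lambda>d. ereal (f d / (C * real d powr r))) \<le> 1 + ereal e"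
    by (simp add: one_ereal_def)
qed

theorem proposition3p6:
  fixes \<alpha> :: real
  assumes "0 \<le> \<alpha>" and "\<alpha> < 1"
  shows "\<exists>C>0.
    asymp_le sequentially (\<lambda>d. q_L \<alpha> d d) (\<lambda>d. C * real d powr (- 1 / (1 - \<alpha>))) \<and>
    (\<alpha> = 0 \<longrightarrow> C = 1) \<and>
    (\<alpha> > 0 \<longrightarrow>
      (\<exists>!\<theta>::real. \<theta> \<noteq> 0 \<and> \<theta> * exp \<theta> / (exp \<theta> - 1) = 1 / (1 - \<alpha>)) \<and>
      (\<forall>\<theta>::real. \<theta> \<noteq> 0 \<and> \<theta> * exp \<theta> / (exp \<theta> - 1) = 1 / (1 - \<alpha>) \<longrightarrow>
         C = \<theta> powr (1 / (1 - \<alpha>)) / (exp \<theta> - 1)))"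
proof -
  define \<beta> where "\<beta> = 1 / (1 - \<alpha>)"
  have upper: "asymp_le sequentially (\<lambda>d. q_L \<alpha> d d) (\<lambda>d. C * real d powr (- 1 / (1 - \<alpha>)))"
    if "C > 0" "entropy_blocks \<beta> C" for C
  proof -
    have "\<forall>\<^sub>F d in sequentially. q_L \<alpha> d d \<le> (1 + \<epsilon>) * C * real d powr (- \<beta>)" if "0 < \<epsilon>" "\<epsilon> \<le> 1" for \<epsilon>
      using eventually_q_L_le[OF assms \<beta>_def \<open>C > 0\<close> that \<open>entropy_blocks \<beta> C\<close>] .
    from asymp_le_powr[OF \<open>C > 0\<close> this] show ?thesis by (simp add: \<beta>_def)
  qed
  show ?thesis
  proof (cases "\<alpha> = 0")
    case True
    then have "entropy_blocks \<beta> 1" using entropy_blocks_one by (simp add: \<beta>_def)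
    then show ?thesis using upper[of 1] True by (intro exI[of _ 1]) simp
  next
    case False
    then have \<beta>: "\<beta> > 1" using assms by (simp add: \<beta>_def)
    obtain \<theta> where \<theta>: "\<theta> > 0" "tp_mean \<theta> = \<beta>" using tp_mean_solution[OF \<beta>] .
    define C where "C = \<theta> powr \<beta> / (exp \<theta> - 1)"
    have C: "C > 0" using \<theta> by (simp add: C_def)
    have "entropy_blocks \<beta> C" unfolding C_def by (rule entropy_blocks_tp_mean[OF \<theta> \<beta>])
    note up = upper[OF C this]
    have ex1: "\<exists>!\<theta>::real. \<theta> \<noteq> 0 \<and> \<theta> * exp \<theta> / (exp \<theta> - 1) = 1 / (1 - \<alpha>)"
      using tp_mean_unique_solution[OF \<beta>] by (simp add: \<beta>_def)
    moreover have sol: "\<theta> \<noteq> 0 \<and> \<theta> * exp \<theta> / (exp \<theta> - 1) = 1 / (1 - \<alpha>)"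
      using \<theta> by (simp add: tp_mean_def \<beta>_def)
    ultimately have "C = t powr (1 / (1 - \<alpha>)) / (exp t - 1)"
      if "t \<noteq> 0 \<and> t * exp t / (exp t - 1) = 1 / (1 - \<alpha>)" for t
      using that unfolding C_def \<beta>_def by blast
    then show ?thesis using C up ex1 False by (intro exI[of _ C]) simp
  qed
qed

end
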